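(* The following problem is undecidable: given finite alphabets $A,B$ and a timed automaton recognising (with Büchi acceptance) a timed $\omega$-language $W\subseteq(A\times B\times\mathbb R_{\ge0})^\omega$ over $A\times B$, decide whether there exist $k,m\in\mathbb N$ such that Player II has a winning $k,m$-controller in the timed synthesis game $G(A,B,W)$. This remains undecidable when the input automaton for $W$ is restricted to have one clock and no $\varepsilon$-transitions.
   Context: Timed words: sequences $(a_1,t_1)(a_2,t_2)\cdots$ with $0\le t_1\le t_2\le\cdots$ reals. Clock constraints over clocks $X$: Boolean combinations of $x\sim z$, $x-y\sim z$ ($z\in\mathbb Z$, $\sim\in\{<,\le,=,\ge,>\}$). A timed automaton (possibly with $\varepsilon$-transitions) $(\Sigma,L,X,I,F,\Delta)$ has rules $(p,a,\varphi,Y,q)$, $a\in\Sigma\cup\{\varepsilon\}$, taken after time elapse when the valuation satisfies $\varphi$, resetting $Y$; runs start in $I$ with all clocks $0$; its timed $\omega$-language consists of infinite timed words over $\Sigma$ obtained by deleting $\varepsilon$-letters from words of runs visiting $F$ infinitely often. Regions: for clocks $X$ and $m$, valuations are equivalent if they satisfy the same constraints over $X$ with constants of absolute value $\le m$. Game $G(A,B,W)$: in rounds Player I picks $a_i\in A$, $t_i\ge t_{i-1}$ ($t_0=0$), Player II answers $b_i\in B$; Player I wins iff $(a_1,b_1,t_1)(a_2,b_2,t_2)\cdots\in W$. A $k,m$-controller is $(A,B,L,\ell_0,\delta)$ with finite $L$, $k$ clocks $X$, $\delta:L\times A\times\mathrm{Regions}(X,m)\to L\times B\times 2^X$; from $(\ell_n,\mu_n)$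 (initially $\ell_0$ and all clocks $0$), on $(a_{n+1},t_{n+1})$, with $\nu=\mu_n+(t_{n+1}-t_n)$ and $\delta(\ell_n,a_{n+1},[\nu])=(\ell',b,Y)$, it answers $b$ and moves to $\ell'$ and $\nu$ with $Y$ reset to $0$. It is winning if no consistent infinite play lies in $W$. *)

theory Defs
  imports Complex_Main "HOL-Library.Nat_Bijection"
begin

datatype recf = RZ | RS | RId nat | RCn recf "recf list" | RPr recf recf | RMn recf

inductive eval :: "recf \<Rightarrow> nat list \<Rightarrow> nat \<Rightarrow> bool" where
  eval_Z: "eval RZ xs 0"
| eval_S: "eval RS (x # xs) (Suc x)"
| eval_Id: "n < length xs \<Longrightarrow> eval (RId n) xs (xs ! n)"
| eval_Cn: "list_all2 (\<lambda>g y. eval g xs y) gs ys \<Longrightarrow> eval f ys z \<Longrightarrow> eval (RCn f gs) xs z"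
| eval_Pr0: "eval f xs z \<Longrightarrow> eval (RPr f g) (0 # xs) z"
| eval_PrS: "eval (RPr f g) (n # xs) y \<Longrightarrow> eval g (n # y # xs) z
             \<Longrightarrow> eval (RPr f g) (Suc n # xs) z"
| eval_Mn: "eval f (n # xs) 0 \<Longrightarrow> (\<forall>j<n. \<exists>y. eval f (j # xs) (Suc y))
             \<Longrightarrow> eval (RMn f) xs n"

definition decidable_on :: "'a set \<Rightarrow> ('a \<Rightarrow> nat) \<Rightarrow> ('a \<Rightarrow> bool) \<Rightarrow> bool" where
  "decidable_on D enc P \<longleftrightarrow> (\<exists>f. \<forall>x\<in>D. eval f [enc x] (if P x then 1 else 0))"

datatype cmp = CLt | CLe | CEq | CGe | CGt

fun cmp_sem :: "cmp \<Rightarrow> real \<Rightarrow> real \<Rightarrow> bool" where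
  "cmp_sem CLt a b = (a < b)"
| "cmp_sem CLe a b = (a \<le> b)"
| "cmp_sem CEq a b = (a = b)"
| "cmp_sem CGe a b = (a \<ge> b)"
| "cmp_sem CGt a b = (a > b)"

datatype ccon = CTrue | CAtom nat cmp int | CDiag nat nat cmp int | CNot ccon | CAnd ccon ccon

type_synonym valuation = "nat \<Rightarrow> real"

fun sat :: "valuation \<Rightarrow> ccon \<Rightarrow> bool" where
  "sat v CTrue = True"
| "sat v (CAtom x c z) = cmp_sem c (v x) (of_int z)"
| "sat v (CDiag x y c z) = cmp_sem c (v x - v y) (of_int z)"
| "sat v (CNot \<phi>) = (\<not> sat v \<phi>)"
| "sat v (CAnd \<phi> \<psi>) = (sat v \<phi> \<and> sat v \<psi>)"

fun ccon_clocks :: "ccon \<Rightarrow> nat set" where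
  "ccon_clocks CTrue = {}"
| "ccon_clocks (CAtom x c z) = {x}"
| "ccon_clocks (CDiag x y c z) = {x, y}"
| "ccon_clocks (CNot \<phi>) = ccon_clocks \<phi>"
| "ccon_clocks (CAnd \<phi> \<psi>) = ccon_clocks \<phi> \<union> ccon_clocks \<psi>"

fun ccon_consts :: "ccon \<Rightarrow> int set" where
  "ccon_consts CTrue = {}"
| "ccon_consts (CAtom x c z) = {z}"
| "ccon_consts (CDiag x y c z) = {z}"
| "ccon_consts (CNot \<phi>) = ccon_consts \<phi>"
| "ccon_consts (CAnd \<phi> \<psi>) = ccon_consts \<phi> \<union> ccon_consts \<psi>"

definition delay :: "valuation \<Rightarrow> real \<Rightarrow> valuation" where
  "delay v d = (\<lambda>x. v x + d)"

definition reset :: "nat set \<Rightarrow> valuation \<Rightarrow> valuation" where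
  "reset Y v = (\<lambda>x. if x \<in> Y then 0 else v x)"

definition region_equiv :: "nat \<Rightarrow> nat \<Rightarrow> valuation \<Rightarrow> valuation \<Rightarrow> bool" where
  "region_equiv k m v v' \<longleftrightarrow>
     (\<forall>\<phi>. ccon_clocks \<phi> \<subseteq> {..<k} \<and> (\<forall>z\<in>ccon_consts \<phi>. \<bar>z\<bar> \<le> int m)
           \<longrightarrow> (sat v \<phi> \<longleftrightarrow> sat v' \<phi>))"

definition region :: "nat \<Rightarrow> nat \<Rightarrow> valuation \<Rightarrow> valuation set" where
  "region k m v = {v'. region_equiv k m v v'}"

text \<open>A rule (p, a, guard, Y, q); the letter None stands for epsilon.
  Letters of the alphabet A \<times> B are pairs of naturals.\<close>
type_synonym rule = "nat \<times> (nat \<times> nat) option \<times> ccon \<times> nat list \<times> nat"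

definition rule_src :: "rule \<Rightarrow> nat" where "rule_src r = (case r of (p,a,g,Y,q) \<Rightarrow> p)"
definition rule_letter :: "rule \<Rightarrow> (nat \<times> nat) option" where "rule_letter r = (case r of (p,a,g,Y,q) \<Rightarrow> a)"
definition rule_guard :: "rule \<Rightarrow> ccon" where "rule_guard r = (case r of (p,a,g,Y,q) \<Rightarrow> g)"
definition rule_resets :: "rule \<Rightarrow> nat set" where "rule_resets r = (case r of (p,a,g,Y,q) \<Rightarrow> set Y)"
definition rule_tgt :: "rule \<Rightarrow> nat" where "rule_tgt r = (case r of (p,a,g,Y,q) \<Rightarrow> q)"

text \<open>Locations {0..<ta_nloc}, clocks {0..<ta_nclk}, initial locations, accepting
  locations, rules.\<close>
record ta =
  ta_nloc :: nat
  ta_nclk :: nat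
  ta_init :: "nat list"
  ta_fin :: "nat list"
  ta_rules :: "rule list"

text \<open>Valuation after the first i transitions; T i is the time of the i-th
  configuration (T 0 = 0) and transition i fires at time T (Suc i).\<close>
fun run_val :: "(nat \<Rightarrow> rule) \<Rightarrow> (nat \<Rightarrow> real) \<Rightarrow> nat \<Rightarrow> valuation" where
  "run_val rl T 0 = (\<lambda>_. 0)"
| "run_val rl T (Suc i) = reset (rule_resets (rl i)) (delay (run_val rl T i) (T (Suc i) - T i))"

definition ta_run :: "ta \<Rightarrow> (nat \<Rightarrow> nat) \<Rightarrow> (nat \<Rightarrow> real) \<Rightarrow> (nat \<Rightarrow> rule) \<Rightarrow> bool" where
  "ta_run A loc T rl \<longleftrightarrow>
     loc 0 \<in> set (ta_init A) \<and> T 0 = 0 \<and>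
     (\<forall>i. T i \<le> T (Suc i) \<and> rl i \<in> set (ta_rules A) \<and>
          rule_src (rl i) = loc i \<and> rule_tgt (rl i) = loc (Suc i) \<and>
          sat (delay (run_val rl T i) (T (Suc i) - T i)) (rule_guard (rl i)))"

text \<open>Timed omega-language (Buchi acceptance): infinite timed words obtained by
  deleting the epsilon letters of an accepting run; g enumerates the non-epsilon
  positions in increasing order.\<close>
definition ta_lang :: "ta \<Rightarrow> (nat \<Rightarrow> (nat \<times> nat) \<times> real) set" where
  "ta_lang A = {w. \<exists>loc T rl g. ta_run A loc T rl \<and>
       (\<exists>\<^sub>\<infinity>i. loc i \<in> set (ta_fin A)) \<and>
       strict_mono g \<and> range g = {i. rule_letter (rl i) \<noteq> None} \<and>
       (\<forall>j. w j = (the (rule_letter (rl (g j))), T (Suc (g j))))}"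

definition wf_ta :: "nat \<Rightarrow> nat \<Rightarrow> ta \<Rightarrow> bool" where
  "wf_ta na nb A \<longleftrightarrow>
     set (ta_init A) \<subseteq> {..<ta_nloc A} \<and> set (ta_fin A) \<subseteq> {..<ta_nloc A} \<and>
     (\<forall>r\<in>set (ta_rules A).
        rule_src r < ta_nloc A \<and> rule_tgt r < ta_nloc A \<and>
        (\<forall>a b. rule_letter r = Some (a, b) \<longrightarrow> a < na \<and> b < nb) \<and>
        ccon_clocks (rule_guard r) \<subseteq> {..<ta_nclk A} \<and>
        rule_resets r \<subseteq> {..<ta_nclk A})"

type_synonym ctrl_fun = "nat \<Rightarrow> nat \<Rightarrow> valuation set \<Rightarrow> nat \<times> nat \<times> nat set"

text \<open>Transition function delta : L \<times> A \<times> Regions(X,m) \<rightarrow> L \<times> B \<times> 2^X,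
  with X = {0..<k}; locations are natural numbers forming a finite set L.\<close>
definition valid_controller ::
  "nat set \<Rightarrow> nat set \<Rightarrow> nat \<Rightarrow> nat \<Rightarrow> nat set \<Rightarrow> nat \<Rightarrow> ctrl_fun \<Rightarrow> bool" where
  "valid_controller A B k m L l0 \<delta> \<longleftrightarrow> finite L \<and> l0 \<in> L \<and>
     (\<forall>l\<in>L. \<forall>a\<in>A. \<forall>\<nu>. (\<forall>x<k. 0 \<le> \<nu> x) \<longrightarrow>
        (case \<delta> l a (region k m \<nu>) of (l', b, Y) \<Rightarrow> l' \<in> L \<and> b \<in> B \<and> Y \<subseteq> {..<k}))"

definition prev_time :: "(nat \<Rightarrow> real) \<Rightarrow> nat \<Rightarrow> real" where
  "prev_time t n = (if n = 0 then 0 else t (n - 1))"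

text \<open>State (l_n, mu_n) of the controller after reading the first n moves
  (a 0, t 0), ..., (a (n-1), t (n-1)) of Player I.\<close>
fun ctrl_state :: "ctrl_fun \<Rightarrow> nat \<Rightarrow> nat \<Rightarrow> nat \<Rightarrow> (nat \<Rightarrow> nat) \<Rightarrow> (nat \<Rightarrow> real)
                    \<Rightarrow> nat \<Rightarrow> nat \<times> valuation" where
  "ctrl_state \<delta> k m l0 a t 0 = (l0, (\<lambda>_. 0))"
| "ctrl_state \<delta> k m l0 a t (Suc n) =
     (case ctrl_state \<delta> k m l0 a t n of (l, \<mu>) \<Rightarrow>
        (let \<nu> = delay \<mu> (t n - prev_time t n) in
          (case \<delta> l (a n) (region k m \<nu>) of (l', b, Y) \<Rightarrow> (l', reset Y \<nu>))))"

definition ctrl_answer :: "ctrl_fun \<Rightarrow> nat \<Rightarrow> nat \<Rightarrow> nat \<Rightarrow> (nat \<Rightarrow> nat) \<Rightarrow> (nat \<Rightarrow> real)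
                            \<Rightarrow> nat \<Rightarrow> nat" where
  "ctrl_answer \<delta> k m l0 a t n =
     (case ctrl_state \<delta> k m l0 a t n of (l, \<mu>) \<Rightarrow>
        fst (snd (\<delta> l (a n) (region k m (delay \<mu> (t n - prev_time t n))))))"

definition winning_controller ::
  "nat set \<Rightarrow> nat set \<Rightarrow> (nat \<Rightarrow> (nat \<times> nat) \<times> real) set
     \<Rightarrow> nat \<Rightarrow> nat \<Rightarrow> nat set \<Rightarrow> nat \<Rightarrow> ctrl_fun \<Rightarrow> bool" where
  "winning_controller A B W k m L l0 \<delta> \<longleftrightarrow> valid_controller A B k m L l0 \<delta> \<and>
     (\<forall>a t. (\<forall>i. a i \<in> A) \<and> 0 \<le> t 0 \<and> (\<forall>i. t i \<le> t (Suc i)) \<longrightarrow>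
        (\<lambda>i. ((a i, ctrl_answer \<delta> k m l0 a t i), t i)) \<notin> W)"

text \<open>An instance: (na, nb, automaton), with A = {0..<na}, B = {0..<nb}.\<close>
type_synonym tinst = "nat \<times> nat \<times> ta"

definition wf_instance :: "tinst \<Rightarrow> bool" where
  "wf_instance I = (case I of (na, nb, A) \<Rightarrow> wf_ta na nb A)"

definition one_clock_no_eps :: "tinst \<Rightarrow> bool" where
  "one_clock_no_eps I = (case I of (na, nb, A) \<Rightarrow>
     ta_nclk A = 1 \<and> (\<forall>r\<in>set (ta_rules A). rule_letter r \<noteq> None))"

definition controllable :: "tinst \<Rightarrow> bool" where
  "controllable I = (case I of (na, nb, A) \<Rightarrow>
     (\<exists>k m L l0 \<delta>. winning_controller {..<na} {..<nb} (ta_lang A) k m L l0 \<delta>))"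

fun enc_cmp :: "cmp \<Rightarrow> nat" where
  "enc_cmp CLt = 0" | "enc_cmp CLe = 1" | "enc_cmp CEq = 2" | "enc_cmp CGe = 3" | "enc_cmp CGt = 4"

fun enc_ccon :: "ccon \<Rightarrow> nat" where
  "enc_ccon CTrue = prod_encode (0, 0)"
| "enc_ccon (CAtom x c z) = prod_encode (1, list_encode [x, enc_cmp c, int_encode z])"
| "enc_ccon (CDiag x y c z) = prod_encode (2, list_encode [x, y, enc_cmp c, int_encode z])"
| "enc_ccon (CNot \<phi>) = prod_encode (3, enc_ccon \<phi>)"
| "enc_ccon (CAnd \<phi> \<psi>) = prod_encode (4, prod_encode (enc_ccon \<phi>, enc_ccon \<psi>))"

fun enc_letter :: "(nat \<times> nat) option \<Rightarrow> nat" where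
  "enc_letter None = 0"
| "enc_letter (Some ab) = Suc (prod_encode ab)"

definition enc_rule :: "rule \<Rightarrow> nat" where
  "enc_rule r = (case r of (p, a, g, Y, q) \<Rightarrow>
     list_encode [p, enc_letter a, enc_ccon g, list_encode Y, q])"

definition enc_ta :: "ta \<Rightarrow> nat" where
  "enc_ta A = list_encode [ta_nloc A, ta_nclk A, list_encode (ta_init A),
                           list_encode (ta_fin A), list_encode (map enc_rule (ta_rules A))]"

definition enc_instance :: "tinst \<Rightarrow> nat" where
  "enc_instance I = (case I of (na, nb, A) \<Rightarrow> list_encode [na, nb, enc_ta A])"

end

theory Submission
  imports Defs "HOL-Library.Countable" "HOL-Library.Multiset" "HOL-Library.Infinite_Set"
begin

text \<open>
  The halting problem of counter programs is reduced to the synthesis problem. Player I writes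
  configurations of the program, one per time unit: the tick of a cell is repeated one time unit
  later by the same cell of the next configuration. Player II may claim once that a tick is not
  such a copy, and a false claim is refuted by a one-clock automaton that guesses the original.
  Cells that Player I omits cannot be detected, so that the written computation is lossy. Every
  program step uses up a cell, and when no free cell is left the program is restarted with one
  additional cell. If the program halts, then a round that starts with sufficiently many cells can
  only end in a restart if a cell was lost. So configurations stay bounded, and Player II can
  remember all relevant ticks with finitely many clocks. If it does not halt, configurations
  exceed any number of clocks. Then at some tick no clock of the controller has an integer value,
  and Player I can insert an infinite (Zeno) sequence of illegal ticks just before it that the
  controller cannot tell apart from the legal one; such an infinite configuration without a claim
  wins for Player I.
\<close>

section \<open>Counter programs for recursive functions\<close>

text \<open>The winning condition asks only for positive evidence, and this keeps it within one
  clock: a run can guess an original, reset the clock and measure one time unit, which confirms a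
  single tick as a copy. That all ticks are copies is never tested by the automaton; policing this
  is left to Player II. Without a claim, Player I must enter \<open>LFin\<close>, where letter 0 can
  no longer be read, so an accepted play ends in a configuration with infinitely many cells.
  Distinct copies have distinct originals and the configuration before is finite, hence some tick
  there is not a copy; the question is whether finitely many clocks let Player II notice it.
  Programs consist of increments and loops because the remainders of such a program form a finite
  set that serves directly as a set of control states. No universal program is needed: a program is
  run on the code of its own automaton rules, so the translation of programs into automata never has
  to be computed, only the addition of the rules that depend on the input.\<close>

datatype ins = Inc nat | Loop nat "ins list"

type_synonym store = "nat \<Rightarrow> nat"

fun nstep :: "ins list \<times> store \<Rightarrow> ins list \<times> store" where
  "nstep ([], \<sigma>) = ([], \<sigma>)"
| "nstep (Inc r # Q, \<sigma>) = (Q, \<sigma>(r := Suc (\<sigma> r)))"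
| "nstep (Loop r B # Q, \<sigma>) = (if \<sigma> r = 0 then (Q, \<sigma>) else (B @ Loop r B # Q, \<sigma>(r := \<sigma> r - 1)))"

definition input_store :: "nat \<Rightarrow> store" where
  "input_store x = (\<lambda>_. 0)(0 := x)"

definition halts :: "ins list \<Rightarrow> nat \<Rightarrow> bool" where
  "halts P x \<longleftrightarrow> (\<exists>n. fst ((nstep ^^ n) (P, input_store x)) = [])"

inductive exec :: "ins list \<Rightarrow> store \<Rightarrow> store \<Rightarrow> bool" where
  exec_Nil: "exec [] \<sigma> \<sigma>"
| exec_Inc: "exec Q (\<sigma>(r := Suc (\<sigma> r))) \<tau> \<Longrightarrow> exec (Inc r # Q) \<sigma> \<tau>"
| exec_Loop0: "\<sigma> r = 0 \<Longrightarrow> exec Q \<sigma> \<tau> \<Longrightarrow> exec (Loop r B # Q) \<sigma> \<tau>"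
| exec_LoopS: "\<sigma> r = Suc n \<Longrightarrow> exec B (\<sigma>(r := n)) \<rho> \<Longrightarrow> exec (Loop r B # Q) \<rho> \<tau>
               \<Longrightarrow> exec (Loop r B # Q) \<sigma> \<tau>"

lemma exec_append: "exec P \<sigma> \<rho> \<Longrightarrow> exec Q \<rho> \<tau> \<Longrightarrow> exec (P @ Q) \<sigma> \<tau>"
  by (induction rule: exec.induct) (auto intro: exec.intros)

text \<open>The arbitrary rest \<open>Q\<close> lets the induction pass through loop bodies, which
  run in front of the pending loop.\<close>

lemma exec_nsteps: "exec P \<sigma> \<tau> \<Longrightarrow> \<exists>n. (nstep ^^ n) (P @ Q, \<sigma>) = (Q, \<tau>)"
proof (induction arbitrary: Q rule: exec.induct)
  case (exec_Nil \<sigma>)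
  show ?case by (rule exI[of _ 0]) simp
next
  case (exec_Inc P \<sigma> r \<tau>)
  then obtain n where "(nstep ^^ n) (P @ Q, \<sigma>(r := Suc (\<sigma> r))) = (Q, \<tau>)" by blast
  then show ?case by (intro exI[of _ "Suc n"]) (simp add: funpow_Suc_right del: funpow.simps)
next
  case (exec_Loop0 \<sigma> r P \<tau> B)
  then obtain n where "(nstep ^^ n) (P @ Q, \<sigma>) = (Q, \<tau>)" by blast
  then show ?case using exec_Loop0(1)
    by (intro exI[of _ "Suc n"]) (simp add: funpow_Suc_right del: funpow.simps)
next
  case (exec_LoopS \<sigma> r n B \<rho> P \<tau>)
  obtain i where i: "(nstep ^^ i) (B @ (Loop r B # P) @ Q, \<sigma>(r := n)) = ((Loop r B # P) @ Q, \<rho>)"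
    using exec_LoopS.IH(1) by blast
  obtain j where j: "(nstep ^^ j) ((Loop r B # P) @ Q, \<rho>) = (Q, \<tau>)"
    using exec_LoopS.IH(2) by blast
  have "(nstep ^^ (j + i)) (B @ (Loop r B # P) @ Q, \<sigma>(r := n)) = (Q, \<tau>)"
    using i j by (simp add: funpow_add)
  then have "(nstep ^^ (Suc (j + i))) ((Loop r B # P) @ Q, \<sigma>) = (Q, \<tau>)"
    using exec_LoopS(1) by (simp add: funpow_Suc_right del: funpow.simps)
  then show ?case by blast
qed

lemma exec_single_Inc:
  "exec [Inc r] \<sigma> (\<sigma>(r := Suc (\<sigma> r)))"
  by (auto intro: exec.intros)

lemma exec_Loop_unfold:
  assumes "exec B (\<sigma>(r := n)) \<rho>" "\<sigma> r = Suc n" "exec [Loop r B] \<rho> \<tau>"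
  shows "exec [Loop r B] \<sigma> \<tau>"
  using assms exec_LoopS by blast

section \<open>Macros for clearing, moving and copying registers\<close>

definition clear :: "nat \<Rightarrow> ins list" where
  "clear r = [Loop r []]"

lemma exec_clear: "exec (clear r) \<sigma> (\<sigma>(r := 0))"
proof -
  have "\<forall>\<sigma>. \<sigma> r = n \<longrightarrow> exec [Loop r []] \<sigma> (\<sigma>(r := 0))" for n
  proof (induction n)
    case 0
    show ?case by (simp add: exec_Loop0 exec_Nil fun_upd_idem)
  next
    case (Suc n)
    show ?case
    proof (intro allI impI)
      fix \<sigma> :: store assume "\<sigma> r = Suc n"
      moreover have "exec [Loop r []] (\<sigma>(r := n)) (\<sigma>(r := 0))"
        using Suc[rule_format, of "\<sigma>(r := n)"] by simp
      ultimately show "exec [Loop r []] \<sigma> (\<sigma>(r := 0))"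
        by (rule exec_Loop_unfold[OF exec_Nil])
    qed
  qed
  then show ?thesis by (simp add: clear_def)
qed

definition move :: "nat \<Rightarrow> nat \<Rightarrow> ins list" where
  "move r s = [Loop r [Inc s]]"

lemma exec_move:
  assumes "r \<noteq> s"
  shows "exec (move r s) \<sigma> (\<sigma>(s := \<sigma> s + \<sigma> r, r := 0))"
proof -
  have "\<forall>\<sigma>. \<sigma> r = n \<longrightarrow> exec [Loop r [Inc s]] \<sigma> (\<sigma>(s := \<sigma> s + \<sigma> r, r := 0))" for n
  proof (induction n)
    case 0
    show ?case
    proof (intro allI impI)
      fix \<sigma> :: store assume "\<sigma> r = 0"
      moreover from this have "\<sigma>(s := \<sigma> s + \<sigma> r, r := 0) = \<sigma>" by auto
      ultimately show "exec [Loop r [Inc s]] \<sigma> (\<sigma>(s := \<sigma> s + \<sigma> r, r := 0))"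
        by (simp add: exec_Loop0 exec_Nil)
    qed
  next
    case (Suc n)
    show ?case
    proof (intro allI impI)
      fix \<sigma> :: store assume *: "\<sigma> r = Suc n"
      let ?\<rho> = "\<sigma>(r := n, s := Suc (\<sigma> s))"
      have "?\<rho> r = n" using assms by simp
      with Suc[rule_format, of ?\<rho>]
      have "exec [Loop r [Inc s]] ?\<rho> (?\<rho>(s := ?\<rho> s + ?\<rho> r, r := 0))" by blast
      moreover have "?\<rho>(s := ?\<rho> s + ?\<rho> r, r := 0) = \<sigma>(s := \<sigma> s + \<sigma> r, r := 0)"
        using assms * by auto
      moreover have "exec [Inc s] (\<sigma>(r := n)) ?\<rho>"
        using exec_single_Inc[of s "\<sigma>(r := n)"] assms by simp
      ultimately show "exec [Loop r [Inc s]] \<sigma> (\<sigma>(s := \<sigma> s + \<sigma> r, r := 0))"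
        using * by (metis exec_Loop_unfold)
    qed
  qed
  then show ?thesis by (simp add: move_def)
qed

definition copy :: "nat \<Rightarrow> nat \<Rightarrow> nat \<Rightarrow> ins list" where
  "copy r s tmp = Loop r [Inc s, Inc tmp] # move tmp r"

lemma exec_copy:
  assumes "r \<noteq> s" "r \<noteq> tmp" "s \<noteq> tmp" "\<sigma> tmp = 0"
  shows "exec (copy r s tmp) \<sigma> (\<sigma>(s := \<sigma> s + \<sigma> r))"
proof -
  have "\<forall>\<sigma>. \<sigma> r = n \<longrightarrow> exec [Loop r [Inc s, Inc tmp]] \<sigma> (\<sigma>(s := \<sigma> s + \<sigma> r, tmp := \<sigma> tmp + \<sigma> r, r := 0))" for n
  proof (induction n)
    case 0
    show ?case
    proof (intro allI impI)
      fix \<sigma> :: store assume "\<sigma> r = 0"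
      moreover from this have "\<sigma>(s := \<sigma> s + \<sigma> r, tmp := \<sigma> tmp + \<sigma> r, r := 0) = \<sigma>" by auto
      ultimately show "exec [Loop r [Inc s, Inc tmp]] \<sigma> (\<sigma>(s := \<sigma> s + \<sigma> r, tmp := \<sigma> tmp + \<sigma> r, r := 0))"
        by (simp add: exec_Loop0 exec_Nil)
    qed
  next
    case (Suc n)
    show ?case
    proof (intro allI impI)
      fix \<sigma> :: store assume *: "\<sigma> r = Suc n"
      let ?\<rho> = "\<sigma>(r := n, s := Suc (\<sigma> s), tmp := Suc (\<sigma> tmp))"
      have "?\<rho> r = n" using assms by simp
      with Suc[rule_format, of ?\<rho>]
      have "exec [Loop r [Inc s, Inc tmp]] ?\<rho> (?\<rho>(s := ?\<rho> s + ?\<rho> r, tmp := ?\<rho> tmp + ?\<rho> r, r := 0))" by blast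
      moreover have "?\<rho>(s := ?\<rho> s + ?\<rho> r, tmp := ?\<rho> tmp + ?\<rho> r, r := 0)
                   = \<sigma>(s := \<sigma> s + \<sigma> r, tmp := \<sigma> tmp + \<sigma> r, r := 0)"
        using assms * by auto
      moreover have "exec [Inc s, Inc tmp] (\<sigma>(r := n)) ?\<rho>"
        using assms by (intro exec_Inc) (simp, metis exec_Nil)
      ultimately show "exec [Loop r [Inc s, Inc tmp]] \<sigma> (\<sigma>(s := \<sigma> s + \<sigma> r, tmp := \<sigma> tmp + \<sigma> r, r := 0))"
        using * by (metis exec_Loop_unfold)
    qed
  qed
  then have 1: "exec [Loop r [Inc s, Inc tmp]] \<sigma> (\<sigma>(s := \<sigma> s + \<sigma> r, tmp := \<sigma> tmp + \<sigma> r, r := 0))"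
    (is "exec _ _ ?\<rho>") by blast
  have 2: "exec (move tmp r) ?\<rho> (?\<rho>(r := ?\<rho> r + ?\<rho> tmp, tmp := 0))"
    using assms by (intro exec_move) auto
  have "?\<rho>(r := ?\<rho> r + ?\<rho> tmp, tmp := 0) = \<sigma>(s := \<sigma> s + \<sigma> r)"
    using assms by auto
  then show ?thesis using exec_append[OF 1 2] by (simp add: copy_def)
qed

definition clears :: "nat list \<Rightarrow> ins list" where
  "clears rs = concat (map clear rs)"

lemma exec_clears: "exec (clears rs) \<sigma> (\<lambda>r. if r \<in> set rs then 0 else \<sigma> r)"
proof (induction rs arbitrary: \<sigma>)
  case Nil
  then show ?case by (simp add: clears_def exec_Nil)
next
  case (Cons r rs)
  have "exec (clear r @ clears rs) \<sigma> (\<lambda>q. if q \<in> set rs then 0 else (\<sigma>(r := 0)) q)"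
    using exec_append[OF exec_clear Cons] .
  moreover have "(\<lambda>q. if q \<in> set rs then 0 else (\<sigma>(r := 0)) q) = (\<lambda>q. if q \<in> set (r # rs) then 0 else \<sigma> q)"
    by auto
  ultimately show ?case by (simp add: clears_def)
qed

text \<open>The program for \<open>f\<close> reads its arguments from the registers \<open>args\<close>, which it preserves, and adds
  the result to \<open>out\<close>; the registers from \<open>d\<close> upwards are scratch space, zero before and after.\<close>
fun compile :: "recf \<Rightarrow> nat list \<Rightarrow> nat \<Rightarrow> nat \<Rightarrow> ins list"
  and compiles :: "recf list \<Rightarrow> nat list \<Rightarrow> nat \<Rightarrow> nat \<Rightarrow> ins list" where
  "compile RZ args out d = []"
| "compile RS args out d = copy (args ! 0) out d @ [Inc out]"
| "compile (RId n) args out d = copy (args ! n) out d"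
| "compile (RCn f gs) args out d =
     compiles gs args d (d + length gs) @ compile f [d..<d + length gs] out (d + length gs) @
     clears [d..<d + length gs]"
| "compile (RPr f g) args out d =
     copy (args ! 0) (d + 2) (d + 4) @ compile f (tl args) (d + 1) (d + 4) @
     [Loop (d + 2) (compile g (d # (d + 1) # tl args) (d + 3) (d + 4) @ clear (d + 1) @
        move (d + 3) (d + 1) @ [Inc d])] @
     move (d + 1) out @ clear d"
| "compile (RMn f) args out d =
     compile f (out # args) d (d + 1) @
     [Loop d (clear d @ [Inc out] @ compile f (out # args) d (d + 1))]"
| "compiles [] args out d = []"
| "compiles (g # gs) args out d = compile g args out d @ compiles gs args (Suc out) d"

section \<open>Correctness of the compiler\<close>

definition correct :: "recf \<Rightarrow> nat list \<Rightarrow> nat \<Rightarrow> bool" where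
  "correct f xs z \<longleftrightarrow> (\<forall>args out d \<sigma>. (\<forall>r\<in>set args. r < d) \<longrightarrow> out < d \<longrightarrow> out \<notin> set args \<longrightarrow>
     (\<forall>r\<ge>d. \<sigma> r = 0) \<longrightarrow> \<sigma> out = 0 \<longrightarrow> map \<sigma> args = xs \<longrightarrow>
     exec (compile f args out d) \<sigma> (\<sigma>(out := z)))"

lemma correctD:
  assumes "correct f xs z" "\<forall>r\<in>set args. r < d" "out < d" "out \<notin> set args"
    "\<forall>r\<ge>d. \<sigma> r = 0" "\<sigma> out = 0" "map \<sigma> args = xs" "\<tau> = \<sigma>(out := z)"
  shows "exec (compile f args out d) \<sigma> \<tau>"
  using assms unfolding correct_def by blast

lemma compiles_correct:
  assumes "list_all2 (\<lambda>g y. correct g xs y) gs ys" "\<forall>r\<in>set args. r < out" "out + length gs \<le> d"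
    "\<forall>r\<ge>d. \<sigma> r = 0" "\<forall>r\<ge>out. r < out + length gs \<longrightarrow> \<sigma> r = 0" "map \<sigma> args = xs"
  shows "exec (compiles gs args out d) \<sigma>
    (\<lambda>r. if out \<le> r \<and> r < out + length gs then ys ! (r - out) else \<sigma> r)"
  using assms
proof (induction arbitrary: out \<sigma> rule: list_all2_induct)
  case Nil
  have "(\<lambda>r. if out \<le> r \<and> r < out then [] ! (r - out) else \<sigma> r) = \<sigma>" by auto
  then show ?case by (simp add: exec_Nil)
next
  case (Cons g gs y ys)
  let ?\<rho> = "\<sigma>(out := y)"
  have "map ?\<rho> args = map \<sigma> args" using Cons.prems(1) by (intro map_cong) auto
  then have mp: "map ?\<rho> args = xs" using Cons.prems(5) by simp
  have "\<forall>r\<in>set args. r < d" using Cons.prems(1,2) by fastforce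
  then have "exec (compile g args out d) \<sigma> ?\<rho>"
    using Cons.hyps(1) Cons.prems by (intro correctD[of g xs y]) auto
  moreover have "exec (compiles gs args (Suc out) d) ?\<rho>
     (\<lambda>r. if Suc out \<le> r \<and> r < Suc out + length gs then ys ! (r - Suc out) else ?\<rho> r)"
  proof (rule Cons.IH[OF _ _ _ _ mp])
    show "\<forall>r\<ge>Suc out. r < Suc out + length gs \<longrightarrow> ?\<rho> r = 0"
    proof (intro allI impI)
      fix r assume "Suc out \<le> r" "r < Suc out + length gs"
      then show "?\<rho> r = 0" using Cons.prems(4)[rule_format, of r] by simp
    qed
  qed (use Cons.prems in \<open>auto simp: less_Suc_eq\<close>)
  moreover have "(\<lambda>r. if Suc out \<le> r \<and> r < Suc out + length gs then ys ! (r - Suc out) else ?\<rho> r)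
     = (\<lambda>r. if out \<le> r \<and> r < out + length (g # gs) then (y # ys) ! (r - out) else \<sigma> r)"
  proof
    fix r
    consider "r < out" | "r = out" | "Suc out \<le> r" by linarith
    then show "(if Suc out \<le> r \<and> r < Suc out + length gs then ys ! (r - Suc out) else ?\<rho> r)
       = (if out \<le> r \<and> r < out + length (g # gs) then (y # ys) ! (r - out) else \<sigma> r)"
    proof cases
      case 3
      then have "r - out = Suc (r - Suc out)" by simp
      then show ?thesis using 3 by auto
    qed auto
  qed
  ultimately show ?case using exec_append by (simp only: compiles.simps)
qed

lemma correct_Cn:
  assumes "list_all2 (\<lambda>g y. correct g xs y) gs ys" "correct f ys z"
  shows "correct (RCn f gs) xs z"
  unfolding correct_def
proof (intro allI impI)
  fix args out d and \<sigma> :: store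
  assume a: "\<forall>r\<in>set args. r < d" "out < d" "out \<notin> set args" "\<forall>r\<ge>d. \<sigma> r = 0" "\<sigma> out = 0" "map \<sigma> args = xs"
  let ?n = "length gs"
  have len: "length ys = ?n" using assms(1) list_all2_lengthD by metis
  let ?\<rho> = "\<lambda>r. if d \<le> r \<and> r < d + ?n then ys ! (r - d) else \<sigma> r"
  have 1: "exec (compiles gs args d (d + ?n)) \<sigma> ?\<rho>"
    using a by (intro compiles_correct[OF assms(1)]) auto
  have "map ?\<rho> [d..<d + ?n] = ys" using len by (intro nth_equalityI) auto
  then have 2: "exec (compile f [d..<d + ?n] out (d + ?n)) ?\<rho> (?\<rho>(out := z))"
    using a by (intro correctD[OF assms(2)]) auto
  have e: "(\<lambda>r. if r \<in> set [d..<d + ?n] then 0 else (?\<rho>(out := z)) r) = \<sigma>(out := z)"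
    using a by (auto simp: fun_eq_iff)
  have 3: "exec (clears [d..<d + ?n]) (?\<rho>(out := z)) (\<sigma>(out := z))"
    using exec_clears[of "[d..<d + ?n]" "?\<rho>(out := z)"] unfolding e .
  show "exec (compile (RCn f gs) args out d) \<sigma> (\<sigma>(out := z))"
    using exec_append[OF 1 exec_append[OF 2 3]] by simp
qed

lemma correct_Pr:
  assumes f: "correct f xs (ys 0)" and g: "\<forall>i<n. correct g (i # ys i # xs) (ys (Suc i))"
  shows "correct (RPr f g) (n # xs) (ys n)"
  unfolding correct_def
proof (intro allI impI)
  fix args out d and \<sigma> :: store
  assume a: "\<forall>r\<in>set args. r < d" "out < d" "out \<notin> set args" "\<forall>r\<ge>d. \<sigma> r = 0" "\<sigma> out = 0"
    "map \<sigma> args = n # xs"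
  then obtain r0 rs where args: "args = r0 # rs" "\<sigma> r0 = n" "map \<sigma> rs = xs" by auto
  have z: "\<sigma> d = 0" "\<sigma> (d + 1) = 0" "\<sigma> (d + 2) = 0" "\<sigma> (d + 3) = 0" "\<sigma> (d + 4) = 0"
    using a(4) by auto
  have rs: "r < d" if "r \<in> set rs" for r using that a(1) args by auto
  \<comment> \<open>State after \<open>i\<close> rounds: \<open>d\<close> counts rounds,
    \<open>d + 1\<close> holds the current value, \<open>d + 2\<close> the rounds still to do.
    Register \<open>d + 3\<close> receives the next value within a round and is empty again after
    it.\<close>
  let ?s = "\<lambda>i. \<sigma>(d := i, d + 1 := ys i, d + 2 := n - i)"
  have ms: "map (\<sigma>(d := i, d + 1 := u, d + 2 := v, d + 3 := w)) rs = xs" for i u v w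
  proof -
    have "map (\<sigma>(d := i, d + 1 := u, d + 2 := v, d + 3 := w)) rs = map \<sigma> rs"
      by (intro map_cong) (auto dest: rs)
    then show ?thesis using args(3) by simp
  qed
  let ?B = "compile g (d # (d + 1) # rs) (d + 3) (d + 4) @ clear (d + 1) @ move (d + 3) (d + 1) @ [Inc d]"
  have 1: "exec (copy r0 (d + 2) (d + 4)) \<sigma> (\<sigma>(d + 2 := n))"
    using exec_copy[of r0 "d + 2" "d + 4" \<sigma>] a args z by auto
  have 2: "exec (compile f rs (d + 1) (d + 4)) (\<sigma>(d + 2 := n)) (?s 0)"
  proof (rule correctD[OF f])
    show "map (\<sigma>(d + 2 := n)) rs = xs"
    proof -
      have "map (\<sigma>(d + 2 := n)) rs = map \<sigma> rs" by (intro map_cong) (auto dest: rs)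
      then show ?thesis using args(3) by simp
    qed
    show "?s 0 = (\<sigma>(d + 2 := n))(d + 1 := ys 0)" using z by (auto simp: fun_eq_iff)
  qed (use a z in \<open>auto dest!: rs\<close>)
  have body: "exec ?B ((?s i)(d + 2 := n - Suc i)) (?s (Suc i))" if "i < n" for i
  proof -
    let ?t = "(?s i)(d + 2 := n - Suc i)"
    have t: "?t = \<sigma>(d := i, d + 1 := ys i, d + 2 := n - Suc i, d + 3 := 0)"
      using z by (auto simp: fun_eq_iff)
    have 1: "exec (compile g (d # (d + 1) # rs) (d + 3) (d + 4)) ?t (?t(d + 3 := ys (Suc i)))"
    proof (rule correctD[of g "i # ys i # xs" "ys (Suc i)"])
      show "correct g (i # ys i # xs) (ys (Suc i))" using g that by blast
      show "map ?t (d # (d + 1) # rs) = i # ys i # xs" using ms[of i "ys i" "n - Suc i" 0] t by simp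
    qed (use a z in \<open>auto dest!: rs\<close>)
    have 2: "exec (move (d + 3) (d + 1)) (?t(d + 3 := ys (Suc i), d + 1 := 0))
       (?t(d + 3 := 0, d + 1 := ys (Suc i)))"
    proof -
      let ?u = "?t(d + 3 := ys (Suc i), d + 1 := 0)"
      have "?u(d + 1 := ?u (d + 1) + ?u (d + 3), d + 3 := 0) = ?t(d + 3 := 0, d + 1 := ys (Suc i))"
        by (auto simp: fun_eq_iff)
      then show ?thesis using exec_move[of "d + 3" "d + 1" ?u] by simp
    qed
    have 3: "exec [Inc d] (?t(d + 3 := 0, d + 1 := ys (Suc i))) (?s (Suc i))"
    proof -
      let ?u = "?t(d + 3 := 0, d + 1 := ys (Suc i))"
      have "?u(d := Suc (?u d)) = ?s (Suc i)" using z by (auto simp: fun_eq_iff)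
      then show ?thesis using exec_single_Inc[of d ?u] by simp
    qed
    show ?thesis by (rule exec_append[OF 1 exec_append[OF exec_clear exec_append[OF 2 3]]])
  qed
  have "exec [Loop (d + 2) ?B] (?s (n - i)) (?s n)" if "i \<le> n" for i
    using that
  proof (induction i)
    case 0
    then show ?case by (simp add: exec_Loop0 exec_Nil)
  next
    case (Suc i)
    have e: "Suc (n - Suc i) = n - i" using Suc.prems by simp
    have "exec ?B ((?s (n - Suc i))(d + 2 := n - (n - i))) (?s (n - i))"
      using body[of "n - Suc i"] Suc.prems unfolding e by simp
    then show ?case
    proof (rule exec_Loop_unfold)
      show "(?s (n - Suc i)) (d + 2) = Suc (n - (n - i))" using Suc.prems by simp
      show "exec [Loop (d + 2) ?B] (?s (n - i)) (?s n)"
        by (rule Suc.IH) (use Suc.prems in simp)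
    qed
  qed
  from this[of n] have 3: "exec [Loop (d + 2) ?B] (?s 0) (?s n)" by simp
  have 4: "exec (move (d + 1) out) (?s n) (\<sigma>(d := n, out := ys n))"
  proof -
    have "(?s n)(out := (?s n) out + (?s n) (d + 1), d + 1 := 0) = \<sigma>(d := n, out := ys n)"
      using z a by (auto simp: fun_eq_iff)
    then show ?thesis using exec_move[of "d + 1" out "?s n"] a(2) by simp
  qed
  have 5: "exec (clear d) (\<sigma>(d := n, out := ys n)) (\<sigma>(out := ys n))"
  proof -
    have "(\<sigma>(d := n, out := ys n))(d := 0) = \<sigma>(out := ys n)" using z a by (auto simp: fun_eq_iff)
    then show ?thesis using exec_clear[of d "\<sigma>(d := n, out := ys n)"] by simp
  qed
  show "exec (compile (RPr f g) args out d) \<sigma> (\<sigma>(out := ys n))"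
    using exec_append[OF 1 exec_append[OF 2 exec_append[OF 3 exec_append[OF 4 5]]]] by (simp add: args)
qed

lemma correct_Mn:
  assumes f: "correct f (n # xs) 0" and nz: "\<forall>j<n. \<exists>y. correct f (j # xs) (Suc y)"
  shows "correct (RMn f) xs n"
  unfolding correct_def
proof (intro allI impI)
  fix args out d and \<sigma> :: store
  assume a: "\<forall>r\<in>set args. r < d" "out < d" "out \<notin> set args" "\<forall>r\<ge>d. \<sigma> r = 0" "\<sigma> out = 0"
    "map \<sigma> args = xs"
  \<comment> \<open>The test register \<open>d\<close> receives 0 only at argument \<open>n\<close>;
    there the loop stops, and the scratch register is already clean.\<close>
  obtain y where y: "correct f (j # xs) (Suc (y j))" if "j < n" for j using nz by metis
  define v where "v j = (if j < n then Suc (y j) else 0)" for j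
  have v: "correct f (j # xs) (v j)" if "j \<le> n" for j
    using that y f by (cases "j = n") (auto simp: v_def)
  have d0: "\<sigma> d = 0" using a(4) by auto
  have run: "exec (compile f (out # args) d (d + 1)) (\<sigma>(out := j)) (\<sigma>(out := j, d := v j))" if "j \<le> n" for j
  proof (rule correctD[OF v[OF that]])
    have "map (\<sigma>(out := j)) args = map \<sigma> args" using a(3) by (intro map_cong) auto
    then show "map (\<sigma>(out := j)) (out # args) = j # xs" using a(6) by simp
  qed (use a d0 in auto)
  let ?B = "clear d @ [Inc out] @ compile f (out # args) d (d + 1)"
  have "exec [Loop d ?B] (\<sigma>(out := n - i, d := v (n - i))) (\<sigma>(out := n))" if "i \<le> n" for i
    using that
  proof (induction i)
    case 0
    have "\<sigma>(out := n - 0, d := v (n - 0)) = \<sigma>(out := n)"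
      using d0 a(2) by (auto simp: fun_eq_iff v_def)
    moreover have "exec [Loop d ?B] (\<sigma>(out := n)) (\<sigma>(out := n))"
      using d0 a(2) by (intro exec_Loop0 exec_Nil) simp
    ultimately show ?case by presburger
  next
    case (Suc i)
    let ?j = "n - Suc i"
    let ?t = "\<sigma>(out := ?j, d := y ?j)"
    have e: "Suc ?j = n - i" using Suc.prems by simp
    have I: "exec [Inc out] (?t(d := 0)) (\<sigma>(out := n - i))"
    proof -
      have "(?t(d := 0))(out := Suc ((?t(d := 0)) out)) = \<sigma>(out := n - i)"
        using d0 a(2) e by (auto simp: fun_eq_iff)
      then show ?thesis using exec_single_Inc[of out "?t(d := 0)"] by presburger
    qed
    have B: "exec ?B ?t (\<sigma>(out := n - i, d := v (n - i)))"
      by (rule exec_append[OF exec_clear exec_append[OF I run]]) simp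
    show ?case
    proof (rule exec_Loop_unfold)
      show "exec ?B ((\<sigma>(out := ?j, d := v ?j))(d := y ?j)) (\<sigma>(out := n - i, d := v (n - i)))"
        using B by simp
      show "(\<sigma>(out := ?j, d := v ?j)) d = Suc (y ?j)" using Suc.prems by (simp add: v_def)
      show "exec [Loop d ?B] (\<sigma>(out := n - i, d := v (n - i))) (\<sigma>(out := n))"
        by (rule Suc.IH) (use Suc.prems in simp)
    qed
  qed
  from this[of n] have "exec [Loop d ?B] (\<sigma>(out := 0, d := v 0)) (\<sigma>(out := n))" by simp
  moreover have "\<sigma>(out := 0) = \<sigma>" using a(5) by auto
  ultimately show "exec (compile (RMn f) args out d) \<sigma> (\<sigma>(out := n))"
    using exec_append[OF run[of 0], of "[Loop d ?B]" "\<sigma>(out := n)"] by simp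
qed

text \<open>The compiled loop of \<open>RPr\<close> counts upwards from 0, while a derivation of
  \<open>eval\<close> unfolds downwards and yields only its last value. The added conjunct therefore
  carries the whole history \<open>ys\<close> of intermediate values, which is the input that
  \<open>correct_Pr\<close> needs.\<close>

lemma eval_correct_strong:
  "eval h as z \<Longrightarrow> correct h as z \<and> (\<forall>f g n xs. h = RPr f g \<and> as = n # xs \<longrightarrow>
     (\<exists>ys. ys n = z \<and> correct f xs (ys 0) \<and> (\<forall>i<n. correct g (i # ys i # xs) (ys (Suc i)))))"
proof (induction rule: eval.induct)
  case (eval_Z xs)
  have "correct RZ xs 0"
    unfolding correct_def by (metis compile.simps(1) exec_Nil fun_upd_triv)
  then show ?case by simp
next
  case (eval_S x xs)
  have "exec (compile RS args out d) \<sigma> (\<sigma>(out := Suc x))"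
    if asm: "\<forall>r\<in>set args. r < d" "out < d" "out \<notin> set args" "\<forall>r\<ge>d. \<sigma> r = 0" "\<sigma> out = 0"
      "map \<sigma> args = x # xs" for args out d and \<sigma> :: store
  proof -
    obtain r0 rs where args: "args = r0 # rs" "\<sigma> r0 = x" using asm(6) by auto
    have "exec (copy r0 out d) \<sigma> (\<sigma>(out := x))"
      using exec_copy[of r0 out d \<sigma>] asm args by auto
    moreover have "exec [Inc out] (\<sigma>(out := x)) (\<sigma>(out := Suc x))"
      using exec_single_Inc[of out "\<sigma>(out := x)"] by simp
    ultimately show ?thesis using args exec_append by simp
  qed
  then show ?case by (simp add: correct_def)
next
  case (eval_Id n xs)
  have "exec (compile (RId n) args out d) \<sigma> (\<sigma>(out := xs ! n))"
    if asm: "\<forall>r\<in>set args. r < d" "out < d" "out \<notin> set args" "\<forall>r\<ge>d. \<sigma> r = 0" "\<sigma> out = 0"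
      "map \<sigma> args = xs" for args out d and \<sigma> :: store
  proof -
    have n: "n < length args" using asm(6) eval_Id by auto
    then have "args ! n \<in> set args" by simp
    then have "args ! n < d" "args ! n \<noteq> out" using asm by auto
    moreover have "\<sigma> (args ! n) = xs ! n" using n asm(6) by auto
    ultimately show ?thesis using exec_copy[of "args ! n" out d \<sigma>] asm by simp
  qed
  then show ?case by (simp add: correct_def)
next
  case (eval_Cn xs gs ys f z)
  have "list_all2 (\<lambda>g y. correct g xs y) gs ys"
    using eval_Cn(1) by (rule list_all2_mono) (elim conjE)
  then have "correct (RCn f gs) xs z" using eval_Cn.IH(2) by (intro correct_Cn) auto
  then show ?case by simp
next
  case (eval_Pr0 f xs z g)
  have "correct f xs ((\<lambda>_. z) 0)" using eval_Pr0 by simp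
  then have "correct (RPr f g) (0 # xs) z" using correct_Pr[of f xs "\<lambda>_. z" 0 g] by simp
  moreover have "\<exists>ys. ys (0::nat) = z \<and> correct f xs (ys 0) \<and> (\<forall>i<0. correct g (i # ys i # xs) (ys (Suc i)))"
    using eval_Pr0 by (intro exI[of _ "\<lambda>_. z"]) simp
  ultimately show ?case by simp
next
  case (eval_PrS f g n xs y z)
  obtain ys where ys: "ys n = y" "correct f xs (ys 0)" "\<forall>i<n. correct g (i # ys i # xs) (ys (Suc i))"
    using eval_PrS.IH(1)[THEN conjunct2, rule_format, of f g n xs] by blast
  let ?ys = "ys(Suc n := z)"
  have "?ys (Suc n) = z" "correct f xs (?ys 0)" "\<forall>i<Suc n. correct g (i # ?ys i # xs) (?ys (Suc i))"
    using ys eval_PrS.IH(2) by (auto simp: less_Suc_eq)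
  then have e: "correct (RPr f g) (Suc n # xs) z" "\<exists>ys. ys (Suc n) = z \<and> correct f xs (ys 0) \<and>
      (\<forall>i<Suc n. correct g (i # ys i # xs) (ys (Suc i)))"
    using correct_Pr[of f xs ?ys "Suc n" g] by (simp, blast)
  from e show ?case by simp
next
  case (eval_Mn f n xs)
  have "\<exists>y. correct f (j # xs) (Suc y)" if "j < n" for j
    using eval_Mn.IH(2)[rule_format, OF that] by (elim exE conjE) (rule exI)
  then have "correct (RMn f) xs n" using eval_Mn.IH(1) by (intro correct_Mn) auto
  then show ?case by simp
qed

lemma eval_correct: "eval h as z \<Longrightarrow> correct h as z"
  using eval_correct_strong by blast

text \<open>Register 0 is the input, 1 the result, and scratch space starts at 2. The final loop
  undoes each of its decrements, so it diverges exactly when the result is nonzero.\<close>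

definition diag_prog :: "recf \<Rightarrow> ins list" where
  "diag_prog h = compile h [0] 1 2 @ [Loop 1 [Inc 1]]"

lemma halts_diag_prog:
  assumes "eval h [x] z" "z = 0 \<or> z = 1"
  shows "halts (diag_prog h) x \<longleftrightarrow> z = 0"
proof -
  define s where "s = (input_store x)(1 := z)"
  have "exec (compile h [0] 1 2) (input_store x) s"
    using eval_correct[OF assms(1)] by (rule correctD) (auto simp: input_store_def s_def)
  then obtain n where n: "(nstep ^^ n) (diag_prog h, input_store x) = ([Loop 1 [Inc 1]], s)"
    using exec_nsteps unfolding diag_prog_def by blast
  show ?thesis
  proof
    assume "z = 0"
    then have "(nstep ^^ Suc n) (diag_prog h, input_store x) = ([], s)" using n by (simp add: s_def)
    then show "halts (diag_prog h) x" unfolding halts_def by (metis fst_conv)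
  next
    assume "halts (diag_prog h) x"
    then obtain k where k: "fst ((nstep ^^ k) (diag_prog h, input_store x)) = []"
      unfolding halts_def by blast
    have nil: "fst ((nstep ^^ i) c) = []" if "fst c = []" for i c
      using that
    proof (induction i)
      case (Suc i)
      then show ?case by (cases "(nstep ^^ i) c") simp
    qed simp
    show "z = 0"
    proof (rule ccontr)
      assume "z \<noteq> 0"
      then have z: "z = 1" using assms by simp
      have loop: "(nstep ^^ i) ([Loop 1 [Inc 1]], s) \<in>
          {([Loop 1 [Inc 1]], s), ([Inc 1, Loop 1 [Inc 1]], s(1 := 0))}" for i
      proof (induction i)
        case (Suc i)
        have e: "s(1 := 0, 1 := Suc 0) = s" "s 1 = Suc 0" using z by (auto simp: s_def)
        from Suc consider "(nstep ^^ i) ([Loop 1 [Inc 1]], s) = ([Loop 1 [Inc 1]], s)"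
          | "(nstep ^^ i) ([Loop 1 [Inc 1]], s) = ([Inc 1, Loop 1 [Inc 1]], s(1 := 0))" by blast
        then show ?case
        proof cases
          case 1
          then have "(nstep ^^ Suc i) ([Loop 1 [Inc 1]], s) = ([Inc 1, Loop 1 [Inc 1]], s(1 := 0))"
            using e(2) by (simp del: One_nat_def)
          then show ?thesis by blast
        next
          case 2
          then have "(nstep ^^ Suc i) ([Loop 1 [Inc 1]], s) = ([Loop 1 [Inc 1]], s(1 := 0, 1 := Suc 0))"
            by (simp del: One_nat_def fun_upd_upd)
          then show ?thesis using e(1) by simp
        qed
      qed simp
      have "(nstep ^^ (k + n)) (diag_prog h, input_store x) = (nstep ^^ k) ([Loop 1 [Inc 1]], s)"
        using n by (simp add: funpow_add)
      moreover have "fst ((nstep ^^ (n + k)) (diag_prog h, input_store x)) = []"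
        using nil[OF k] by (simp add: funpow_add)
      ultimately have "fst ((nstep ^^ k) ([Loop 1 [Inc 1]], s)) = []" by (simp add: add.commute)
      then show False using loop[of k] by auto
    qed
  qed
qed

section \<open>The winning condition\<close>

definition cell :: "nat \<Rightarrow> nat \<Rightarrow> nat" where
  "cell c d = prod_encode (c, d) + 2"

definition in_of :: "nat \<Rightarrow> nat" where
  "in_of a = fst (prod_decode (a - 2))"

text \<open>A created cell (letter 1) is born with content 1, that is, used up. It becomes free only
  through a restart.\<close>

definition out_of :: "nat \<Rightarrow> nat" where
  "out_of a = (if a = 1 then 1 else snd (prod_decode (a - 2)))"

lemma cell_simps [simp]:
  "in_of (cell c d) = c" "out_of (cell c d) = d" "out_of (Suc 0) = Suc 0"
  "cell c d = cell c' d' \<longleftrightarrow> c = c' \<and> d = d'"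
  "cell c d \<noteq> 0" "cell c d \<noteq> Suc 0" "0 \<noteq> cell c d" "Suc 0 \<noteq> cell c d" "2 \<le> cell c d" "0 < cell c d"
  by (auto simp: cell_def in_of_def out_of_def)

lemma cell_in_out: "2 \<le> a \<Longrightarrow> cell (in_of a) (out_of a) = a"
  by (simp add: cell_def in_of_def out_of_def)

definition letters :: "nat \<Rightarrow> nat set" where
  "letters C = {0, 1} \<union> {cell c d | c d. c < C \<and> d < C}"

lemma finite_letters: "finite (letters C)"
proof -
  have "{cell c d | c d. c < C \<and> d < C} = (\<lambda>(c, d). cell c d) ` ({..<C} \<times> {..<C})" by auto
  then show ?thesis by (simp add: letters_def)
qed

text \<open>All remainders that a run of the program can be left with; inside a loop this is a
  remainder of the body followed by the loop itself. The list is finite and closed under steps, so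
  its members can index locations.\<close>

fun resid :: "ins list \<Rightarrow> ins list list" where
  "resid [] = [[]]"
| "resid (Inc r # P) = (Inc r # P) # resid P"
| "resid (Loop r B # P) = map (\<lambda>Q. Q @ Loop r B # P) (resid B) @ resid P"

text \<open>A strict bound on all contents that occur. The base value 3 admits 0, 1 and 2, the
  latter because register 0 holds the input even if the program never mentions it.\<close>

fun content_bound :: "ins list \<Rightarrow> nat" where
  "content_bound [] = 3"
| "content_bound (Inc r # P) = max (r + 3) (content_bound P)"
| "content_bound (Loop r B # P) = max (r + 3) (max (content_bound B) (content_bound P))"

lemma Nil_in_resid: "[] \<in> set (resid P)"
  by (induction P rule: resid.induct) auto

lemma resid_self: "P \<in> set (resid P)"
  using Nil_in_resid by (cases P rule: resid.cases) force+

lemma resid_Inc: "Inc r # Q \<in> set (resid P) \<Longrightarrow> Q \<in> set (resid P)"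
proof (induction P arbitrary: Q rule: resid.induct)
  case (2 r' P)
  then show ?case using resid_self by auto
next
  case (3 r' B P)
  then consider "Inc r # Q \<in> set (resid P)"
    | Q' where "Q' \<in> set (resid B)" "Inc r # Q = Q' @ Loop r' B # P" by auto
  then show ?case
  proof cases
    case 2
    from 2(2) obtain Q'' where "Q' = Inc r # Q''" "Q = Q'' @ Loop r' B # P" by (cases Q') auto
    then show ?thesis using 3 2 by auto
  qed (use 3 in auto)
qed auto

lemma resid_Loop:
  "Loop r A # Q \<in> set (resid P) \<Longrightarrow> Q \<in> set (resid P) \<and> A @ Loop r A # Q \<in> set (resid P)"
proof (induction P arbitrary: Q rule: resid.induct)
  case (3 r' B P)
  then consider "Loop r A # Q \<in> set (resid P)"
    | Q' where "Q' \<in> set (resid B)" "Loop r A # Q = Q' @ Loop r' B # P" by auto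
  then show ?case
  proof cases
    case 2
    show ?thesis
    proof (cases Q')
      case Nil
      then show ?thesis using 2 resid_self[of B] resid_self[of P] by auto
    next
      case (Cons i Q'')
      then have "Loop r A # Q'' \<in> set (resid B)" "Q = Q'' @ Loop r' B # P" using 2 by auto
      then show ?thesis using 3(1)[of Q''] by force
    qed
  qed (use 3 in auto)
qed auto

lemma content_bound_append: "content_bound (P @ Q) = max (content_bound P) (content_bound Q)"
proof (induction P rule: content_bound.induct)
  case 1
  have "3 \<le> content_bound Q" by (induction Q rule: content_bound.induct) auto
  then show ?case by simp
qed auto

lemma content_bound_ge: "3 \<le> content_bound P"
  by (induction P rule: content_bound.induct) auto

lemma content_bound_resid: "Q \<in> set (resid P) \<Longrightarrow> content_bound Q \<le> content_bound P"
proof (induction P arbitrary: Q rule: resid.induct)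
  case (3 r B P)
  then show ?case by (fastforce simp: content_bound_append)
qed (fastforce simp: le_max_iff_disj)+

lemma resid_content_bound:
  "Inc r # Q \<in> set (resid P) \<Longrightarrow> r + 2 < content_bound P"
  "Loop r A # Q \<in> set (resid P) \<Longrightarrow> r + 2 < content_bound P"
  by (auto dest!: content_bound_resid)

text \<open>Locations \<open>LS\<close>, \<open>LA\<close>, \<open>LAcc\<close>, \<open>LH\<close>, \<open>LM\<close> refute a claim of Player II; the others follow a
  run written by Player I in which no claim is made.\<close>
datatype loc = Lc nat | LS | LA | LAcc | LH | LM nat bool | LB | LF | LX | LFin
  | LU "ins list" | LV "ins list" | LZ "ins list" | LZV nat "ins list"

instance ins :: countable by countable_datatype
instance loc :: countable by countable_datatype

text \<open>The locations \<open>Lc i\<close>, whose number grows with the input, get the even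
  numbers, which are computable from \<open>i\<close>. The remaining ones get odd numbers, and these
  enter the reduction only as constants or through the code of the program.\<close>

definition lenc :: "loc \<Rightarrow> nat" where
  "lenc l = (case l of Lc i \<Rightarrow> 2 * i | _ \<Rightarrow> Suc (2 * to_nat l))"

lemma lenc_Lc [simp]: "lenc (Lc i) = 2 * i"
  by (simp add: lenc_def)

lemma lenc_inj [simp]: "lenc l = lenc l' \<longleftrightarrow> l = l'"
proof -
  have "to_nat l = to_nat l' \<Longrightarrow> l = l'" by simp
  then show ?thesis unfolding lenc_def
    by (cases l; cases l') (simp_all, presburger+)
qed

text \<open>A letter \<open>cell c d\<close> is a cell of content \<open>c\<close> that has content \<open>d\<close> in the next configuration.
  Content 0 is free, 1 is used up, and \<open>r + 2\<close> is one unit of register \<open>r\<close>. Letter 0 starts a new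
  configuration and letter 1 is a newly created cell.\<close>
inductive bbase :: "ins list \<Rightarrow> loc \<Rightarrow> nat \<Rightarrow> loc \<Rightarrow> bool" for P where
  b_init: "bbase P LB 0 LF"
| b_rest: "bbase P (Lc 0) (cell 0 0) (Lc 0)"
| b_loaded: "l \<in> {LX, LU P, LZ P} \<Longrightarrow> bbase P (Lc 0) 0 l"
| b_restart: "0 < c \<Longrightarrow> c < content_bound P \<Longrightarrow> bbase P LX (cell c 0) LX"
| b_restarted: "l \<in> {LF, LFin} \<Longrightarrow> bbase P LX 0 l"
| b_fin: "c < content_bound P \<Longrightarrow> d < content_bound P \<Longrightarrow> bbase P LFin (cell c d) LFin"
| b_keep: "Q \<in> set (resid P) \<Longrightarrow> c < content_bound P \<Longrightarrow> l \<in> {LU Q, LV Q} \<Longrightarrow> bbase P l (cell c c) l"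
| b_inc: "Inc r # Q \<in> set (resid P) \<Longrightarrow> bbase P (LU (Inc r # Q)) (cell 0 (r + 2)) (LV Q)"
| b_dec: "Loop r A # Q \<in> set (resid P)
    \<Longrightarrow> bbase P (LU (Loop r A # Q)) (cell (r + 2) 1) (LV (A @ Loop r A # Q))"
| b_next: "Q \<in> set (resid P) \<Longrightarrow> l \<in> {LX, LU Q, LZ Q} \<Longrightarrow> bbase P (LV Q) 0 l"
| b_zkeep: "Loop r A # Q \<in> set (resid P) \<Longrightarrow> c < content_bound P \<Longrightarrow> c \<noteq> r + 2
    \<Longrightarrow> l \<in> {LZ (Loop r A # Q), LZV r Q} \<Longrightarrow> bbase P l (cell c c) l"
| b_zero: "Loop r A # Q \<in> set (resid P) \<Longrightarrow> bbase P (LZ (Loop r A # Q)) (cell 0 1) (LZV r Q)"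
| b_znext: "Loop r A # Q \<in> set (resid P) \<Longrightarrow> l \<in> {LX, LU Q, LZ Q} \<Longrightarrow> bbase P (LZV r Q) 0 l"

inductive_cases bbase_cases: "bbase P l a l'"

text \<open>The steps that mention the input \<open>x\<close> are kept apart from
  \<open>bbase\<close>, so that the rules stemming from \<open>bbase\<close> have a code depending
  on \<open>P\<close> alone. A header read while loading means that the free cells do not suffice
  for the input; the round is then given up through \<open>LX\<close>.\<close>

definition bstep :: "ins list \<Rightarrow> nat \<Rightarrow> loc \<Rightarrow> nat \<Rightarrow> loc \<Rightarrow> bool" where
  "bstep P x l a l' \<longleftrightarrow> bbase P l a l' \<or> l = LF \<and> a = 1 \<and> l' = Lc x \<or>
     (\<exists>i<x. l = Lc (Suc i) \<and> (a = cell 0 2 \<and> l' = Lc i \<or> a = 0 \<and> l' = LX))"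

text \<open>Every rule outside the refuting part resets the clock, so this guard makes the times of
  an unclaimed play positive and strictly increasing.\<close>

definition gpos :: ccon where "gpos = CAtom 0 CGt 0"
definition gone :: ccon where "gone = CAtom 0 CEq 1"

text \<open>Answer 1 is the claim. Each way into \<open>LAcc\<close> shows that the claimed tick was
  in order: it is the opening header, a created cell, or lies one time unit after a guessed original
  (\<open>LH\<close> for headers, \<open>LM\<close> for cells). The flag of \<open>LM\<close>
  records whether the single header between original and copy has been read. All answers before the
  claim must be 0.\<close>

inductive aux :: "nat \<Rightarrow> loc \<Rightarrow> nat \<Rightarrow> nat \<Rightarrow> ccon \<Rightarrow> bool \<Rightarrow> loc \<Rightarrow> bool" for C where
  aux_first: "aux C LS 0 1 CTrue False LAcc"
| aux_wait: "a \<in> letters C \<Longrightarrow> aux C LA a 0 CTrue False LA"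
| aux_fresh: "aux C LA 1 1 CTrue False LAcc"
| aux_head: "aux C LA 0 0 CTrue True LH"
| aux_hwait: "a \<in> letters C \<Longrightarrow> a \<noteq> 0 \<Longrightarrow> aux C LH a 0 CTrue False LH"
| aux_hmatch: "aux C LH 0 1 gone False LAcc"
| aux_cell: "a \<in> letters C \<Longrightarrow> a \<noteq> 0 \<Longrightarrow> aux C LA a 0 CTrue True (LM (out_of a) False)"
| aux_mwait: "a \<in> letters C \<Longrightarrow> a \<noteq> 0 \<Longrightarrow> c < C \<Longrightarrow> aux C (LM c h) a 0 CTrue False (LM c h)"
| aux_mhead: "c < C \<Longrightarrow> aux C (LM c False) 0 0 CTrue False (LM c True)"
| aux_match: "c < C \<Longrightarrow> d < C \<Longrightarrow> aux C (LM c True) (cell c d) 1 gone False LAcc"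
| aux_acc: "b < 2 \<Longrightarrow> aux C LAcc 0 b CTrue False LAcc"

definition mk_rule :: "loc \<Rightarrow> nat \<Rightarrow> nat \<Rightarrow> ccon \<Rightarrow> bool \<Rightarrow> loc \<Rightarrow> rule" where
  "mk_rule l a b g res l' = (lenc l, Some (a, b), g, if res then [0] else [], lenc l')"

lemma mk_rule_simps [simp]:
  "rule_src (mk_rule l a b g res l') = lenc l"
  "rule_letter (mk_rule l a b g res l') = Some (a, b)"
  "rule_guard (mk_rule l a b g res l') = g"
  "rule_resets (mk_rule l a b g res l') = (if res then {0} else {})"
  "rule_tgt (mk_rule l a b g res l') = lenc l'"
  by (auto simp: mk_rule_def rule_src_def rule_letter_def rule_guard_def rule_resets_def rule_tgt_def)

definition base_set :: "ins list \<Rightarrow> rule set" where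
  "base_set P = {mk_rule l a 0 gpos True l' | l a l'. bbase P l a l'} \<union>
     {mk_rule l a b g res l' | l a b g res l'. aux (content_bound P) l a b g res l'}"

text \<open>An arbitrary enumeration suffices: no function from programs to rule lists is ever
  computed, and only the code of the chosen list enters the reduction.\<close>

definition base_rules :: "ins list \<Rightarrow> rule list" where
  "base_rules P = (SOME rs. set rs = base_set P)"

text \<open>The path through the locations \<open>Lc x, \<dots>, Lc 0\<close> loads the input \<open>x\<close> into register 0.\<close>
fun chain :: "nat \<Rightarrow> rule list" where
  "chain 0 = []"
| "chain (Suc i) = mk_rule (Lc (Suc i)) (cell 0 2) 0 gpos True (Lc i) #
     mk_rule (Lc (Suc i)) 0 0 gpos True LX # chain i"

text \<open>The numbers up to \<open>2 * x\<close> accommodate the chain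
  \<open>Lc x, ..., Lc 0\<close>. The odd numbers of the other locations also fit below
  \<open>2 * x + 2\<close> when \<open>x\<close> is the code of \<open>P\<close>, which is the input
  used in the reduction.\<close>

definition automaton :: "ins list \<Rightarrow> nat \<Rightarrow> ta" where
  "automaton P x = \<lparr>ta_nloc = 2 * x + 2, ta_nclk = 1, ta_init = [lenc LS, lenc LA, lenc LB],
     ta_fin = [lenc LAcc, lenc LFin],
     ta_rules = chain x @ mk_rule LF 1 0 gpos True (Lc x) # base_rules P\<rparr>"

lemma out_of_letters: "a \<in> letters (content_bound P) \<Longrightarrow> a \<noteq> 0 \<Longrightarrow> out_of a < content_bound P"
  using content_bound_ge[of P] by (auto simp: letters_def)

lemma finite_bbase: "finite {(l, a, l'). bbase P l a l'}"
proof -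
  let ?R = "set (resid P)" and ?C = "content_bound P"
  define Z where "Z = (\<lambda>Q. case Q of Loop r A # Q' \<Rightarrow> LZV r Q' | _ \<Rightarrow> LB) ` ?R"
  let ?L = "{LB, LF, LX, LFin, Lc 0, LU P, LZ P} \<union> LU ` ?R \<union> LV ` ?R \<union> LZ ` ?R \<union> Z"
  have "{(l, a, l'). bbase P l a l'} \<subseteq> ?L \<times> letters ?C \<times> ?L"
  proof
    fix y assume "y \<in> {(l, a, l'). bbase P l a l'}"
    then obtain l a l' where y: "y = (l, a, l')" "bbase P l a l'" by auto
    have 3: "3 \<le> ?C" by (rule content_bound_ge)
    have LZV: "LZV r Q \<in> Z" if "Loop r A # Q \<in> ?R" for r A Q
      unfolding Z_def using that by (intro image_eqI[where x = "Loop r A # Q"]) auto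
    from y(2) have "l \<in> ?L \<and> a \<in> letters ?C \<and> l' \<in> ?L"
      by cases (use 3 in \<open>auto simp: letters_def dest: LZV resid_Inc resid_Loop resid_content_bound\<close>)
    then show "y \<in> ?L \<times> letters ?C \<times> ?L" using y(1) by blast
  qed
  then show ?thesis by (rule finite_subset) (simp add: finite_letters Z_def)
qed

lemma finite_aux: "finite {(l, a, b, g, res, l'). aux (content_bound P) l a b g res l'}"
proof -
  let ?C = "content_bound P"
  let ?L = "{LS, LA, LAcc, LH} \<union> (\<lambda>(c, h). LM c h) ` ({..<?C} \<times> UNIV)"
  have "{(l, a, b, g, res, l'). aux ?C l a b g res l'} \<subseteq> ?L \<times> letters ?C \<times> {..<2} \<times> {CTrue, gone} \<times> UNIV \<times> ?L"
  proof
    fix y assume "y \<in> {(l, a, b, g, res, l'). aux ?C l a b g res l'}"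
    then obtain l a b g res l' where y: "y = (l, a, b, g, res, l')" "aux ?C l a b g res l'" by auto
    have 3: "3 \<le> ?C" by (rule content_bound_ge)
    from y(2) have "l \<in> ?L \<and> a \<in> letters ?C \<and> b < 2 \<and> g \<in> {CTrue, gone} \<and> l' \<in> ?L"
      by cases (use 3 out_of_letters[of a P] in \<open>auto simp: letters_def\<close>)
    then show "y \<in> ?L \<times> letters ?C \<times> {..<2} \<times> {CTrue, gone} \<times> UNIV \<times> ?L" using y(1) by blast
  qed
  then show ?thesis by (rule finite_subset) (simp add: finite_letters)
qed

lemma set_base_rules: "set (base_rules P) = base_set P"
proof -
  have "base_set P = (\<lambda>(l, a, l'). mk_rule l a 0 gpos True l') ` {(l, a, l'). bbase P l a l'} \<union>
    (\<lambda>(l, a, b, g, res, l'). mk_rule l a b g res l') ` {(l, a, b, g, res, l'). aux (content_bound P) l a b g res l'}"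
    by (force simp: base_set_def)
  then have "finite (base_set P)" using finite_bbase finite_aux by simp
  then show ?thesis unfolding base_rules_def by (metis (mono_tags, lifting) finite_list someI_ex)
qed

lemma set_chain: "set (chain x) = {mk_rule (Lc (Suc i)) a 0 gpos True l' | i a l'.
    i < x \<and> (a = cell 0 2 \<and> l' = Lc i \<or> a = 0 \<and> l' = LX)}"
  by (induction x) (auto simp: less_Suc_eq)

lemma set_rules: "set (ta_rules (automaton P x)) =
   {mk_rule l a 0 gpos True l' | l a l'. bstep P x l a l'} \<union>
   {mk_rule l a b g res l' | l a b g res l'. aux (content_bound P) l a b g res l'}"
proof -
  have "{mk_rule l a 0 gpos True l' | l a l'. bstep P x l a l'} = set (chain x) \<union>
      {mk_rule LF 1 0 gpos True (Lc x)} \<union> {mk_rule l a 0 gpos True l' | l a l'. bbase P l a l'}"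
    unfolding bstep_def set_chain by blast
  then show ?thesis by (simp add: automaton_def set_base_rules base_set_def Un_assoc)
qed

section \<open>The timed language of the automaton\<close>

lemma strict_mono_surj_id:
  assumes "strict_mono g" "range g = (UNIV :: nat set)"
  shows "g n = n"
proof (induction n rule: less_induct)
  case (less n)
  obtain i where i: "g i = n" using assms(2) by (metis surjD)
  have "i \<le> n" using strict_mono_imp_increasing[OF assms(1), of i] i by simp
  then show ?case using less[of i] i by (cases "i = n") auto
qed

lemma automaton_letter: "r \<in> set (ta_rules (automaton P x)) \<Longrightarrow> rule_letter r \<noteq> None"
  by (auto simp: set_rules)

lemma automaton_lang_iff:
  "w \<in> ta_lang (automaton P x) \<longleftrightarrow> (\<exists>loc T rl. ta_run (automaton P x) loc T rl \<and>
     (\<exists>\<^sub>\<infinity>i. loc i \<in> {lenc LAcc, lenc LFin}) \<and> (\<forall>j. w j = (the (rule_letter (rl j)), T (Suc j))))"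
  (is "?l \<longleftrightarrow> ?r")
proof
  assume ?l
  then obtain loc T rl g where h: "ta_run (automaton P x) loc T rl"
     "\<exists>\<^sub>\<infinity>i. loc i \<in> set (ta_fin (automaton P x))" "strict_mono g" "range g = {i. rule_letter (rl i) \<noteq> None}"
     "\<forall>j. w j = (the (rule_letter (rl (g j))), T (Suc (g j)))"
    unfolding ta_lang_def by blast
  have "range g = UNIV" using h(1,4) automaton_letter unfolding ta_run_def by blast
  then have "g j = j" for j using strict_mono_surj_id[OF h(3)] by blast
  then have "\<forall>j. w j = (the (rule_letter (rl j)), T (Suc j))" using h(5) by simp
  then show ?r using h(1,2) by (auto simp: automaton_def)
next
  assume ?r
  then obtain loc T rl where h: "ta_run (automaton P x) loc T rl"
     "\<exists>\<^sub>\<infinity>i. loc i \<in> {lenc LAcc, lenc LFin}" "\<forall>j. w j = (the (rule_letter (rl j)), T (Suc j))" by blast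
  have "rule_letter (rl i) \<noteq> None" for i using h(1) automaton_letter unfolding ta_run_def by blast
  then have "range id = {i. rule_letter (rl i) \<noteq> None}" by simp
  moreover have "strict_mono (id :: nat \<Rightarrow> nat)" by (simp add: strict_mono_def)
  moreover have "\<exists>\<^sub>\<infinity>i. loc i \<in> set (ta_fin (automaton P x))" using h(2) by (simp add: automaton_def)
  ultimately show ?l unfolding ta_lang_def mem_Collect_eq
    by (intro exI[of _ loc] exI[of _ T] exI[of _ rl] exI[of _ "id :: nat \<Rightarrow> nat"] conjI)
      (use h in simp_all)
qed


definition hc :: "(nat \<Rightarrow> nat) \<Rightarrow> nat \<Rightarrow> nat \<Rightarrow> nat" where
  "hc a i j = card {k. i \<le> k \<and> k < j \<and> a k = 0}"

lemma hc_finite [simp]: "finite {k. i \<le> k \<and> k < (j::nat) \<and> a k = (0::nat)}"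
  by (rule finite_subset[of _ "{..<j}"]) auto

lemma hc_Suc: "i \<le> j \<Longrightarrow> hc a i (Suc j) = hc a i j + (if a j = 0 then 1 else 0)"
proof -
  assume "i \<le> j"
  then have "{k. i \<le> k \<and> k < Suc j \<and> a k = 0} =
      (if a j = 0 then insert j {k. i \<le> k \<and> k < j \<and> a k = 0} else {k. i \<le> k \<and> k < j \<and> a k = 0})"
    by (auto simp: less_Suc_eq)
  then show ?thesis by (simp add: hc_def)
qed

lemma hc_empty [simp]: "j \<le> i \<Longrightarrow> hc a i j = 0"
  by (auto simp: hc_def)

lemma hc_mono: "i' \<le> i \<Longrightarrow> j \<le> j' \<Longrightarrow> hc a i j \<le> hc a i' j'"
  unfolding hc_def by (rule card_mono) auto

definition matches :: "nat \<Rightarrow> nat \<Rightarrow> bool" where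
  "matches c d \<longleftrightarrow> c = 0 \<and> d = 0 \<or> c \<noteq> 0 \<and> 2 \<le> d \<and> out_of c = in_of d"

text \<open>The ticks at which a claim would be false. Exactly one header in the positions after
  \<open>i\<close> up to and including \<open>j\<close> puts the original into the previous
  configuration; if \<open>j\<close> is itself a header, it makes \<open>i\<close> the header
  directly before it.\<close>

definition legit :: "(nat \<Rightarrow> nat) \<Rightarrow> (nat \<Rightarrow> real) \<Rightarrow> nat \<Rightarrow> bool" where
  "legit a t j \<longleftrightarrow> j = 0 \<and> a 0 = 0 \<or> a j = 1 \<or>
     (\<exists>i<j. t i = t j - 1 \<and> matches (a i) (a j) \<and> hc a (Suc i) (Suc j) = 1)"

definition brun :: "ins list \<Rightarrow> nat \<Rightarrow> (nat \<Rightarrow> loc) \<Rightarrow> (nat \<Rightarrow> nat) \<Rightarrow> nat \<Rightarrow> bool" where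
  "brun P x ls a n \<longleftrightarrow> ls 0 = LB \<and> (\<forall>i<n. bstep P x (ls i) (a i) (ls (Suc i)))"

fun refuting :: "loc \<Rightarrow> bool" where
  "refuting LS = True" | "refuting LA = True" | "refuting LAcc = True" | "refuting LH = True"
| "refuting (LM c h) = True" | "refuting _ = False"

lemma bstep_not_refuting: "bstep P x l a l' \<Longrightarrow> \<not> refuting l \<and> \<not> refuting l'"
  unfolding bstep_def by (auto elim!: bbase_cases)

lemma aux_refuting: "aux C l a b g res l' \<Longrightarrow> refuting l \<and> refuting l'"
  by (induction rule: aux.induct) auto

lemma run_val_Suc0:
  "run_val rl T (Suc i) 0 = (if 0 \<in> rule_resets (rl i) then 0 else run_val rl T i 0 + (T (Suc i) - T i))"
  by (simp add: reset_def delay_def)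

context
  fixes a b :: "nat \<Rightarrow> nat" and t T :: "nat \<Rightarrow> real" and rl :: "nat \<Rightarrow> rule"
begin

definition claim :: "nat \<Rightarrow> bool" where
  "claim j \<longleftrightarrow> b j \<noteq> 0 \<and> (\<forall>i<j. b i = 0) \<and> legit a t j"

text \<open>What a refuting run has witnessed after \<open>n\<close> letters. The position
  \<open>i\<close> is the guessed original, at which the clock was reset; letter \<open>i\<close> is
  read at time \<open>T (Suc i)\<close> because \<open>T 0\<close> is the start.\<close>

fun refinv :: "nat \<Rightarrow> loc \<Rightarrow> bool" where
  "refinv n LS \<longleftrightarrow> n = 0"
| "refinv n LA \<longleftrightarrow> (\<forall>i<n. b i = 0)"
| "refinv n LAcc \<longleftrightarrow> (\<exists>j. claim j)"
| "refinv n LH \<longleftrightarrow> (\<forall>i<n. b i = 0) \<and>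
     (\<exists>i<n. a i = 0 \<and> hc a (Suc i) n = 0 \<and> run_val rl T n 0 = T n - T (Suc i))"
| "refinv n (LM c h) \<longleftrightarrow> (\<forall>i<n. b i = 0) \<and>
     (\<exists>i<n. a i \<noteq> 0 \<and> out_of (a i) = c \<and> hc a (Suc i) n = (if h then 1 else 0) \<and>
       run_val rl T n 0 = T n - T (Suc i))"
| "refinv n _ \<longleftrightarrow> False"

lemma refinv_step:
  assumes inv: "refinv n l" and aux: "aux C l (a n) (b n) g res l'"
    and rl: "rl n = mk_rule l (a n) (b n) g res l'"
    and sat: "sat (delay (run_val rl T n) (T (Suc n) - T n)) g"
    and tT: "\<And>i. t i = T (Suc i)"
  shows "refinv (Suc n) l'"
  using aux
proof cases
  case aux_first
  then have "claim 0" using inv by (auto simp: claim_def legit_def)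
  then show ?thesis using aux_first by auto
next
  case aux_wait
  then show ?thesis using inv by (auto simp: less_Suc_eq)
next
  case aux_fresh
  then have "claim n" using inv by (auto simp: claim_def legit_def)
  then show ?thesis using aux_fresh by auto
next
  case aux_head
  have "run_val rl T (Suc n) 0 = T (Suc n) - T (Suc n)"
    unfolding run_val_Suc0 using rl aux_head by simp
  then show ?thesis using inv aux_head by (auto simp: less_Suc_eq simp del: run_val.simps)
next
  case aux_hwait
  obtain i where i: "i < n" "a i = 0" "hc a (Suc i) n = 0" "run_val rl T n 0 = T n - T (Suc i)"
    using inv aux_hwait by auto
  have "run_val rl T (Suc n) 0 = T (Suc n) - T (Suc i)" "hc a (Suc i) (Suc n) = 0"
    unfolding run_val_Suc0 using rl aux_hwait i by (auto simp: hc_Suc)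
  then show ?thesis using inv aux_hwait i by (auto simp: less_Suc_eq simp del: run_val.simps)
next
  case aux_hmatch
  obtain i where i: "i < n" "a i = 0" "hc a (Suc i) n = 0" "run_val rl T n 0 = T n - T (Suc i)"
    using inv aux_hmatch by auto
  have "T (Suc i) = T (Suc n) - 1" using sat aux_hmatch i(4) by (simp add: gone_def delay_def)
  then have "claim n" using inv i aux_hmatch tT
    by (auto simp: claim_def legit_def matches_def hc_Suc intro!: exI[of _ i])
  then show ?thesis using aux_hmatch by auto
next
  case aux_cell
  have "run_val rl T (Suc n) 0 = T (Suc n) - T (Suc n)"
    unfolding run_val_Suc0 using rl aux_cell by simp
  then show ?thesis using inv aux_cell by (auto simp: less_Suc_eq simp del: run_val.simps)
next
  case (aux_mwait c h)
  obtain i where i: "i < n" "a i \<noteq> 0" "out_of (a i) = c" "hc a (Suc i) n = (if h then 1 else 0)"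
      "run_val rl T n 0 = T n - T (Suc i)"
    using inv aux_mwait by auto
  have "run_val rl T (Suc n) 0 = T (Suc n) - T (Suc i)" "hc a (Suc i) (Suc n) = (if h then 1 else 0)"
    unfolding run_val_Suc0 using rl aux_mwait i by (auto simp: hc_Suc)
  then show ?thesis using inv aux_mwait i
    by (auto simp: less_Suc_eq simp del: run_val.simps intro!: exI[of _ i])
next
  case (aux_mhead c)
  obtain i where i: "i < n" "a i \<noteq> 0" "out_of (a i) = c" "hc a (Suc i) n = 0"
      "run_val rl T n 0 = T n - T (Suc i)"
    using inv aux_mhead by auto
  have "run_val rl T (Suc n) 0 = T (Suc n) - T (Suc i)" "hc a (Suc i) (Suc n) = 1"
    unfolding run_val_Suc0 using rl aux_mhead i by (auto simp: hc_Suc)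
  then show ?thesis using inv aux_mhead i
    by (auto simp: less_Suc_eq simp del: run_val.simps intro!: exI[of _ i])
next
  case (aux_match c d)
  obtain i where i: "i < n" "a i \<noteq> 0" "out_of (a i) = c" "hc a (Suc i) n = 1"
      "run_val rl T n 0 = T n - T (Suc i)"
    using inv aux_match by auto
  have "T (Suc i) = T (Suc n) - 1" using sat aux_match i(5) by (simp add: gone_def delay_def)
  then have "claim n" using inv i aux_match tT
    by (auto simp: claim_def legit_def matches_def hc_Suc intro!: exI[of _ i])
  then show ?thesis using aux_match by auto
next
  case aux_acc
  then show ?thesis using inv by auto
qed

end

text \<open>No rule connects the refuting locations with the others, so the initial location decides
  for the whole run. In a refuting run, reaching \<open>LAcc\<close> leaves a refuted claim behind
  by \<open>refinv\<close>; in the other kind, all answers are 0 and only \<open>LFin\<close> can be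
  visited infinitely often.\<close>

lemma automaton_lang_cases:
  assumes w: "(\<lambda>i. ((a i, b i), t i)) \<in> ta_lang (automaton P x)"
  obtains (refuted) j where "b j \<noteq> 0" "\<forall>i<j. b i = 0" "legit a t j"
  | (unclaimed) ls where "\<forall>i. b i = 0" "\<forall>i. t i < t (Suc i)" "\<forall>n. brun P x ls a n" "\<exists>\<^sub>\<infinity>i. ls i = LFin"
proof -
  let ?A = "automaton P x"
  obtain loc T rl where run: "ta_run ?A loc T rl" and inf: "\<exists>\<^sub>\<infinity>i. loc i \<in> {lenc LAcc, lenc LFin}"
    and w': "\<And>j. ((a j, b j), t j) = (the (rule_letter (rl j)), T (Suc j))"
    using w unfolding automaton_lang_iff by meson
  have tT: "t i = T (Suc i)" for i using w' by simp
  define ls where "ls i = (THE l. lenc l = loc i)" for i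
  have ex: "\<exists>l a' b' g res l'. rl i = mk_rule l a' b' g res l' \<and> lenc l = loc i \<and> lenc l' = loc (Suc i) \<and>
      (bstep P x l a' l' \<and> b' = 0 \<and> g = gpos \<and> res \<or> aux (content_bound P) l a' b' g res l')" for i
  proof -
    have "rl i \<in> set (ta_rules ?A)" "rule_src (rl i) = loc i" "rule_tgt (rl i) = loc (Suc i)"
      using run unfolding ta_run_def by auto
    then show ?thesis unfolding set_rules by force
  qed
  have ls: "lenc (ls i) = loc i" for i
    using ex[of i] unfolding ls_def by (metis (mono_tags, lifting) lenc_inj the_equality)
  have step: "\<exists>g res. rl i = mk_rule (ls i) (a i) (b i) g res (ls (Suc i)) \<and>
      (bstep P x (ls i) (a i) (ls (Suc i)) \<and> b i = 0 \<and> g = gpos \<and> res \<or>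
       aux (content_bound P) (ls i) (a i) (b i) g res (ls (Suc i)))" for i
  proof -
    obtain l a' b' g res l' where e: "rl i = mk_rule l a' b' g res l'" "lenc l = loc i" "lenc l' = loc (Suc i)"
      "bstep P x l a' l' \<and> b' = 0 \<and> g = gpos \<and> res \<or> aux (content_bound P) l a' b' g res l'"
      using ex by blast
    have "l = ls i" "l' = ls (Suc i)" using e ls by (metis lenc_inj)+
    moreover have "a' = a i" "b' = b i" using w'[of i] e(1) by auto
    ultimately show ?thesis using e(1,4) by (intro exI[of _ g] exI[of _ res]) simp
  qed
  have sat: "sat (delay (run_val rl T i) (T (Suc i) - T i)) (rule_guard (rl i))" for i
    using run unfolding ta_run_def by blast
  have "loc 0 \<in> {lenc LS, lenc LA, lenc LB}" using run by (simp add: ta_run_def automaton_def)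
  then have ls0: "ls 0 \<in> {LS, LA, LB}" using ls[of 0] by (auto dest: sym)
  have inf': "\<exists>\<^sub>\<infinity>i. ls i \<in> {LAcc, LFin}"
  proof (rule INFM_mono[OF inf])
    fix i assume "loc i \<in> {lenc LAcc, lenc LFin}"
    then show "ls i \<in> {LAcc, LFin}" using ls[of i] by auto
  qed
  show thesis
  proof (cases "refuting (ls 0)")
    case True
    have inv: "refinv a b t T rl n (ls n)" for n
    proof (induction n)
      case 0
      show ?case using ls0 True by auto
    next
      case (Suc n)
      then have "refuting (ls n)" by (cases "ls n") auto
      with step[of n] bstep_not_refuting obtain g res where
        g: "rl n = mk_rule (ls n) (a n) (b n) g res (ls (Suc n))"
          "aux (content_bound P) (ls n) (a n) (b n) g res (ls (Suc n))" by blast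
      show ?case using refinv_step[OF Suc g(2,1) _ tT] sat[of n] g(1) by simp
    qed
    obtain n where "ls n \<in> {LAcc, LFin}" using inf' by (auto simp: INFM_nat)
    then have "\<exists>j. claim a b t j" using inv[of n] by auto
    then show thesis using refuted unfolding claim_def by blast
  next
    case False
    have nr: "\<not> refuting (ls n)" for n
    proof (induction n)
      case (Suc n)
      then show ?case using step[of n] aux_refuting bstep_not_refuting by blast
    qed (use False in simp)
    have b: "b i = 0" "bstep P x (ls i) (a i) (ls (Suc i))"
        "rl i = mk_rule (ls i) (a i) (b i) gpos True (ls (Suc i))" for i
      using step[of i] nr[of i] by (auto dest: aux_refuting)
    have clk: "run_val rl T i 0 = 0" for i
    proof (cases i)
      case (Suc k)
      then show ?thesis using b(3)[of k] unfolding Suc run_val_Suc0 by simp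
    qed simp
    have "T i < T (Suc i)" for i
      using sat[of i] b(3)[of i] clk[of i] by (simp add: gpos_def delay_def)
    then have "\<forall>i. t i < t (Suc i)" using tT by simp
    moreover have "\<forall>n. brun P x ls a n" using b(2) ls0 False by (auto simp: brun_def)
    moreover have "\<exists>\<^sub>\<infinity>i. ls i = LFin" 
    proof (rule INFM_mono[OF inf'])
      fix i assume "ls i \<in> {LAcc, LFin}"
      then show "ls i = LFin" using nr[of i] by auto
    qed
    ultimately show thesis using unclaimed b(1) by blast
  qed
qed

lemma automaton_langI:
  assumes "ls 0 \<in> {LS, LA, LB}"
    and rule: "\<And>i. mk_rule (ls i) (a i) (b i) (g i) (res i) (ls (Suc i)) \<in> set (ta_rules (automaton P x))"
    and sat: "\<And>i. sat (delay (run_val (\<lambda>i. mk_rule (ls i) (a i) (b i) (g i) (res i) (ls (Suc i))) (prev_time t) i)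
        (t i - prev_time t i)) (g i)"
    and inf: "\<exists>\<^sub>\<infinity>i. ls i \<in> {LAcc, LFin}" and t: "0 \<le> t 0" "\<And>i. t i \<le> t (Suc i)"
  shows "(\<lambda>i. ((a i, b i), t i)) \<in> ta_lang (automaton P x)"
proof -
  have pt: "prev_time t (Suc i) = t i" for i by (simp add: prev_time_def)
  have mono: "prev_time t i \<le> t i" for i using t by (cases i) (auto simp: prev_time_def)
  have "ta_run (automaton P x) (\<lambda>i. lenc (ls i)) (prev_time t)
      (\<lambda>i. mk_rule (ls i) (a i) (b i) (g i) (res i) (ls (Suc i)))"
    unfolding ta_run_def using assms(1) rule sat mono
    by (auto simp: pt automaton_def prev_time_def simp del: run_val.simps)
  moreover have "\<exists>\<^sub>\<infinity>i. lenc (ls i) \<in> {lenc LAcc, lenc LFin}" using inf by simp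
  ultimately show ?thesis unfolding automaton_lang_iff
    by (intro exI conjI allI) (assumption | simp add: pt)+
qed

lemma run_val_since_reset:
  assumes "i < n" "res i" "\<And>k. i < k \<Longrightarrow> k < n \<Longrightarrow> \<not> res k"
  shows "run_val (\<lambda>i. mk_rule (ls i) (a i) (b i) (g i) (res i) (ls (Suc i))) T n 0 = T n - T (Suc i)"
  using assms
proof (induction n)
  case (Suc n)
  show ?case
  proof (cases "i = n")
    case True
    then show ?thesis using Suc unfolding run_val_Suc0 by simp
  next
    case False
    then show ?thesis using Suc unfolding run_val_Suc0 by simp
  qed
qed simp

lemma automaton_lang_unclaimed:
  assumes "\<And>i. bstep P x (ls i) (a i) (ls (Suc i))" "ls 0 = LB" "\<exists>\<^sub>\<infinity>i. ls i = LFin"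
    "0 < t 0" "\<And>i. t i < t (Suc i)"
  shows "(\<lambda>i. ((a i, 0), t i)) \<in> ta_lang (automaton P x)"
proof (rule automaton_langI[where ls = ls and g = "\<lambda>_. gpos" and res = "\<lambda>_. True"])
  fix i
  show "mk_rule (ls i) (a i) 0 gpos True (ls (Suc i)) \<in> set (ta_rules (automaton P x))"
    using assms(1) unfolding set_rules by blast
  let ?rl = "\<lambda>i. mk_rule (ls i) (a i) 0 gpos True (ls (Suc i))"
  have "run_val ?rl (prev_time t) i 0 = 0" by (cases i) (simp_all add: run_val_Suc0 del: run_val.simps(2))
  moreover have "0 < t i - prev_time t i" using assms(4,5) by (cases i) (auto simp: prev_time_def)
  ultimately show "sat (delay (run_val ?rl (prev_time t) i) (t i - prev_time t i)) gpos"
    by (simp add: gpos_def delay_def)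
  show "\<exists>\<^sub>\<infinity>i. ls i \<in> {LAcc, LFin}" using assms(3) by (rule INFM_mono) auto
qed (use assms in \<open>auto intro: less_imp_le\<close>)

text \<open>The converse direction for refuted claims. Player I goes on with letter 0 forever
  because \<open>LAcc\<close> reads nothing else.\<close>

lemma automaton_lang_refuted:
  assumes j: "b j = 1" "\<And>i. i < j \<Longrightarrow> b i = 0" "legit a t j"
    and known: "\<And>i. i \<le> j \<Longrightarrow> a i \<in> letters (content_bound P)"
    and after: "\<And>i. j < i \<Longrightarrow> a i = 0 \<and> b i < 2"
    and t: "0 \<le> t 0" "\<And>i. t i \<le> t (Suc i)"
  shows "(\<lambda>i. ((a i, b i), t i)) \<in> ta_lang (automaton P x)"
proof -
  let ?C = "content_bound P"
  have main: ?thesis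
    if ls: "ls 0 \<in> {LS, LA}" "\<And>i. i > j \<Longrightarrow> ls i = LAcc"
      and au: "\<And>i. i \<le> j \<Longrightarrow> aux ?C (ls i) (a i) (b i) (g i) (res i) (ls (Suc i))"
      and sat: "\<And>i. i \<le> j \<Longrightarrow> g i = gone \<Longrightarrow>
         run_val (\<lambda>i. mk_rule (ls i) (a i) (b i) (g i) (res i) (ls (Suc i))) (prev_time t) i 0 + (t i - prev_time t i) = 1"
      and g: "\<And>i. g i \<in> {CTrue, gone}" "\<And>i. i > j \<Longrightarrow> g i = CTrue \<and> \<not> res i" for ls g res
  proof (rule automaton_langI[where ls = ls and g = g and res = res])
    fix i
    show "mk_rule (ls i) (a i) (b i) (g i) (res i) (ls (Suc i)) \<in> set (ta_rules (automaton P x))"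
    proof (cases "i \<le> j")
      case True
      then show ?thesis using au[of i] unfolding set_rules by blast
    next
      case False
      then have "aux ?C (ls i) (a i) (b i) (g i) (res i) (ls (Suc i))"
        using ls(2) after[of i] g(2)[of i] by (simp add: aux_acc)
      then show ?thesis unfolding set_rules by blast
    qed
    show "sat (delay (run_val (\<lambda>i. mk_rule (ls i) (a i) (b i) (g i) (res i) (ls (Suc i))) (prev_time t) i)
        (t i - prev_time t i)) (g i)"
    proof (cases "g i = gone")
      case True
      then have "i \<le> j" using g(2)[of i] by (cases "i \<le> j") (auto simp: gone_def)
      from sat[OF this True] show ?thesis using True by (simp add: gone_def delay_def)
    next
      case False
      then show ?thesis using g(1)[of i] by simp
    qed
    show "\<exists>\<^sub>\<infinity>i. ls i \<in> {LAcc, LFin}"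
      unfolding INFM_nat
    proof
      fix m
      have "ls (Suc (max m j)) = LAcc" by (rule ls(2)) simp
      then show "\<exists>n>m. ls n \<in> {LAcc, LFin}" by (intro exI[of _ "Suc (max m j)"]) auto
    qed
  qed (use ls t in auto)
  from j(3) consider "j = 0" "a 0 = 0" | "a j = 1"
    | i where "i < j" "t i = t j - 1" "matches (a i) (a j)" "hc a (Suc i) (Suc j) = 1"
    unfolding legit_def by metis
  then show ?thesis
  proof cases
    case 1
    show ?thesis
      by (rule main[where ls = "\<lambda>i. if i = 0 then LS else LAcc" and g = "\<lambda>_. CTrue" and res = "\<lambda>_. False"])
        (use 1 j in \<open>auto simp: aux_first gone_def simp del: One_nat_def\<close>)
  next
    case 2
    show ?thesis
      by (rule main[where ls = "\<lambda>i. if i \<le> j then LA else LAcc" and g = "\<lambda>_. CTrue" and res = "\<lambda>_. False"])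
        (use 2 j known in \<open>auto simp: aux_fresh aux_wait gone_def not_less_eq_eq le_antisym simp del: One_nat_def\<close>)
  next
    case (3 i)
    define g where "g k = (if k = j then gone else CTrue)" for k
    \<comment> \<open>Guess the original at \<open>i\<close>; from then on the flag of
      \<open>LM\<close> is the number of headers read since, which \<open>small\<close> bounds by
      1.\<close>
    define ls where "ls k = (if k \<le> i then LA else if k \<le> j then
      (if a i = 0 then LH else LM (out_of (a i)) (hc a (Suc i) k = 1)) else LAcc)" for k
    have small: "hc a (Suc i) k \<le> 1" if "k \<le> Suc j" for k
      using hc_mono[of "Suc i" "Suc i" k "Suc j" a] that 3(4) by simp
    show ?thesis
    proof (rule main[where ls = ls and g = g and res = "\<lambda>k. k = i"])
      fix k assume k: "k \<le> j"
      have C: "out_of (a i) < ?C" if "a i \<noteq> 0" using out_of_letters[OF known that] 3(1) by simp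
      consider "k < i" | "k = i" | "i < k" "k < j" | "k = j" "i < k" using k 3(1) by linarith
      then show "aux ?C (ls k) (a k) (b k) (g k) (k = i) (ls (Suc k))"
      proof cases
        case 1
        then have "a k \<in> letters ?C" "b k = 0" using known[of k] j(2)[of k] k 3(1) by auto
        then show ?thesis using 1 3(1) by (simp add: ls_def g_def aux_wait)
      next
        case 2
        have "a k \<in> letters ?C" "b k = 0" using known[of k] j(2)[of k] 2 3(1) by auto
        then show ?thesis using 2 3(1) by (auto simp: ls_def g_def aux_head aux_cell)
      next
        case k: 3
        have *: "a k \<in> letters ?C" "b k = 0" using known[of k] j(2)[of k] k by auto
        show ?thesis
        proof (cases "a i = 0")
          case True
          \<comment> \<open>The tick \<open>j\<close> is itself the one header after
            \<open>i\<close>, so none occurs strictly in between and \<open>LH\<close> is not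
            blocked.\<close>
          have "hc a (Suc i) (Suc j) = hc a (Suc i) j + 1"
            using 3 True by (auto simp: hc_Suc matches_def)
          then have "hc a (Suc i) (Suc k) = 0"
            using hc_mono[of "Suc i" "Suc i" "Suc k" j a] k 3(4) by simp
          then have "a k \<noteq> 0" using k by (auto simp: hc_Suc split: if_splits)
          then show ?thesis using True k * by (simp add: ls_def g_def aux_hwait)
        next
          case False
          show ?thesis
          proof (cases "a k = 0")
            case True
            then have "hc a (Suc i) k = 0" "hc a (Suc i) (Suc k) = 1"
              using small[of "Suc k"] k by (auto simp: hc_Suc)
            then show ?thesis using True False k * C by (simp add: ls_def g_def aux_mhead)
          next
            case nz: False
            then have "hc a (Suc i) (Suc k) = hc a (Suc i) k" using k by (simp add: hc_Suc)
            then show ?thesis using nz False k * C by (simp add: ls_def g_def aux_mwait)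
          qed
        qed
      next
        case 4
        show ?thesis
        proof (cases "a i = 0")
          case True
          then show ?thesis using 4 3 j aux_hmatch by (auto simp: ls_def g_def matches_def simp del: One_nat_def)
        next
          case False
          then have m: "2 \<le> a j" "in_of (a j) = out_of (a i)" using 3(3) by (auto simp: matches_def)
          then have e: "a j = cell (out_of (a i)) (out_of (a j))" using cell_in_out by metis
          have "hc a (Suc i) j = 1" using 3 m by (simp add: hc_Suc)
          moreover have "out_of (a j) < ?C" using out_of_letters[OF known] m by simp
          ultimately show ?thesis using False 4 3(1) j(1) aux_match[OF C[OF False], of "out_of (a j)"] e
            by (simp add: ls_def g_def del: One_nat_def)
        qed
      qed
    next
      fix k assume "k \<le> j" "g k = gone"
      then have k: "k = j" by (auto simp: g_def gone_def split: if_splits)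
      have "run_val (\<lambda>i'. mk_rule (ls i') (a i') (b i') (g i') (i' = i) (ls (Suc i'))) (prev_time t) k 0
         = prev_time t k - prev_time t (Suc i)"
        using 3(1) k by (intro run_val_since_reset) auto
      then show "run_val (\<lambda>i'. mk_rule (ls i') (a i') (b i') (g i') (i' = i) (ls (Suc i'))) (prev_time t) k 0
         + (t k - prev_time t k) = 1"
        using 3(2) k by (simp add: prev_time_def)
    qed (use 3(1) in \<open>auto simp: ls_def g_def\<close>)
  qed
qed

section \<open>A controller for halting programs\<close>

lemma hc_split: "i \<le> j \<Longrightarrow> j \<le> k \<Longrightarrow> hc a i k = hc a i j + hc a j k"
proof (induction k)
  case (Suc k)
  then show ?case by (cases "j = Suc k") (auto simp: hc_Suc)
qed simp

section \<open>Contents of the current and the previous configuration\<close>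

definition cur :: "(nat \<Rightarrow> nat) \<Rightarrow> nat \<Rightarrow> nat set" where
  "cur a n = {i. i < n \<and> a i \<noteq> 0 \<and> hc a i n = 0}"

definition prv :: "(nat \<Rightarrow> nat) \<Rightarrow> nat \<Rightarrow> nat set" where
  "prv a n = {i. i < n \<and> a i \<noteq> 0 \<and> hc a i n = 1}"

lemma finite_cur [simp]: "finite (cur a n)" "finite (prv a n)"
  by (auto simp: cur_def prv_def)

lemma cur_Suc: "cur a (Suc n) = (if a n = 0 then {} else insert n (cur a n))"
  by (auto simp: cur_def hc_Suc less_Suc_eq)

lemma prv_Suc: "prv a (Suc n) = (if a n = 0 then cur a n else prv a n)"
  by (auto simp: cur_def prv_def hc_Suc less_Suc_eq)

definition cur_out :: "(nat \<Rightarrow> nat) \<Rightarrow> nat \<Rightarrow> nat multiset" where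
  "cur_out a n = image_mset (\<lambda>i. out_of (a i)) (mset_set (cur a n))"

text \<open>Created cells have no original and are left out; so this multiset can be compared with
  the contents that the previous configuration hands on.\<close>

definition cur_in :: "(nat \<Rightarrow> nat) \<Rightarrow> nat \<Rightarrow> nat multiset" where
  "cur_in a n = image_mset (\<lambda>i. in_of (a i)) (mset_set {i \<in> cur a n. 2 \<le> a i})"

definition prv_out :: "(nat \<Rightarrow> nat) \<Rightarrow> nat \<Rightarrow> nat multiset" where
  "prv_out a n = image_mset (\<lambda>i. out_of (a i)) (mset_set (prv a n))"

fun upd :: "nat \<Rightarrow> nat multiset \<times> nat multiset \<times> nat multiset \<Rightarrow> nat multiset \<times> nat multiset \<times> nat multiset" where
  "upd l (p, i, out) = (if l = 0 then (out, {#}, {#}) else if l = 1 then (p, i, add_mset 1 out)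
     else (p, add_mset (in_of l) i, add_mset (out_of l) out))"

lemma contents_Suc:
  "(prv_out a (Suc n), cur_in a (Suc n), cur_out a (Suc n)) = upd (a n) (prv_out a n, cur_in a n, cur_out a n)"
proof -
  have n: "n \<notin> cur a n" by (auto simp: cur_def)
  show ?thesis
  proof (cases "a n = 0")
    case True
    then show ?thesis by (simp add: prv_out_def cur_in_def cur_out_def cur_Suc prv_Suc)
  next
    case False
    have out: "cur_out a (Suc n) = add_mset (out_of (a n)) (cur_out a n)"
      using False n by (simp add: cur_out_def cur_Suc)
    have e: "{i \<in> insert n (cur a n). 2 \<le> a i} =
        (if a n = 1 then {i \<in> cur a n. 2 \<le> a i} else insert n {i \<in> cur a n. 2 \<le> a i})"
      using False by auto
    have "cur_in a (Suc n) = (if a n = 1 then cur_in a n else add_mset (in_of (a n)) (cur_in a n))"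
    proof -
      have "cur_in a (Suc n) = image_mset (\<lambda>i. in_of (a i)) (mset_set {i \<in> insert n (cur a n). 2 \<le> a i})"
        unfolding cur_in_def cur_Suc using False by simp
      then show ?thesis unfolding e using n by (simp add: cur_in_def)
    qed
    then show ?thesis using False out by (auto simp: prv_out_def prv_Suc)
  qed
qed

lemma contents_0: "prv_out a 0 = {#}" "cur_in a 0 = {#}" "cur_out a 0 = {#}"
  by (auto simp: prv_out_def cur_in_def cur_out_def cur_def prv_def)

lemma image_mset_inj_subset:
  assumes "finite S'" "inj_on \<phi> S" "\<phi> ` S \<subseteq> S'" "\<And>j. j \<in> S \<Longrightarrow> g (\<phi> j) = f j"
  shows "image_mset f (mset_set S) \<subseteq># image_mset g (mset_set S')"
proof (cases "finite S")
  case True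
  have "image_mset f (mset_set S) = image_mset (g \<circ> \<phi>) (mset_set S)"
    using assms(4) True by (intro image_mset_cong) auto
  also have "\<dots> = image_mset g (mset_set (\<phi> ` S))"
    using assms(2) by (simp flip: image_mset_mset_set add: multiset.map_comp)
  also have "\<dots> \<subseteq># image_mset g (mset_set S')"
    using assms(1,3) by (intro image_mset_subseteq_mono subset_imp_msubset_mset_set)
  finally show ?thesis .
qed simp

text \<open>Distinct ticks of a configuration are copied from distinct ticks of the previous one.\<close>
lemma cur_in_subset_prv_out:
  assumes leg: "\<And>i. i < n \<Longrightarrow> legit a t i" and t: "\<And>i. t i < t (Suc i)"
  shows "cur_in a n \<subseteq># prv_out a n"
proof -
  let ?S = "{i \<in> cur a n. 2 \<le> a i}"
  have "\<exists>i\<in>prv a n. t i = t j - 1 \<and> out_of (a i) = in_of (a j)" if j: "j \<in> ?S" for j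
  proof -
    have "j < n" "2 \<le> a j" "hc a j n = 0" using j by (auto simp: cur_def)
    moreover from this have "legit a t j" using leg by simp
    ultimately obtain i where i: "i < j" "t i = t j - 1" "matches (a i) (a j)" "hc a (Suc i) (Suc j) = 1"
      by (auto simp: legit_def)
    have nz: "a i \<noteq> 0" "out_of (a i) = in_of (a j)" using i(3) \<open>2 \<le> a j\<close> by (auto simp: matches_def)
    have "hc a j n = hc a j (Suc j) + hc a (Suc j) n" using \<open>j < n\<close> by (intro hc_split) auto
    then have "hc a (Suc j) n = 0" using \<open>hc a j n = 0\<close> by simp
    moreover have "hc a i n = hc a i (Suc i) + hc a (Suc i) n" using i(1) \<open>j < n\<close> by (intro hc_split) auto
    moreover have "hc a (Suc i) n = hc a (Suc i) (Suc j) + hc a (Suc j) n"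
      using i(1) \<open>j < n\<close> by (intro hc_split) auto
    moreover have "hc a i (Suc i) = 0" using nz by (simp add: hc_Suc)
    ultimately have "i \<in> prv a n" using i nz \<open>j < n\<close> by (simp add: prv_def)
    then show ?thesis using i nz by blast
  qed
  then obtain \<phi> where \<phi>: "\<And>j. j \<in> ?S \<Longrightarrow> \<phi> j \<in> prv a n \<and> t (\<phi> j) = t j - 1 \<and> out_of (a (\<phi> j)) = in_of (a j)"
    by metis
  have "strict_mono t" using t by (simp add: strict_mono_Suc_iff)
  then have "inj t" by (rule strict_mono_imp_inj_on)
  have "inj_on \<phi> ?S"
  proof (rule inj_onI)
    fix j j' assume "j \<in> ?S" "j' \<in> ?S" "\<phi> j = \<phi> j'"
    then have "t j = t j'" using \<phi>[of j] \<phi>[of j'] by simp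
    then show "j = j'" using \<open>inj t\<close> by (simp add: inj_eq)
  qed
  then show ?thesis unfolding cur_in_def prv_out_def
    using \<phi> by (intro image_mset_inj_subset[where \<phi> = \<phi>]) auto
qed

context
  fixes P :: "ins list" and x T :: nat
begin

definition st :: "nat \<Rightarrow> ins list \<times> store" where
  "st k = (nstep ^^ k) (P, input_store x)"

text \<open>Room for the created cell, \<open>x\<close> units of input and one cell for each of
  \<open>T\<close> steps, plus one cell to spare: a round of this size that loses nothing still has
  a free cell when the program halts.\<close>

definition cap :: nat where "cap = x + T + 2"

text \<open>The last conjunct says that at most \<open>1 + x + k\<close> cells have ceased to be
  free: the created one, the input, and at most one per step.\<close>

definition exact :: "nat \<Rightarrow> nat multiset \<Rightarrow> bool" where
  "exact k M \<longleftrightarrow> size M = cap \<and> (\<forall>r. count M (Suc (Suc r)) = snd (st k) r) \<and> cap \<le> count M 0 + 1 + x + k"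

text \<open>Below capacity nothing needs to be known about the contents: the round may restart at
  will and is still within \<open>cap\<close> after gaining its one cell.\<close>

definition sim :: "ins list \<Rightarrow> nat multiset \<Rightarrow> bool" where
  "sim Q M \<longleftrightarrow> size M < cap \<or> (\<exists>k\<le>T. fst (st k) = Q \<and> exact k M)"

text \<open>A configuration that starts a round with \<open>cap\<close> cells and has lost none of them since
  simulates the machine faithfully, and then it never runs out of free cells.\<close>
fun binv :: "loc \<Rightarrow> nat multiset \<times> nat multiset \<times> nat multiset \<Rightarrow> bool" where
  "binv LB (p, i, out) \<longleftrightarrow> p = {#} \<and> i = {#} \<and> out = {#}"
| "binv LF (p, i, out) \<longleftrightarrow> size p < cap \<and> i = {#} \<and> out = {#}"
| "binv (Lc m) (p, i, out) \<longleftrightarrow> size p < cap \<and> m \<le> x \<and> size out = size i + 1 \<and>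
     (\<exists>z. out = {#1#} + replicate_mset (x - m) 2 + replicate_mset z 0 \<and> (0 < m \<longrightarrow> z = 0))"
| "binv LX (p, i, out) \<longleftrightarrow> size p \<le> cap \<and> (size p < cap \<or> 0 \<in># p) \<and> size out = size i \<and> 0 \<notin># i"
| "binv LFin (p, i, out) \<longleftrightarrow> size p \<le> cap \<and> size out = size i"
| "binv (LU Q) (p, i, out) \<longleftrightarrow> sim Q p \<and> out = i"
| "binv (LV Q) (p, i, out) \<longleftrightarrow> size p \<le> cap \<and> size out = size i \<and> (size p < cap \<or>
     (\<exists>k<T. fst (st (Suc k)) = Q \<and> exact k p \<and> (\<exists>c d. add_mset c out = add_mset d i \<and>
       (\<forall>M M'. exact k M \<longrightarrow> add_mset c M' = add_mset d M \<longrightarrow> exact (Suc k) M'))))"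
| "binv (LZ Q) (p, i, out) \<longleftrightarrow> sim Q p \<and> out = i \<and> (\<forall>r A Q'. Q = Loop r A # Q' \<longrightarrow> r + 2 \<notin># i)"
| "binv (LZV r Q) (p, i, out) \<longleftrightarrow> size p \<le> cap \<and> size out = size i \<and> r + 2 \<notin># i \<and> (size p < cap \<or>
     (\<exists>k<T. (\<exists>A. fst (st k) = Loop r A # Q) \<and> exact k p \<and> add_mset 0 out = add_mset 1 i))"
| "binv _ _ \<longleftrightarrow> False"

lemma st_Suc: "st (Suc k) = nstep (st k)"
  by (simp add: st_def)

lemma sim_size: "sim Q M \<Longrightarrow> size M \<le> cap"
  by (auto simp: sim_def exact_def)

lemma sim_free: "sim Q M \<Longrightarrow> size M < cap \<or> 0 \<in># M"
  by (auto simp: sim_def exact_def cap_def simp flip: count_greater_zero_iff)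

lemma count_add_mset_exchange:
  assumes "add_mset c M' = add_mset d M"
  shows "count M' y + (if y = c then 1 else 0) = count M y + (if y = d then 1 else 0)" "size M' = size M"
  using arg_cong[OF assms, of "\<lambda>N. count N y"] arg_cong[OF assms, of size] by (auto split: if_splits)

lemma exact_inc:
  assumes "exact k M" "fst (st k) = Inc r # Q" "add_mset 0 M' = add_mset (r + 2) M"
  shows "exact (Suc k) M'"
proof -
  obtain \<sigma> where s: "st k = (Inc r # Q, \<sigma>)" using assms(2) by (cases "st k") auto
  then have s': "st (Suc k) = (Q, \<sigma>(r := Suc (\<sigma> r)))" by (simp add: st_Suc)
  have "count M' (Suc (Suc q)) = count M (Suc (Suc q)) + (if q = r then 1 else 0)" for q
    using count_add_mset_exchange(1)[OF assms(3), of "Suc (Suc q)"] by simp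
  moreover have "count M' 0 + 1 = count M 0" using count_add_mset_exchange(1)[OF assms(3), of 0] by simp
  ultimately show ?thesis
    using assms(1) s s' count_add_mset_exchange(2)[OF assms(3)] by (auto simp: exact_def)
qed

lemma exact_dec:
  assumes "exact k M" "fst (st k) = Loop r A # Q" "add_mset (r + 2) M' = add_mset 1 M"
  shows "exact (Suc k) M' \<and> fst (st (Suc k)) = A @ Loop r A # Q"
proof -
  obtain \<sigma> where s: "st k = (Loop r A # Q, \<sigma>)" using assms(2) by (cases "st k") auto
  have c: "count M' (Suc (Suc q)) + (if q = r then 1 else 0) = count M (Suc (Suc q))" for q
    using count_add_mset_exchange(1)[OF assms(3), of "Suc (Suc q)"] by simp
  then have "0 < \<sigma> r" using c[of r] assms(1) s by (simp add: exact_def)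
  then have s': "st (Suc k) = (A @ Loop r A # Q, \<sigma>(r := \<sigma> r - 1))" using s by (simp add: st_Suc)
  have "count M' 0 = count M 0" using count_add_mset_exchange(1)[OF assms(3), of 0] by simp
  moreover have "count M' (Suc (Suc q)) = (\<sigma>(r := \<sigma> r - 1)) q" for q
    using c[of q] assms(1) s by (auto simp: exact_def)
  ultimately show ?thesis
    using assms(1) s' count_add_mset_exchange(2)[OF assms(3)] by (auto simp: exact_def)
qed

lemma exact_zero:
  assumes "exact k M" "fst (st k) = Loop r A # Q" "add_mset 0 M' = add_mset 1 M" "r + 2 \<notin># M"
  shows "exact (Suc k) M' \<and> fst (st (Suc k)) = Q"
proof -
  obtain \<sigma> where s: "st k = (Loop r A # Q, \<sigma>)" using assms(2) by (cases "st k") auto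
  have "\<sigma> r = 0" using assms(1,4) s by (auto simp: exact_def not_in_iff)
  then have s': "st (Suc k) = (Q, \<sigma>)" using s by (simp add: st_Suc)
  have "count M' (Suc (Suc q)) = count M (Suc (Suc q))" for q
    using count_add_mset_exchange(1)[OF assms(3), of "Suc (Suc q)"] by simp
  moreover have "count M' 0 + 1 = count M 0" using count_add_mset_exchange(1)[OF assms(3), of 0] by simp
  ultimately show ?thesis
    using assms(1) s s' count_add_mset_exchange(2)[OF assms(3)] by (auto simp: exact_def)
qed

context
  assumes halted: "fst (st T) = []"
begin

lemma running: "k \<le> T \<Longrightarrow> fst (st k) = i # Q \<Longrightarrow> k < T"
  using halted by (cases "k = T") auto

text \<open>If the finished configuration still has \<open>cap\<close> cells, nothing was omitted,
  so \<open>i = p\<close> and the exchange stored in \<open>binv\<close> turns an exact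
  configuration into an exact one for the next step. Otherwise the first disjunct of
  \<open>sim\<close> holds.\<close>

lemma binv_LV_sim:
  assumes "binv (LV Q) (p, i, out)" "i \<subseteq># p"
  shows "sim Q out"
proof (cases "size out < cap")
  case False
  then have "size i \<ge> size p" "size p \<ge> cap" using assms size_mset_mono[OF assms(2)] by auto
  then have "i = p" using assms(2) by (metis mset_subset_size leD subset_mset.le_imp_less_or_eq)
  then show ?thesis using assms(1) \<open>size p \<ge> cap\<close> unfolding sim_def
    by auto (metis Suc_leI)
qed (simp add: sim_def)

lemma binv_LZV_sim:
  assumes "binv (LZV r Q) (p, i, out)" "i \<subseteq># p"
  shows "sim Q out"
proof (cases "size out < cap")
  case False
  then have "size i \<ge> size p" "size p \<ge> cap" using assms size_mset_mono[OF assms(2)] by auto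
  then have ip: "i = p" using assms(2) by (metis mset_subset_size leD subset_mset.le_imp_less_or_eq)
  then obtain k A where "k < T" "fst (st k) = Loop r A # Q" "exact k p" "add_mset 0 out = add_mset 1 p"
    using assms(1) \<open>size p \<ge> cap\<close> by auto
  moreover have "r + 2 \<notin># p" using assms(1) ip by simp
  ultimately have "exact (Suc k) out \<and> fst (st (Suc k)) = Q" using exact_zero by blast
  then show ?thesis using \<open>k < T\<close> unfolding sim_def by (intro disjI2 exI[of _ "Suc k"]) auto
qed (simp add: sim_def)

lemma sim_enter:
  assumes "sim Q M" "l \<in> {LX, LU Q, LZ Q}"
  shows "binv l (M, {#}, {#})"
  using assms sim_size[OF assms(1)] sim_free[OF assms(1)] by auto

lemma binv_step:
  assumes inv: "binv l (p, i, out)" and sub: "i \<subseteq># p" and step: "bstep P x l a l'"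
    and sub': "upd a (p, i, out) = (p', i', out')" "i' \<subseteq># p'"
  shows "binv l' (upd a (p, i, out))"
proof -
  consider "bbase P l a l'" | "l = LF" "a = 1" "l' = Lc x"
    | m where "m < x" "l = Lc (Suc m)" "a = cell 0 2" "l' = Lc m"
    | m where "m < x" "l = Lc (Suc m)" "a = 0" "l' = LX"
    using step unfolding bstep_def by blast
  then show ?thesis
  proof cases
    case 1
    then show ?thesis
    proof cases
      case b_init
      then show ?thesis using inv by (simp add: cap_def)
    next
      case b_rest
      then obtain z where "out = {#1#} + replicate_mset x 2 + replicate_mset z 0" using inv by auto
      then show ?thesis using inv b_rest by (auto intro!: exI[of _ "Suc z"])
    next
      case b_loaded
      obtain z where z: "out = {#1#} + replicate_mset x 2 + replicate_mset z 0" "size out \<le> cap"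
        using inv b_loaded size_mset_mono[OF sub] by auto
      have "sim P out"
      proof (cases "size out < cap")
        case False
        then have "size out = cap" using z(2) by simp
        then have "exact 0 out" using z(1) by (auto simp: exact_def st_def input_store_def)
        then show ?thesis unfolding sim_def by (auto simp: st_def intro!: exI[of _ 0])
      qed (simp add: sim_def)
      then show ?thesis using sim_enter b_loaded by simp
    next
      case (b_restart c)
      then show ?thesis using inv by auto
    next
      case b_restarted
      \<comment> \<open>A configuration of full size contains a free cell, but \<open>LX\<close>
        never copies one. So a restart from full size has lost a cell.\<close>
      have "size out < cap"
      proof (rule ccontr)
        assume "\<not> size out < cap"
        then have "size i \<ge> size p" "size p \<ge> cap" using inv b_restarted size_mset_mono[OF sub] by auto
        then have "i = p" using sub by (metis mset_subset_size leD subset_mset.le_imp_less_or_eq)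
        then show False using inv b_restarted \<open>size p \<ge> cap\<close> by auto
      qed
      then show ?thesis using b_restarted by auto
    next
      case (b_fin c d)
      then show ?thesis using inv by auto
    next
      case (b_keep Q c)
      then show ?thesis using inv by (auto simp: add_mset_commute)
    next
      case (b_inc r Q)
      have "sim (Inc r # Q) p" "out = i" using inv b_inc by auto
      moreover have "\<exists>k<T. fst (st (Suc k)) = Q \<and> exact k p \<and> (\<exists>c d. add_mset c (add_mset (r + 2) i) = add_mset d (add_mset 0 i) \<and>
       (\<forall>M M'. exact k M \<longrightarrow> add_mset c M' = add_mset d M \<longrightarrow> exact (Suc k) M'))"
        if k: "k \<le> T" "fst (st k) = Inc r # Q" "exact k p" for k
      proof (rule exI[of _ k], intro conjI, goal_cases)
        case 4
        show ?case by (rule exI[of _ 0], rule exI[of _ "r + 2"]) (use exact_inc k(2) in \<open>auto simp: add_mset_commute\<close>)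
      next
        case 1
        show ?case using running k by blast
      next
        case 2
        show ?case using k(2) by (cases "st k") (simp add: st_Suc)
      qed (use k in auto)
      ultimately show ?thesis using sim_size[of "Inc r # Q" p] b_inc by (auto simp: sim_def)
    next
      case (b_dec r A Q)
      have "sim (Loop r A # Q) p" "out = i" using inv b_dec by auto
      \<comment> \<open>The decremented unit is a copy, so it has an original in \<open>p\<close>:
        the register really is nonzero. This uses the inclusion after the step.\<close>
      moreover have "r + 2 \<in># p" using sub' b_dec by (auto dest: mset_subset_eqD)
      moreover have "\<exists>k<T. fst (st (Suc k)) = A @ Loop r A # Q \<and> exact k p \<and> (\<exists>c d. add_mset c (add_mset 1 i) = add_mset d (add_mset (r + 2) i) \<and>
       (\<forall>M M'. exact k M \<longrightarrow> add_mset c M' = add_mset d M \<longrightarrow> exact (Suc k) M'))"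
        if k: "k \<le> T" "fst (st k) = Loop r A # Q" "exact k p" "r + 2 \<in># p" for k
      proof (rule exI[of _ k], intro conjI, goal_cases)
        case 4
        show ?case by (rule exI[of _ "r + 2"], rule exI[of _ 1]) (use exact_dec k(2) in \<open>auto simp: add_mset_commute\<close>)
      next
        case 1
        show ?case using running k by blast
      next
        case 2
        \<comment> \<open>The hypothetical lossless successor of \<open>p\<close>, used only to
          obtain the next program from \<open>exact_dec\<close>.\<close>
        have "add_mset (r + 2) (add_mset 1 p - {#r + 2#}) = add_mset 1 p" using k(4) by simp
        then show ?case using exact_dec k(2,3) by blast
      qed (use k in auto)
      ultimately show ?thesis using sim_size[of "Loop r A # Q" p] b_dec by (auto simp: sim_def)
    next
      case (b_next Q)
      then show ?thesis using sim_enter[OF binv_LV_sim[of Q p i out]] inv sub by simp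
    next
      case (b_zkeep r A Q c)
      then show ?thesis using inv by (auto simp: add_mset_commute)
    next
      case (b_zero r A Q)
      have "sim (Loop r A # Q) p" "out = i" "r + 2 \<notin># i" using inv b_zero by auto
      moreover have "\<exists>k<T. (\<exists>A. fst (st k) = Loop r A # Q) \<and> exact k p" if "\<not> size p < cap"
        using that \<open>sim (Loop r A # Q) p\<close> running unfolding sim_def by blast
      ultimately show ?thesis using sim_size[of "Loop r A # Q" p] b_zero
        by (cases "size p < cap") (auto simp: add_mset_commute)
    next
      case (b_znext r A Q)
      then show ?thesis using sim_enter[OF binv_LZV_sim[of r Q p i out]] inv sub by simp
    qed
  next
    case 2
    then show ?thesis using inv by auto
  next
    case 3
    then have "x - m = Suc (x - Suc m)" by simp
    then show ?thesis using inv 3 by auto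
  next
    case 4
    then show ?thesis using inv by (auto simp: cap_def)
  qed
qed

lemma binv_size:
  assumes "binv l (p, i, out)" "i \<subseteq># p"
  shows "size p \<le> cap" "size out \<le> cap"
  using assms size_mset_mono[OF assms(2)] by (cases l; auto dest: sim_size)+

end
end

lemma halts_bounded:
  assumes "halts P x"
  obtains K where "\<And>a t ls n. brun P x ls a n \<Longrightarrow> (\<And>i. i < n \<Longrightarrow> legit a t i) \<Longrightarrow>
    (\<And>i. t i < t (Suc i)) \<Longrightarrow> card (cur a n) \<le> K \<and> card (prv a n) \<le> K"
proof -
  obtain T where T: "fst (st P x T) = []" using assms unfolding halts_def st_def by blast
  show thesis
  proof (rule that)
    fix a n and t :: "nat \<Rightarrow> real" and ls
    assume run: "brun P x ls a n" and leg: "\<And>i. i < n \<Longrightarrow> legit a t i" and t: "\<And>i. t i < t (Suc i)"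
    have sub: "cur_in a m \<subseteq># prv_out a m" if "m \<le> n" for m
      using that leg t by (intro cur_in_subset_prv_out[of m a t]) auto
    have "binv P x T (ls m) (prv_out a m, cur_in a m, cur_out a m)" if "m \<le> n" for m
      using that
    proof (induction m)
      case 0
      then show ?case using run by (simp add: brun_def contents_0)
    next
      case (Suc m)
      have step: "bstep P x (ls m) (a m) (ls (Suc m))" using run Suc.prems by (simp add: brun_def)
      have "binv P x T (ls m) (prv_out a m, cur_in a m, cur_out a m)" using Suc by simp
      from binv_step[OF T this sub step contents_Suc[symmetric] sub] Suc.prems
      show ?case unfolding contents_Suc by simp
    qed
    from binv_size[OF T this[of n] sub[of n]]
    show "card (cur a n) \<le> cap x T \<and> card (prv a n) \<le> cap x T"
      by (simp add: cur_out_def prv_out_def)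
  qed
qed


section \<open>The controller with cyclic memory\<close>

definition mem :: "nat \<Rightarrow> (nat \<Rightarrow> nat) \<Rightarrow> nat \<Rightarrow> nat \<times> (nat \<times> nat) list" where
  "mem k a n = (n mod k, map (\<lambda>i. (i mod k, a i)) [n - k..<n])"

text \<open>The memory holds the last \<open>k\<close> letters, each paired with the clock that was
  reset at it. Clocks are reused cyclically, and the first component is the clock due next.\<close>

definition remember :: "nat \<Rightarrow> nat \<times> (nat \<times> nat) list \<Rightarrow> nat \<Rightarrow> nat \<times> (nat \<times> nat) list" where
  "remember k s l = (Suc (fst s) mod k, drop (Suc (length (snd s)) - k) (snd s @ [(fst s, l)]))"

lemma remember_mem: "0 < k \<Longrightarrow> remember k (mem k a n) (a n) = mem k a (Suc n)"
proof -
  assume k: "0 < k"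
  have "drop (Suc (n - (n - k)) - k) ([n - k..<n] @ [n]) = [Suc n - k..<Suc n]"
  proof (cases "n < k")
    case False
    then have "[n - k..<n] = (n - k) # [Suc (n - k)..<n]" using k by (simp add: upt_conv_Cons)
    then show ?thesis using False k by (simp add: Suc_diff_le)
  qed simp
  then have "drop (Suc (n - (n - k)) - k) (map (\<lambda>i. (i mod k, a i)) ([n - k..<n] @ [n])) =
      map (\<lambda>i. (i mod k, a i)) [Suc n - k..<Suc n]"
    by (simp only: drop_map)
  then show ?thesis by (simp add: remember_def mem_def mod_Suc_eq)
qed

definition hdrs :: "(nat \<times> nat) list \<Rightarrow> nat" where
  "hdrs h = length (filter (\<lambda>y. snd y = 0) h)"

lemma hdrs_map: "hdrs (map (\<lambda>i. (f i, a i)) [i..<j]) = hc a i j"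
proof (induction j)
  case (Suc j)
  then show ?case by (cases "i \<le> j") (auto simp: hdrs_def hc_Suc)
qed (simp add: hdrs_def)

definition justified :: "(nat \<times> nat) list \<Rightarrow> nat \<Rightarrow> valuation \<Rightarrow> bool" where
  "justified h l \<nu> \<longleftrightarrow> l = 1 \<or> h = [] \<and> l = 0 \<or>
     (\<exists>q<length h. \<nu> (fst (h ! q)) = 1 \<and> matches (snd (h ! q)) l \<and>
        hdrs (drop (Suc q) h) + (if l = 0 then 1 else 0) = 1)"

text \<open>The controller claims only if its memory reaches back to the beginning or over two
  configuration starts, so that no justification can lie outside of it.\<close>
definition claims :: "nat \<Rightarrow> (nat \<times> nat) list \<Rightarrow> nat \<Rightarrow> valuation \<Rightarrow> bool" where
  "claims k h l \<nu> \<longleftrightarrow> (length h < k \<or> 2 \<le> hdrs h) \<and> \<not> justified h l \<nu>"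

definition ctrl :: "nat \<Rightarrow> ctrl_fun" where
  "ctrl k l a R = (let s = from_nat l :: nat \<times> (nat \<times> nat) list in
     (to_nat (remember k s a), if claims k (snd s) a (SOME \<nu>. \<nu> \<in> R) then 1 else 0, {fst s}))"

lemma ctrl_to_nat:
  "ctrl k (to_nat s) a R = (to_nat (remember k s a), if claims k (snd s) a (SOME \<nu>. \<nu> \<in> R) then 1 else 0, {fst s})"
  by (simp add: ctrl_def Let_def)

text \<open>The controller sees only a region and evaluates its test at a chosen representative.
  This is sound with \<open>m = 1\<close> because the test only asks whether clocks equal 1.\<close>

lemma region_some_one:
  assumes "c < k"
  shows "(SOME \<nu>'. \<nu>' \<in> region k 1 \<nu>) c = 1 \<longleftrightarrow> \<nu> c = 1"
proof -
  have "\<nu> \<in> region k 1 \<nu>" by (simp add: region_def region_equiv_def)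
  then have "(SOME \<nu>'. \<nu>' \<in> region k 1 \<nu>) \<in> region k 1 \<nu>"
    by (rule someI[where P = "\<lambda>\<nu>'. \<nu>' \<in> region k 1 \<nu>"])
  then have "sat \<nu> (CAtom c CEq 1) \<longleftrightarrow> sat (SOME \<nu>'. \<nu>' \<in> region k 1 \<nu>) (CAtom c CEq 1)"
    using assms unfolding region_def region_equiv_def mem_Collect_eq
    by (metis (no_types, lifting) abs_1 ccon_clocks.simps(2) ccon_consts.simps(2) empty_subsetI
        insert_subset lessThan_iff of_nat_1 order_refl singletonD)
  then show ?thesis by simp
qed

lemma mod_neq_window:
  assumes "i < n" "n < i + k"
  shows "i mod k \<noteq> n mod (k::nat)"
proof
  assume "i mod k = n mod k"
  then have "k dvd n - i" using assms by (metis less_imp_le mod_eq_dvd_iff_nat)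
  then show False using assms by (auto dest!: dvd_imp_le)
qed

text \<open>The reset at tick \<open>n\<close> overwrites only the time of tick
  \<open>n - k\<close>, which leaves the window at the same moment; hence each of the last
  \<open>k\<close> ticks is timed by its own clock.\<close>

lemma ctrl_state_ctrl:
  assumes k: "0 < k"
  shows "\<exists>\<mu>. ctrl_state (ctrl k) k 1 (to_nat (mem k a 0)) a t n = (to_nat (mem k a n), \<mu>) \<and>
    (\<forall>i<n. n \<le> i + k \<longrightarrow> \<mu> (i mod k) = prev_time t n - t i)"
proof (induction n)
  case (Suc n)
  then obtain \<mu> where \<mu>: "ctrl_state (ctrl k) k 1 (to_nat (mem k a 0)) a t n = (to_nat (mem k a n), \<mu>)"
    "\<forall>i<n. n \<le> i + k \<longrightarrow> \<mu> (i mod k) = prev_time t n - t i" by blast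
  let ?\<mu> = "reset {n mod k} (delay \<mu> (t n - prev_time t n))"
  have "ctrl_state (ctrl k) k 1 (to_nat (mem k a 0)) a t (Suc n) = (to_nat (mem k a (Suc n)), ?\<mu>)"
    using \<mu>(1) by (simp add: ctrl_to_nat remember_mem[OF k] Let_def) (simp add: mem_def)
  moreover have "?\<mu> (i mod k) = prev_time t (Suc n) - t i" if "i < Suc n" "Suc n \<le> i + k" for i
  proof (cases "i = n")
    case False
    then have "i mod k \<noteq> n mod k" using mod_neq_window[of i n k] that by simp
    then show ?thesis using False that \<mu>(2) by (simp add: reset_def delay_def prev_time_def)
  qed (simp add: reset_def prev_time_def)
  ultimately show ?case by blast
qed simp

lemma justified_iff_legit:
  assumes k: "0 < k" and suff: "length (snd (mem k a n)) < k \<or> 2 \<le> hdrs (snd (mem k a n))"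
    and \<nu>: "\<And>i. i < n \<Longrightarrow> n \<le> i + k \<Longrightarrow> \<nu> (i mod k) = 1 \<longleftrightarrow> t i = t n - 1"
  shows "justified (snd (mem k a n)) (a n) \<nu> \<longleftrightarrow> legit a t n"
proof -
  let ?h = "snd (mem k a n)"
  have h: "?h = map (\<lambda>i. (i mod k, a i)) [n - k..<n]" by (simp add: mem_def)
  have nil: "?h = [] \<longleftrightarrow> n = 0" using k by (auto simp: h)
  have idx: "(\<nu> (fst (?h ! q)) = 1 \<and> matches (snd (?h ! q)) (a n) \<and>
        hdrs (drop (Suc q) ?h) + (if a n = 0 then 1 else 0) = 1) \<longleftrightarrow>
      (t i = t n - 1 \<and> matches (a i) (a n) \<and> hc a (Suc i) (Suc n) = 1)"
    if "i = n - k + q" "i < n" for i q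
  proof -
    have "[n - k..<n] ! q = i" "q < length [n - k..<n]" using that nth_upt[of "n - k" q n] by auto
    then have "?h ! q = (i mod k, a i)" unfolding h by (simp only: nth_map)
    moreover have "hdrs (drop (Suc q) ?h) = hc a (Suc i) n"
      using that by (simp add: h drop_map hdrs_map)
    moreover have "\<nu> (i mod k) = 1 \<longleftrightarrow> t i = t n - 1" using that by (intro \<nu>) auto
    ultimately show ?thesis using that by (auto simp: hc_Suc)
  qed
  have "(\<exists>q<length ?h. \<nu> (fst (?h ! q)) = 1 \<and> matches (snd (?h ! q)) (a n) \<and>
        hdrs (drop (Suc q) ?h) + (if a n = 0 then 1 else 0) = 1) \<longleftrightarrow>
      (\<exists>i<n. t i = t n - 1 \<and> matches (a i) (a n) \<and> hc a (Suc i) (Suc n) = 1)" (is "?l \<longleftrightarrow> ?r")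
  proof
    assume ?l
    then obtain q where q: "q < length ?h" "\<nu> (fst (?h ! q)) = 1 \<and> matches (snd (?h ! q)) (a n) \<and>
        hdrs (drop (Suc q) ?h) + (if a n = 0 then 1 else 0) = 1" by blast
    have "n - k + q < n" using q(1) by (simp add: h)
    then show ?r using idx[OF refl, of q] q(2) by blast
  next
    assume ?r
    then obtain i where i: "i < n" "t i = t n - 1 \<and> matches (a i) (a n) \<and> hc a (Suc i) (Suc n) = 1" by blast
    \<comment> \<open>An original that precedes the window would be separated from \<open>n\<close>
      by two headers of the window, but exactly one is allowed.\<close>
    have "n - k \<le> i"
    proof (rule ccontr)
      assume "\<not> n - k \<le> i"
      then have "2 \<le> hc a (n - k) n" using suff by (simp add: h hdrs_map)
      also have "\<dots> \<le> hc a (Suc i) (Suc n)" using \<open>\<not> n - k \<le> i\<close> by (intro hc_mono) auto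
      finally show False using i(2) by simp
    qed
    then have "i = n - k + (i - (n - k))" "i - (n - k) < length ?h" using i(1) by (auto simp: h)
    then show ?l using idx[of i "i - (n - k)"] i by blast
  qed
  then show ?thesis unfolding justified_def legit_def nil by auto
qed

theorem halts_controllable:
  assumes "halts P x"
  shows "controllable (na, 2, automaton P x)"
proof -
  obtain K where K: "\<And>a t ls n. brun P x ls a n \<Longrightarrow> (\<And>i. i < n \<Longrightarrow> legit a t i) \<Longrightarrow>
    (\<And>i. t i < t (Suc i)) \<Longrightarrow> card (cur a n) \<le> K \<and> card (prv a n) \<le> K"
    using halts_bounded[OF assms] by metis
  \<comment> \<open>A window with fewer than two headers holds at most \<open>K\<close> current
    cells, \<open>K\<close> previous cells and one header. With one position more, a full memory
    contains two headers, and the controller is always entitled to claim.\<close>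
  define k where "k = 2 * K + 2"
  have k: "0 < k" by (simp add: k_def)
  define S where "S = {..<k} \<times> {h :: (nat \<times> nat) list. set h \<subseteq> {..<k} \<times> {..<na} \<and> length h \<le> k}"
  have mem0: "mem k a 0 = (0, [])" for a by (simp add: mem_def)
  have valid: "valid_controller {..<na} {..<2} k 1 (to_nat ` S) (to_nat (0::nat, [] :: (nat \<times> nat) list)) (ctrl k)"
    unfolding valid_controller_def
  proof (intro conjI ballI allI impI)
    show "finite (to_nat ` S)" unfolding S_def
      by (intro finite_imageI finite_cartesian_product finite_lists_length_le) auto
    show "to_nat (0::nat, [] :: (nat \<times> nat) list) \<in> to_nat ` S" using k by (auto simp: S_def)
    fix l l' and \<nu> :: valuation assume "l \<in> to_nat ` S" "l' \<in> {..<na}"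
    then obtain s where s: "s \<in> S" "l = to_nat s" by blast
    have "remember k s l' \<in> S"
      using s(1) k \<open>l' \<in> {..<na}\<close> unfolding S_def remember_def
      by (auto dest!: in_set_dropD)
    then show "case ctrl k l l' (region k 1 \<nu>) of (l', b, Y) \<Rightarrow> l' \<in> to_nat ` S \<and> b \<in> {..<2} \<and> Y \<subseteq> {..<k}"
      using s by (auto simp: ctrl_to_nat S_def)
  qed
  have "winning_controller {..<na} {..<2} (ta_lang (automaton P x)) k 1 (to_nat ` S)
      (to_nat (0::nat, [] :: (nat \<times> nat) list)) (ctrl k)"
    unfolding winning_controller_def
  proof (intro conjI allI impI notI valid)
    fix a :: "nat \<Rightarrow> nat" and t :: "nat \<Rightarrow> real"
    define b where "b = ctrl_answer (ctrl k) k 1 (to_nat (0::nat, [] :: (nat \<times> nat) list)) a t"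
    assume "(\<lambda>i. ((a i, ctrl_answer (ctrl k) k 1 (to_nat (0::nat, [] :: (nat \<times> nat) list)) a t i), t i))
        \<in> ta_lang (automaton P x)"
    then have W: "(\<lambda>i. ((a i, b i), t i)) \<in> ta_lang (automaton P x)" by (simp add: b_def)
    have b: "b n \<noteq> 0 \<longleftrightarrow> (length (snd (mem k a n)) < k \<or> 2 \<le> hdrs (snd (mem k a n))) \<and> \<not> legit a t n" for n
    proof -
      obtain \<mu> where \<mu>: "ctrl_state (ctrl k) k 1 (to_nat (0::nat, [] :: (nat \<times> nat) list)) a t n = (to_nat (mem k a n), \<mu>)"
        "\<forall>i<n. n \<le> i + k \<longrightarrow> \<mu> (i mod k) = prev_time t n - t i"
        using ctrl_state_ctrl[OF k] unfolding mem0 by blast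
      let ?\<nu> = "delay \<mu> (t n - prev_time t n)"
      let ?\<nu>' = "SOME \<nu>. \<nu> \<in> region k 1 ?\<nu>"
      have "b n \<noteq> 0 \<longleftrightarrow> claims k (snd (mem k a n)) (a n) ?\<nu>'"
        unfolding b_def ctrl_answer_def \<mu>(1) by (simp add: ctrl_to_nat)
      moreover have "?\<nu>' (i mod k) = 1 \<longleftrightarrow> t i = t n - 1" if "i < n" "n \<le> i + k" for i
      proof -
        have "?\<nu> (i mod k) = t n - t i" using \<mu>(2) that by (simp add: delay_def)
        then show ?thesis using region_some_one[of "i mod k" k ?\<nu>] k by auto
      qed
      ultimately show ?thesis unfolding claims_def using justified_iff_legit[OF k, of a n ?\<nu>' t] by blast
    qed
    from W show False
    proof (cases rule: automaton_lang_cases)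
      case (refuted j)
      then show False using b[of j] by blast
    next
      case (unclaimed ls)
      have leg: "legit a t n" for n
      proof (induction n rule: less_induct)
        case (less n)
        have card: "card (cur a n) \<le> K \<and> card (prv a n) \<le> K"
          by (rule K[of ls a n t]) (use unclaimed less in auto)
        have "length (snd (mem k a n)) < k \<or> 2 \<le> hdrs (snd (mem k a n))"
        proof (rule ccontr)
          assume "\<not> (length (snd (mem k a n)) < k \<or> 2 \<le> hdrs (snd (mem k a n)))"
          then have n: "k \<le> n" "hc a (n - k) n < 2" by (auto simp: mem_def hdrs_map)
          let ?H = "{i. n - k \<le> i \<and> i < n \<and> a i = 0}"
          have sub: "{n - k..<n} \<subseteq> cur a n \<union> prv a n \<union> ?H"
          proof
            fix i assume i: "i \<in> {n - k..<n}"
            have "hc a i n \<le> hc a (n - k) n" using i by (intro hc_mono) auto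
            then have "hc a i n = 0 \<or> hc a i n = 1" using n(2) by linarith
            then show "i \<in> cur a n \<union> prv a n \<union> ?H" using i by (auto simp: cur_def prv_def)
          qed
          have "k = card {n - k..<n}" using n(1) by simp
          also have "\<dots> \<le> card (cur a n \<union> prv a n \<union> ?H)" using sub by (intro card_mono) auto
          also have "\<dots> \<le> card (cur a n) + card (prv a n) + card ?H"
            by (meson add_le_mono1 card_Un_le order_trans)
          also have "card ?H < 2" using n(2) by (simp add: hc_def)
          finally show False using card by (simp add: k_def)
        qed
        then show ?case using b[of n] unclaimed(1) by metis
      qed
      \<comment> \<open>In \<open>LFin\<close> no header can be read, so the current configuration
        would outgrow \<open>K\<close> although every tick is legitimate.\<close>
      have fin_stay: "l' = LFin \<and> l \<noteq> 0" if "bstep P x LFin l l'" for l l'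
        using that unfolding bstep_def by (auto elim: bbase_cases)
      obtain m where m: "ls m = LFin" using unclaimed(4) by (auto simp: INFM_nat)
      have stay: "ls (m + d) = LFin" for d
      proof (induction d)
        case (Suc d)
        then show ?case using unclaimed(3) fin_stay unfolding brun_def by (metis add_Suc_right lessI)
      qed (simp add: m)
      have nz: "a (m + d) \<noteq> 0" for d
        using unclaimed(3) fin_stay stay[of d] unfolding brun_def by (metis lessI)
      have "{m..<m + d} \<subseteq> cur a (m + d)" for d
        using nz by (auto simp: cur_def hc_def) (metis add_diff_inverse_nat le_trans not_less)+
      then have "card {m..<m + Suc K} \<le> card (cur a (m + Suc K))" by (rule card_mono[OF finite_cur(1)])
      moreover have "card (cur a (m + Suc K)) \<le> K" using K[of ls a _ t] unclaimed(2,3) leg by blast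
      ultimately show False by simp
    qed
  qed
  then show ?thesis unfolding controllable_def by blast
qed

section \<open>Defeating controllers for diverging programs\<close>

fun path :: "ins list \<Rightarrow> nat \<Rightarrow> loc \<Rightarrow> nat list \<Rightarrow> loc \<Rightarrow> bool" where
  "path P x l [] l' \<longleftrightarrow> l = l'"
| "path P x l (a # u) l' \<longleftrightarrow> (\<exists>m. bstep P x l a m \<and> path P x m u l')"

lemma path_append: "path P x l (u @ v) l' \<longleftrightarrow> (\<exists>m. path P x l u m \<and> path P x m v l')"
  by (induction u arbitrary: l) auto

lemma path_loop: "(\<And>y. y \<in> set u \<Longrightarrow> bstep P x l y l) \<Longrightarrow> path P x l u l"
  by (induction u) auto

lemma path_load: "n \<le> m \<Longrightarrow> m \<le> x \<Longrightarrow> path P x (Lc m) (replicate n (cell 0 2)) (Lc (m - n))"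
proof (induction n arbitrary: m)
  case (Suc n)
  then obtain i where i: "m = Suc i" by (cases m) auto
  then have "bstep P x (Lc m) (cell 0 2) (Lc i)" using Suc.prems by (simp add: bstep_def)
  moreover have "path P x (Lc i) (replicate n (cell 0 2)) (Lc (i - n))" using Suc i by auto
  ultimately show ?case using i by auto
qed simp

definition copies :: "nat list \<Rightarrow> nat list \<Rightarrow> bool" where
  "copies cs u \<longleftrightarrow> (\<forall>y\<in>set u. 2 \<le> y) \<and> map in_of u = cs"

text \<open>The written configurations are listed latest first.\<close>
inductive reach :: "ins list \<Rightarrow> nat \<Rightarrow> loc \<Rightarrow> nat list \<Rightarrow> nat list list \<Rightarrow> bool" for P x where
  reach_init: "reach P x LF [] []"
| reach_step: "reach P x l cs us \<Longrightarrow> path P x l u m \<Longrightarrow> bstep P x m 0 l' \<Longrightarrow>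
    copies cs u \<or> (\<exists>v. u = 1 # v \<and> copies cs v) \<Longrightarrow> reach P x l' (map out_of u) (u # us)"

text \<open>The kind of the next configuration (restart, action or zero test) must be guessed when
  its header is read. All three guesses are kept open here until the machine state decides.\<close>

definition boundary :: "ins list \<Rightarrow> nat \<Rightarrow> ins list \<Rightarrow> nat list \<Rightarrow> bool" where
  "boundary P x Q cs \<longleftrightarrow> (\<forall>l\<in>{LX, LU Q, LZ Q}. \<exists>us. reach P x l cs us)"

lemma boundaryI:
  assumes "reach P x l cs us" "path P x l u m" "copies cs u \<or> (\<exists>v. u = 1 # v \<and> copies cs v)"
    "\<And>l'. l' \<in> {LX, LU Q, LZ Q} \<Longrightarrow> bstep P x m 0 l'" "cs' = map out_of u"
  shows "boundary P x Q cs'"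
  unfolding boundary_def using reach_step[OF assms(1,2) _ assms(3)] assms(4,5) by blast

lemma boundary_change:
  assumes "reach P x l (xs @ c # ys) us"
    "\<And>y. y \<in> set xs \<Longrightarrow> bstep P x l (cell y y) l" "bstep P x l (cell c d) m"
    "\<And>y. y \<in> set ys \<Longrightarrow> bstep P x m (cell y y) m"
    "\<And>l'. l' \<in> {LX, LU Q, LZ Q} \<Longrightarrow> bstep P x m 0 l'"
  shows "boundary P x Q (xs @ d # ys)"
proof (rule boundaryI[OF assms(1), where u = "map (\<lambda>y. cell y y) xs @ cell c d # map (\<lambda>y. cell y y) ys" and m = m])
  have "path P x l (map (\<lambda>y. cell y y) xs) l" using assms(2) by (intro path_loop) auto
  moreover have "path P x m (map (\<lambda>y. cell y y) ys) m" using assms(4) by (intro path_loop) auto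
  ultimately show "path P x l (map (\<lambda>y. cell y y) xs @ cell c d # map (\<lambda>y. cell y y) ys) m"
    using assms(3) by (auto simp: path_append)
qed (use assms(5) in \<open>auto simp: copies_def comp_def\<close>)

text \<open>An increment turns a free cell into a unit, a decrement turns a unit into a used-up
  cell, and a zero test turns a free cell into a used-up one. The weights 2, 1, 0 fall in each
  case.\<close>

definition weight :: "nat \<Rightarrow> nat" where
  "weight c = (if c = 0 then 2 else if c = 1 then 0 else 1)"

lemma bbase_bstep: "bbase P l a l' \<Longrightarrow> bstep P x l a l'"
  by (simp add: bstep_def)

text \<open>As long as a free cell remains, a program that has not halted can make its next step
  without omitting cells, and the total weight drops. So a diverging program must run out of free
  cells, and then the guess \<open>LX\<close> permits a restart.\<close>

lemma boundary_exhaust: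
  assumes "\<not> halts P x" "boundary P x Q cs" "(Q, \<sigma>) = (nstep ^^ k) (P, input_store x)"
    "\<And>r. count_list cs (r + 2) = \<sigma> r" "set cs \<subseteq> {..<content_bound P}" "Q \<in> set (resid P)"
  shows "\<exists>cs' us. reach P x LX cs' us \<and> 0 \<notin> set cs' \<and> length cs' = length cs \<and> set cs' \<subseteq> {..<content_bound P}"
  using assms(2-)
proof (induction "sum_list (map weight cs)" arbitrary: Q cs \<sigma> k rule: less_induct)
  case less
  let ?C = "content_bound P"
  show ?case
  proof (cases "0 \<in> set cs")
    case False
    then show ?thesis using less.prems(1,4) unfolding boundary_def by blast
  next
    case True
    have step: "nstep (Q, \<sigma>) = (nstep ^^ Suc k) (P, input_store x)" using less.prems(2) by simp
    have "Q \<noteq> []" using assms(1) less.prems(2) unfolding halts_def by (metis fst_conv)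
    then obtain i Q' where Q: "Q = i # Q'" by (cases Q) auto
    have 3: "3 \<le> ?C" by (rule content_bound_ge)
    show ?thesis
    proof (cases i)
      case (Inc r)
      obtain xs ys where cs: "cs = xs @ 0 # ys" using True by (meson split_list)
      have Q': "Q' \<in> set (resid P)" using resid_Inc less.prems(5) Q Inc by blast
      have r: "r + 2 < ?C" using resid_content_bound less.prems(5) Q Inc by blast
      obtain us where us: "reach P x (LU Q) (xs @ 0 # ys) us" using less.prems(1) cs unfolding boundary_def by blast
      have "boundary P x Q' (xs @ (r + 2) # ys)"
      proof (rule boundary_change[OF us, where m = "LV Q'"])
        show "bstep P x (LU Q) (cell 0 (r + 2)) (LV Q')"
          using less.prems(5) unfolding Q Inc by (intro bbase_bstep b_inc)
        show "bstep P x (LU Q) (cell y y) (LU Q)" if "y \<in> set xs" for y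
          using that less.prems(4,5) cs by (intro bbase_bstep b_keep[of Q]) auto
        show "bstep P x (LV Q') (cell y y) (LV Q')" if "y \<in> set ys" for y
          using that less.prems(4) cs Q' by (intro bbase_bstep b_keep[of Q']) auto
        show "bstep P x (LV Q') 0 l'" if "l' \<in> {LX, LU Q', LZ Q'}" for l'
          using Q' that by (intro bbase_bstep b_next) auto
      qed
      moreover have "sum_list (map weight (xs @ (r + 2) # ys)) < sum_list (map weight cs)"
        by (simp add: cs weight_def)
      moreover have "(Q', \<sigma>(r := Suc (\<sigma> r))) = (nstep ^^ Suc k) (P, input_store x)" using step Q Inc by simp
      moreover have "count_list (xs @ (r + 2) # ys) (q + 2) = (\<sigma>(r := Suc (\<sigma> r))) q" for q
        using less.prems(3)[of q] cs by auto
      moreover have "set (xs @ (r + 2) # ys) \<subseteq> {..<?C}" using less.prems(4) cs r by auto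
      ultimately have "\<exists>cs' us. reach P x LX cs' us \<and> 0 \<notin> set cs' \<and>
          length cs' = length (xs @ (r + 2) # ys) \<and> set cs' \<subseteq> {..<?C}"
        using Q' less.hyps by blast
      then show ?thesis by (simp add: cs)
    next
      case (Loop r A)
      note mem = resid_Loop[of r A Q' P] less.prems(5)[unfolded Q Loop]
      have r: "r + 2 < ?C" using resid_content_bound less.prems(5) Q Loop by blast
      show ?thesis
      proof (cases "\<sigma> r = 0")
        case z: True
        obtain xs ys where cs: "cs = xs @ 0 # ys" using True by (meson split_list)
        have nr: "r + 2 \<notin> set cs" using less.prems(3)[of r] z by (simp add: count_list_0_iff)
        obtain us where us: "reach P x (LZ Q) (xs @ 0 # ys) us" using less.prems(1) cs unfolding boundary_def by blast
        have "boundary P x Q' (xs @ 1 # ys)"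
        proof (rule boundary_change[OF us, where m = "LZV r Q'"])
          show "bstep P x (LZ Q) (cell y y) (LZ Q)" if "y \<in> set xs" for y
            using that less.prems(4) nr cs mem unfolding Q Loop
            by (intro bbase_bstep b_zkeep[where r = r and A = A and Q = Q']) auto
          show "bstep P x (LZV r Q') (cell y y) (LZV r Q')" if "y \<in> set ys" for y
            using that less.prems(4) nr cs mem unfolding Q Loop
            by (intro bbase_bstep b_zkeep[where r = r and A = A and Q = Q']) auto
          show "bstep P x (LZ Q) (cell 0 1) (LZV r Q')"
            unfolding Q Loop by (intro bbase_bstep b_zero) (use mem in auto)
          show "bstep P x (LZV r Q') 0 l'" if "l' \<in> {LX, LU Q', LZ Q'}" for l'
            by (intro bbase_bstep b_znext[OF _ that, of r A]) (use mem in auto)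
        qed
        moreover have "sum_list (map weight (xs @ 1 # ys)) < sum_list (map weight cs)"
          by (simp add: cs weight_def)
        moreover have "(Q', \<sigma>) = (nstep ^^ Suc k) (P, input_store x)" using step Q Loop z by simp
        moreover have "count_list (xs @ 1 # ys) (q + 2) = \<sigma> q" for q
          using less.prems(3)[of q] cs by auto
        moreover have "set (xs @ 1 # ys) \<subseteq> {..<?C}" using less.prems(4) cs 3 by auto
        ultimately have "\<exists>cs' us. reach P x LX cs' us \<and> 0 \<notin> set cs' \<and>
            length cs' = length (xs @ 1 # ys) \<and> set cs' \<subseteq> {..<?C}"
          using mem less.hyps by blast
        then show ?thesis by (simp add: cs)
      next
        case nz: False
        then have "r + 2 \<in> set cs" using less.prems(3)[of r] by (metis count_notin)
        then obtain xs ys where cs: "cs = xs @ (r + 2) # ys" by (meson split_list)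
        obtain us where us: "reach P x (LU Q) (xs @ (r + 2) # ys) us" using less.prems(1) cs unfolding boundary_def by blast
        let ?Q = "A @ Loop r A # Q'"
        have "boundary P x ?Q (xs @ 1 # ys)"
        proof (rule boundary_change[OF us, where m = "LV ?Q"])
          show "bstep P x (LU Q) (cell (r + 2) 1) (LV ?Q)"
            unfolding Q Loop by (intro bbase_bstep b_dec) (use mem in auto)
          show "bstep P x (LU Q) (cell y y) (LU Q)" if "y \<in> set xs" for y
            using that less.prems(4,5) cs by (intro bbase_bstep b_keep[of Q]) auto
          show "bstep P x (LV ?Q) (cell y y) (LV ?Q)" if "y \<in> set ys" for y
            using that less.prems(4) cs mem by (intro bbase_bstep b_keep[of ?Q]) auto
          show "bstep P x (LV ?Q) 0 l'" if "l' \<in> {LX, LU ?Q, LZ ?Q}" for l'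
            using mem that by (intro bbase_bstep b_next) auto
        qed
        moreover have "sum_list (map weight (xs @ 1 # ys)) < sum_list (map weight cs)"
          by (simp add: cs weight_def)
        moreover have "(?Q, \<sigma>(r := \<sigma> r - 1)) = (nstep ^^ Suc k) (P, input_store x)" using step Q Loop nz by simp
        moreover have "count_list (xs @ 1 # ys) (q + 2) = (\<sigma>(r := \<sigma> r - 1)) q" for q
          using less.prems(3)[of q] cs by auto
        moreover have "set (xs @ 1 # ys) \<subseteq> {..<?C}" using less.prems(4) cs 3 by auto
        ultimately have "\<exists>cs' us. reach P x LX cs' us \<and> 0 \<notin> set cs' \<and>
            length cs' = length (xs @ 1 # ys) \<and> set cs' \<subseteq> {..<?C}"
          using mem less.hyps by blast
        then show ?thesis by (simp add: cs)
      qed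
    qed
  qed
qed

lemma count_list_replicate: "count_list (replicate n c) d = (if c = d then n else 0)"
  by (induction n) auto

lemma reach_round:
  assumes nh: "\<not> halts P x" and F: "reach P x LF (replicate n 0) us"
  shows "\<exists>cs us. reach P x LX cs us \<and> 0 \<notin> set cs \<and> length cs = Suc n \<and> set cs \<subseteq> {..<content_bound P}"
proof -
  have 3: "3 \<le> content_bound P" by (rule content_bound_ge)
  have init: "bstep P x LF 1 (Lc x)" by (simp add: bstep_def)
  show ?thesis
  proof (cases "n < x")
    case True
    \<comment> \<open>The input does not fit: the header during loading leads directly to
      \<open>LX\<close>, so even this round gains its cell.\<close>
    let ?u = "1 # replicate n (cell 0 2)"
    have "path P x LF ?u (Lc (x - n))" using init path_load[of n x x P] True by auto
    moreover have "bstep P x (Lc (x - n)) 0 LX" using True unfolding bstep_def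
      by (intro disjI2 exI[of _ "x - Suc n"]) auto
    moreover have "copies (replicate n 0) (replicate n (cell 0 2))" by (simp add: copies_def)
    ultimately have "reach P x LX (map out_of ?u) (?u # us)" using reach_step[OF F] by blast
    then show ?thesis using 3 by (intro exI[of _ "map out_of ?u"]) auto
  next
    case False
    let ?v = "replicate x (cell 0 2) @ replicate (n - x) (cell 0 0)"
    let ?cs = "(1::nat) # replicate x 2 @ replicate (n - x) 0"
    have l0: "path P x (Lc 0) (replicate (n - x) (cell 0 0)) (Lc 0)"
      by (rule path_loop) (auto intro!: bbase_bstep b_rest)
    have "path P x (Lc x) (replicate x (cell 0 2)) (Lc 0)" using path_load[of x x x P] by simp
    then have "path P x LF (1 # ?v) (Lc 0)" using init l0 by (auto simp: path_append simp del: One_nat_def)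
    moreover have "replicate x 0 @ replicate (n - x) 0 = replicate n (0::nat)"
      using False by (simp flip: replicate_add)
    then have "copies (replicate n 0) ?v" by (auto simp: copies_def)
    ultimately have "boundary P x P ?cs"
      by (intro boundaryI[OF F, where u = "1 # ?v" and m = "Lc 0"]) (auto intro!: bbase_bstep b_loaded)
    moreover have "count_list ?cs (r + 2) = input_store x r" for r
      by (simp add: count_list_replicate input_store_def)
    moreover have "(P, input_store x) = (nstep ^^ 0) (P, input_store x)" by simp
    moreover have "set ?cs \<subseteq> {..<content_bound P}" using 3 by auto
    ultimately have "\<exists>cs us. reach P x LX cs us \<and> 0 \<notin> set cs \<and> length cs = length ?cs \<and> set cs \<subseteq> {..<content_bound P}"
      using boundary_exhaust[OF nh _ _ _ _ resid_self] by blast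
    then show ?thesis using False by simp
  qed
qed

lemma reach_restart:
  assumes X: "reach P x LX cs us" "0 \<notin> set cs" "set cs \<subseteq> {..<content_bound P}" and l: "l \<in> {LF, LFin}"
  shows "\<exists>us. reach P x l (replicate (length cs) 0) us"
proof -
  let ?u = "map (\<lambda>c. cell c 0) cs"
  have "bstep P x LX (cell c 0) LX" if "c \<in> set cs" for c
    using that X(2,3) by (intro bbase_bstep b_restart) (auto intro: gr0I)
  then have "path P x LX ?u LX" by (intro path_loop) auto
  moreover have "bstep P x LX 0 l" using l by (intro bbase_bstep b_restarted)
  moreover have "copies cs ?u" by (auto simp: copies_def comp_def)
  ultimately have "reach P x l (map out_of ?u) (?u # us)" using reach_step[OF X(1)] by blast
  moreover have "map out_of ?u = replicate (length cs) 0" by (simp add: comp_def map_replicate_const)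
  ultimately show ?thesis by auto
qed

lemma reach_unbounded:
  assumes "\<not> halts P x"
  shows "\<exists>us. reach P x LF (replicate n 0) us"
proof (induction n)
  case 0
  show ?case using reach_init by auto
next
  case (Suc n)
  then show ?case using reach_round[OF assms] reach_restart[of P x _ _ LF] by (metis insertI1)
qed

lemma reach_LFin:
  assumes "\<not> halts P x"
  shows "\<exists>us. reach P x LFin (replicate (Suc n) 0) us"
  using reach_unbounded[OF assms, of n] reach_round[OF assms] reach_restart[of P x _ _ LFin]
  by (metis insertI1 insertI2)

text \<open>The cell followed by \<open>n\<close> others has offset \<open>1 / (n + 2)\<close>, so that creating a cell at the
  front of a configuration leaves the offsets of the other cells unchanged.\<close>
fun tcells :: "real \<Rightarrow> nat list \<Rightarrow> (nat \<times> real) list" where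
  "tcells b [] = []"
| "tcells b (y # u) = (y, b + 1 / (real (length u) + 2)) # tcells b u"

lemma map_fst_tcells [simp]: "map fst (tcells b u) = u"
  by (induction u) auto

lemma length_tcells [simp]: "length (tcells b u) = length u"
  by (induction u) auto

lemma tcells_bounds: "z \<in> set (tcells b u) \<Longrightarrow> b < snd z \<and> snd z < b + 1"
  by (induction u) auto

lemma tcells_append:
  "tcells b (u @ v) = take (length u) (tcells b (u @ v)) @ tcells b v"
  by (induction u) auto

fun word :: "nat list list \<Rightarrow> (nat \<times> real) list" where
  "word [] = []"
| "word (u # us) = word us @ (0, real (length us) + 1) # tcells (real (length us) + 1) u"

definition hl :: "(nat \<times> real) list \<Rightarrow> nat" where
  "hl w = length (filter (\<lambda>z. fst z = 0) w)"

lemma hl_simps [simp]: "hl [] = 0" "hl (z # w) = (if fst z = 0 then 1 else 0) + hl w" "hl (w @ w') = hl w + hl w'"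
  by (auto simp: hl_def)

lemma hl_tcells: "0 \<notin> set u \<Longrightarrow> hl (tcells b u) = 0"
  by (induction u) auto

section \<open>Honest timed words\<close>

definition legitl :: "(nat \<times> real) list \<Rightarrow> nat \<times> real \<Rightarrow> bool" where
  "legitl w y \<longleftrightarrow> w = [] \<and> fst y = 0 \<or> fst y = 1 \<or>
     (\<exists>pre z post. w = pre @ z # post \<and> snd z = snd y - 1 \<and> matches (fst z) (fst y) \<and>
        hl post + (if fst y = 0 then 1 else 0) = 1)"

definition later :: "(nat \<times> real) list \<Rightarrow> real \<Rightarrow> bool" where
  "later w s \<longleftrightarrow> (if w = [] then 0 else snd (last w)) < s"

inductive hon :: "ins list \<Rightarrow> nat \<Rightarrow> (nat \<times> real) list \<Rightarrow> loc \<Rightarrow> bool" for P x where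
  hon_Nil: "hon P x [] LB"
| hon_snoc: "hon P x w l \<Longrightarrow> bstep P x l (fst y) l' \<Longrightarrow> legitl w y \<Longrightarrow> later w (snd y) \<Longrightarrow> hon P x (w @ [y]) l'"

text \<open>The cells \<open>v1\<close> are dealt with and \<open>v2\<close> still has to be copied
  by \<open>u\<close>. Since \<open>copies\<close> forces equal lengths, original and copy have
  equally many successors, hence equal offsets, and are exactly one time unit apart. The bound in
  \<open>later\<close> is the offset of the first cell of \<open>u\<close>.\<close>

lemma hon_suffix:
  assumes "hon P x (w1 @ tcells (b - 1) (v1 @ v2) @ (0, b) # ws) l" "path P x l u m" "copies (map out_of v2) u"
    "0 \<notin> set v2" "hl ws = 0" "later ((0, b) # ws) (b + 1 / (real (length u) + 1))"
  shows "hon P x (w1 @ tcells (b - 1) (v1 @ v2) @ (0, b) # ws @ tcells b u) m"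
  using assms
proof (induction u arbitrary: v1 v2 ws l)
  case (Cons y u)
  obtain z v where v2: "v2 = z # v" "out_of z = in_of y" "copies (map out_of v) u" "2 \<le> y" "length v = length u"
    using Cons.prems(3) by (cases v2) (auto simp: copies_def dest: arg_cong[of _ _ length])
  obtain l' where l': "bstep P x l y l'" "path P x l' u m" using Cons.prems(2) by auto
  let ?s = "b + 1 / (real (length u) + 2)"
  let ?w = "w1 @ tcells (b - 1) (v1 @ v2) @ (0, b) # ws"
  have t: "tcells (b - 1) (v1 @ v2) = take (length v1) (tcells (b - 1) (v1 @ v2)) @
      (z, b - 1 + 1 / (real (length u) + 2)) # tcells (b - 1) v"
    by (subst tcells_append) (simp add: v2)
  have "legitl ?w (y, ?s)"
    unfolding legitl_def
  proof (intro disjI2 exI conjI)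
    show "?w = (w1 @ take (length v1) (tcells (b - 1) (v1 @ v2))) @ (z, b - 1 + 1 / (real (length u) + 2)) #
        (tcells (b - 1) v @ (0, b) # ws)" by (subst t) simp
    show "matches (fst (z, b - 1 + 1 / (real (length u) + 2))) (fst (y, ?s))"
      using v2 Cons.prems(4) by (simp add: matches_def)
    show "hl (tcells (b - 1) v @ (0, b) # ws) + (if fst (y, ?s) = 0 then 1 else 0) = 1"
      using Cons.prems(4,5) v2 by (simp add: hl_tcells)
  qed simp
  moreover have "later ?w ?s" using Cons.prems(6) by (simp add: later_def add.commute)
  ultimately have "hon P x (?w @ [(y, ?s)]) l'" using hon_snoc[OF Cons.prems(1), of "(y, ?s)"] l'(1) by simp
  then have 1: "hon P x (w1 @ tcells (b - 1) ((v1 @ [z]) @ v) @ (0, b) # (ws @ [(y, ?s)])) l'"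
    by (simp add: v2)
  have "1 / (real (length u) + 2) < 1 / (real (length u) + 1)" by (simp add: field_simps)
  then have "later ((0, b) # (ws @ [(y, ?s)])) (b + 1 / (real (length u) + 1))"
    by (simp add: later_def)
  moreover have "hl (ws @ [(y, ?s)]) = 0" using Cons.prems(5) v2(4) by simp
  ultimately show ?case using Cons.IH[OF 1 l'(2) v2(3)] Cons.prems(4) v2 by simp
qed simp

lemma hon_config:
  assumes h: "hon P x (w1 @ tcells (b - 1) v @ [(0, b)]) l" and p: "path P x l u m"
    and c: "copies (map out_of v) u \<or> (\<exists>u'. u = 1 # u' \<and> copies (map out_of v) u')" and v: "0 \<notin> set v"
  shows "hon P x (w1 @ tcells (b - 1) v @ (0, b) # tcells b u) m"
  using c
proof
  assume "copies (map out_of v) u"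
  then show ?thesis using hon_suffix[of P x w1 b "[]" v "[]" l u m] h p v by (simp add: later_def)
next
  assume "\<exists>u'. u = 1 # u' \<and> copies (map out_of v) u'"
  then obtain u' where u: "u = 1 # u'" "copies (map out_of v) u'" by blast
  obtain l' where l': "bstep P x l 1 l'" "path P x l' u' m" using p u by auto
  let ?s = "b + 1 / (real (length u') + 2)"
  have "hon P x ((w1 @ tcells (b - 1) v @ [(0, b)]) @ [(1, ?s)]) l'"
    using l' by (intro hon_snoc[OF h]) (auto simp: legitl_def later_def)
  moreover have "1 / (real (length u') + 2) < 1 / (real (length u') + 1)" by (simp add: field_simps)
  then have "later ((0, b) # [(1, ?s)]) (b + 1 / (real (length u') + 1))" by (simp add: later_def)
  ultimately show ?thesis using hon_suffix[of P x w1 b "[]" v "[(1, ?s)]" l' u' m] l'(2) u v by simp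
qed

lemma copies_nonzero:
  "copies cs u \<or> (\<exists>v. u = 1 # v \<and> copies cs v) \<Longrightarrow> 0 \<notin> set u"
  by (fastforce simp: copies_def)

definition prefix_word :: "nat list list \<Rightarrow> (nat \<times> real) list" where
  "prefix_word us = word us @ [(0, real (length us) + 1)]"

lemma prefix_word_config:
  assumes h: "hon P x (prefix_word us) l" and p: "path P x l u m"
    and c: "copies cs u \<or> (\<exists>v. u = 1 # v \<and> copies cs v)"
    and us: "case us of [] \<Rightarrow> cs = [] | v # _ \<Rightarrow> cs = map out_of v \<and> 0 \<notin> set v"
  shows "hon P x (prefix_word us @ tcells (real (length us) + 1) u) m"
proof (cases us)
  case Nil
  then show ?thesis using hon_config[of P x "[]" 1 "[]" l u m] h p c us by (simp add: prefix_word_def)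
next
  case (Cons v vs)
  then show ?thesis
    using hon_config[of P x "word vs @ [(0, real (length us))]" "real (length us) + 1" v l u m] h p c us
    by (simp add: prefix_word_def add.commute)
qed

lemma reach_hon:
  "reach P x l cs us \<Longrightarrow> hon P x (prefix_word us) l \<and>
     (case us of [] \<Rightarrow> cs = [] | v # _ \<Rightarrow> cs = map out_of v \<and> 0 \<notin> set v)"
proof (induction rule: reach.induct)
  case reach_init
  have "hon P x ([] @ [(0, 1)]) LF"
    by (rule hon_snoc[OF hon_Nil]) (auto simp: legitl_def later_def intro: bbase_bstep b_init)
  then show ?case by (simp add: prefix_word_def)
next
  case (reach_step l cs us u m l')
  let ?b = "real (length us) + 1"
  have h: "hon P x (prefix_word us @ tcells ?b u) m"
    using prefix_word_config reach_step by blast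
  have nz: "0 \<notin> set u" using copies_nonzero reach_step.hyps by blast
  let ?w = "prefix_word us @ tcells ?b u"
  have "legitl ?w (0, ?b + 1)"
    unfolding legitl_def
    by (intro disjI2 exI[of _ "word us"] exI[of _ "(0, ?b)"] exI[of _ "tcells ?b u"])
      (simp add: prefix_word_def matches_def hl_tcells nz)
  moreover have "later ?w (?b + 1)"
  proof (cases "u = []")
    case False
    then have "tcells ?b u \<noteq> []" by (metis length_0_conv length_tcells)
    then show ?thesis using tcells_bounds[of "last (tcells ?b u)" ?b u]
      by (auto simp: later_def prefix_word_def simp del: One_nat_def)
  qed (simp add: later_def prefix_word_def)
  ultimately have "hon P x (?w @ [(0, ?b + 1)]) l'"
    using hon_snoc[OF h, of "(0, ?b + 1)" l'] reach_step.hyps by simp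
  then show ?case using nz by (simp add: prefix_word_def add.commute add.left_commute)
qed


lemma bstep_letters: "bstep P x l a l' \<Longrightarrow> a \<in> letters (content_bound P)"
  using content_bound_ge[of P] unfolding bstep_def letters_def
  by (auto elim!: bbase_cases dest: resid_content_bound)

lemma hl_map: "hl (map (\<lambda>i. (a i, t i)) [i..<j]) = hc a i j"
proof (induction j)
  case (Suc j)
  then show ?case by (cases "i \<le> j") (auto simp: hc_Suc)
qed simp

lemma legitl_legit:
  assumes "legitl w (a (length w), t (length w))" "w = map (\<lambda>i. (a i, t i)) [0..<length w]"
  shows "legit a t (length w)"
proof -
  let ?n = "length w"
  consider "w = []" "a ?n = 0" | "a ?n = 1" | pre z post where "w = pre @ z # post" "snd z = t ?n - 1"
      "matches (fst z) (a ?n)" "hl post + (if a ?n = 0 then 1 else 0) = 1"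
    using assms(1) unfolding legitl_def fst_conv snd_conv by metis
  then show ?thesis
  proof cases
    case (3 pre z post)
    let ?i = "length pre"
    have i: "?i < ?n" using 3(1) by simp
    have "w ! ?i = z" using 3(1) by simp
    moreover have "w ! ?i = (a ?i, t ?i)" using i by (subst assms(2)) simp
    ultimately have z: "z = (a ?i, t ?i)" by simp
    have "post = drop (Suc ?i) w" using 3(1) by simp
    also have "\<dots> = map (\<lambda>i. (a i, t i)) [Suc ?i..<?n]" by (subst assms(2)) (simp add: drop_map)
    finally have "hl post = hc a (Suc ?i) ?n" by (simp only: hl_map)
    then have "hc a (Suc ?i) (Suc ?n) = 1" using 3(4) i by (simp add: hc_Suc)
    then show ?thesis unfolding legit_def using i 3(2,3) z by auto
  qed (auto simp: legit_def)
qed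

lemma hon_props:
  assumes "hon P x w l" "w = map (\<lambda>i. (a i, t i)) [0..<length w]"
  shows "(\<forall>j<length w. legit a t j \<and> a j \<in> letters (content_bound P) \<and> prev_time t j < t j) \<and>
    (\<exists>ls. ls 0 = LB \<and> (\<forall>i<length w. bstep P x (ls i) (a i) (ls (Suc i))) \<and> ls (length w) = l)"
  using assms
proof (induction rule: hon.induct)
  case hon_Nil
  show ?case by (auto intro: exI[of _ "\<lambda>_. LB"])
next
  case (hon_snoc w l y l')
  let ?n = "length w"
  have w: "w = map (\<lambda>i. (a i, t i)) [0..<?n]" and y: "y = (a ?n, t ?n)" using hon_snoc.prems by auto
  have "legit a t ?n" using legitl_legit[OF _ w] hon_snoc.hyps(3) y by simp
  moreover have "a ?n \<in> letters (content_bound P)" using bstep_letters[OF hon_snoc.hyps(2)] y by simp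
  moreover have "prev_time t ?n < t ?n"
  proof (cases "?n = 0")
    case True
    then show ?thesis using hon_snoc.hyps(4) y by (simp add: later_def prev_time_def)
  next
    case False
    then have "last w = (a (?n - 1), t (?n - 1))" by (subst w) (simp add: last_map)
    then show ?thesis using hon_snoc.hyps(4) y False by (simp add: later_def prev_time_def)
  qed
  moreover obtain ls where ls: "ls 0 = LB" "\<forall>i<?n. bstep P x (ls i) (a i) (ls (Suc i))" "ls ?n = l"
    using hon_snoc.IH[OF w] by blast
  moreover have "\<exists>ls. ls 0 = LB \<and> (\<forall>i<Suc ?n. bstep P x (ls i) (a i) (ls (Suc i))) \<and> ls (Suc ?n) = l'"
    using ls hon_snoc.hyps(2) y by (intro exI[of _ "ls(Suc ?n := l')"]) (auto simp: less_Suc_eq)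
  ultimately show ?case using hon_snoc.IH[OF w] by (auto simp: less_Suc_eq)
qed

section \<open>Arbitrary controllers against honest plays\<close>

lemma ctrl_state_cong:
  assumes "\<And>i. i < n \<Longrightarrow> a i = a' i \<and> t i = t' i"
  shows "ctrl_state \<delta> k m l0 a t n = ctrl_state \<delta> k m l0 a' t' n"
  using assms
proof (induction n)
  case (Suc n)
  have "prev_time t n = prev_time t' n" using Suc.prems by (simp add: prev_time_def)
  then show ?case using Suc by simp
qed simp

lemma ctrl_answer_cong:
  assumes "\<And>i. i \<le> n \<Longrightarrow> a i = a' i \<and> t i = t' i"
  shows "ctrl_answer \<delta> k m l0 a t n = ctrl_answer \<delta> k m l0 a' t' n"
proof -
  have "prev_time t n = prev_time t' n" using assms by (simp add: prev_time_def)
  moreover have "ctrl_state \<delta> k m l0 a t n = ctrl_state \<delta> k m l0 a' t' n"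
    using assms by (intro ctrl_state_cong) simp
  ultimately show ?thesis using assms by (simp add: ctrl_answer_def)
qed

lemma valid_controller_state:
  assumes v: "valid_controller A B k m L l0 \<delta>" and a: "\<And>i. a i \<in> A" and t: "0 \<le> t 0" "\<And>i. t i \<le> t (Suc i)"
  shows "fst (ctrl_state \<delta> k m l0 a t n) \<in> L \<and> (\<forall>c<k. 0 \<le> snd (ctrl_state \<delta> k m l0 a t n) c)"
    "ctrl_answer \<delta> k m l0 a t n \<in> B"
proof -
  have d: "prev_time t n \<le> t n" for n using t by (cases n) (auto simp: prev_time_def)
  have step: "case \<delta> l (a n) (region k m (delay \<mu> (t n - prev_time t n))) of (l', b, Y) \<Rightarrow> l' \<in> L \<and> b \<in> B \<and> Y \<subseteq> {..<k}"
    if "l \<in> L" "\<forall>c<k. 0 \<le> \<mu> c" for l n and \<mu> :: valuation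
    using v a that d[of n] unfolding valid_controller_def by (auto simp: delay_def)
  have st: "fst (ctrl_state \<delta> k m l0 a t n) \<in> L \<and> (\<forall>c<k. 0 \<le> snd (ctrl_state \<delta> k m l0 a t n) c)" for n
  proof (induction n)
    case 0
    then show ?case using v by (simp add: valid_controller_def)
  next
    case (Suc n)
    obtain l \<mu> where s: "ctrl_state \<delta> k m l0 a t n = (l, \<mu>)" by fastforce
    then have "l \<in> L" "\<forall>c<k. 0 \<le> \<mu> c" using Suc by auto
    from step[OF this, of n] d[of n] this show ?case
      by (auto simp: s Let_def reset_def delay_def split: prod.splits)
  qed
  then show "fst (ctrl_state \<delta> k m l0 a t n) \<in> L \<and> (\<forall>c<k. 0 \<le> snd (ctrl_state \<delta> k m l0 a t n) c)" .
  obtain l \<mu> where s: "ctrl_state \<delta> k m l0 a t n = (l, \<mu>)" by fastforce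
  then show "ctrl_answer \<delta> k m l0 a t n \<in> B" using st[of n] step[of l \<mu> n]
    by (auto simp: ctrl_answer_def split: prod.splits)
qed

text \<open>A delay leaves clock differences alone, and a clock that stays strictly between two
  consecutive integers changes no comparison with an integer. This works for every
  \<open>m\<close>.\<close>

lemma region_eqI:
  assumes "0 \<le> d" "\<And>c. c < k \<Longrightarrow> \<exists>N::int. of_int N < \<nu> c \<and> \<nu> c + d < of_int N + 1"
  shows "region k m (delay \<nu> d) = region k m \<nu>"
proof -
  have atom: "cmp_sem r (\<nu> c + d) (of_int z) \<longleftrightarrow> cmp_sem r (\<nu> c) (of_int z)" if c: "c < k" for c r z
  proof -
    obtain N :: int where N: "of_int N < \<nu> c" "\<nu> c + d < of_int N + 1" using assms(2)[OF c] by blast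
    show ?thesis
    proof (cases "z \<le> N")
      case True
      then have "real_of_int z \<le> of_int N" by simp
      then show ?thesis using N assms(1) by (cases r) auto
    next
      case False
      then have "N + 1 \<le> z" by simp
      then have "real_of_int N + 1 \<le> of_int z" by linarith
      then show ?thesis using N assms(1) by (cases r) auto
    qed
  qed
  have "sat (delay \<nu> d) \<phi> \<longleftrightarrow> sat \<nu> \<phi>" if "ccon_clocks \<phi> \<subseteq> {..<k}" for \<phi>
    using that by (induction \<phi>) (auto simp: delay_def atom)
  then show ?thesis unfolding region_def region_equiv_def by auto
qed

context
  fixes P :: "ins list" and x na k m :: nat and L :: "nat set" and l0 :: nat and \<delta> :: ctrl_fun
  assumes win: "winning_controller {..<na} {..<2} (ta_lang (automaton P x)) k m L l0 \<delta>"
    and na: "letters (content_bound P) \<subseteq> {..<na}"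
begin

text \<open>Otherwise Player I would stop time right after the claim and play letter 0 forever, and
  the automaton would refute the claim. Only the play up to \<open>j\<close> matters for the
  answer.\<close>

lemma no_claim_at_legit:
  assumes leg: "legit a t j" and t: "0 \<le> t 0" "\<And>i. i < j \<Longrightarrow> t i \<le> t (Suc i)"
    and a: "\<And>i. i \<le> j \<Longrightarrow> a i \<in> letters (content_bound P)"
    and prev: "\<And>i. i < j \<Longrightarrow> ctrl_answer \<delta> k m l0 a t i = 0"
  shows "ctrl_answer \<delta> k m l0 a t j = 0"
proof (rule ccontr)
  assume nz: "ctrl_answer \<delta> k m l0 a t j \<noteq> 0"
  define a' where "a' i = (if i \<le> j then a i else 0)" for i
  define t' where "t' i = (if i \<le> j then t i else t j)" for i
  define b where "b = ctrl_answer \<delta> k m l0 a' t'"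
  have z: "0 \<in> letters (content_bound P)" by (simp add: letters_def)
  have A: "a' i \<in> {..<na}" for i using a z na by (auto simp: a'_def)
  have t': "0 \<le> t' 0" "t' i \<le> t' (Suc i)" for i
    using t by (auto simp: t'_def not_less_eq_eq)
  have b: "b i = ctrl_answer \<delta> k m l0 a t i" if "i \<le> j" for i
    unfolding b_def using that by (intro ctrl_answer_cong) (auto simp: a'_def t'_def)
  have v: "valid_controller {..<na} {..<2} k m L l0 \<delta>" using win by (simp add: winning_controller_def)
  have b2: "b i < 2" for i using valid_controller_state(2)[OF v, where a = a' and t = t' and n = i] A t' by (simp add: b_def)
  have hc: "hc a' i (Suc j) = hc a i (Suc j)" for i
    unfolding hc_def by (rule arg_cong[where f = card]) (auto simp: a'_def)
  have "legit a' t' j"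
    using leg unfolding legit_def hc by (fastforce simp: a'_def t'_def)
  then have "(\<lambda>i. ((a' i, b i), t' i)) \<in> ta_lang (automaton P x)"
  proof (rule automaton_lang_refuted[rotated 2])
    show "b j = 1" using b[of j] nz b2[of j] by linarith
  qed (use b prev a t' b2 in \<open>auto simp: a'_def\<close>)
  then show False using win A t' unfolding winning_controller_def b_def by blast
qed

lemma hon_no_claim:
  assumes "hon P x w l" "w = map (\<lambda>i. (a i, t i)) [0..<length w]" "j < length w"
  shows "ctrl_answer \<delta> k m l0 a t j = 0"
  using assms(3)
proof (induction j rule: less_induct)
  case (less j)
  have h: "legit a t i \<and> a i \<in> letters (content_bound P) \<and> prev_time t i < t i" if "i < length w" for i
    using hon_props[OF assms(1,2)] that by blast
  show ?case
  proof (rule no_claim_at_legit)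
    have "0 < length w" using less.prems by linarith
    from h[OF this] show "0 \<le> t 0" by (simp add: prev_time_def)
    show "t i \<le> t (Suc i)" if "i < j" for i
      using h[of "Suc i"] that less.prems by (simp add: prev_time_def)
  qed (use h less in auto)
qed

text \<open>The valuation at which letter \<open>n\<close> is answered: after the delay and before
  the resets of that move.\<close>

definition val :: "(nat \<Rightarrow> nat) \<Rightarrow> (nat \<Rightarrow> real) \<Rightarrow> nat \<Rightarrow> valuation" where
  "val a t n = delay (snd (ctrl_state \<delta> k m l0 a t n)) (t n - prev_time t n)"

lemma ctrl_state_Suc_val:
  obtains Y where "snd (ctrl_state \<delta> k m l0 a t (Suc n)) = reset Y (val a t n)"
proof -
  obtain l \<mu> where s: "ctrl_state \<delta> k m l0 a t n = (l, \<mu>)" by fastforce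
  obtain l' b Y where "\<delta> l (a n) (region k m (val a t n)) = (l', b, Y)" by (metis prod_cases3)
  then show thesis using that[of Y] by (simp add: val_def s Let_def)
qed

lemma val_later:
  assumes "p < q"
  shows "val a t q c = val a t p c + (t q - t p) \<or> (\<exists>j. p \<le> j \<and> j < q \<and> val a t q c = t q - t j)"
  using assms
proof (induction q)
  case (Suc q)
  obtain Y where Y: "snd (ctrl_state \<delta> k m l0 a t (Suc q)) = reset Y (val a t q)" by (rule ctrl_state_Suc_val)
  have v: "val a t (Suc q) c = (if c \<in> Y then 0 else val a t q c) + (t (Suc q) - t q)"
    unfolding val_def[of a t "Suc q"] Y by (simp add: delay_def reset_def prev_time_def)
  show ?case
  proof (cases "c \<in> Y")
    case True
    then show ?thesis using v Suc.prems by (intro disjI2 exI[of _ q]) auto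
  next
    case False
    show ?thesis
    proof (cases "p = q")
      case True
      then show ?thesis using v False by simp
    next
      case neq: False
      with Suc consider "val a t q c = val a t p c + (t q - t p)"
        | j where "p \<le> j" "j < q" "val a t q c = t q - t j" by auto
      then show ?thesis
      proof cases
        case 1
        then show ?thesis using v False by simp
      next
        case (2 j)
        then show ?thesis using v False by (intro disjI2 exI[of _ j]) auto
      qed
    qed
  qed
qed simp

text \<open>Every clock is integer-valued at no more than one of several ticks within one time unit.\<close>
lemma tick_without_integer_clock:
  assumes inc: "\<And>i j. N0 \<le> i \<Longrightarrow> i < j \<Longrightarrow> j < N0 + n \<Longrightarrow> t i < t j \<and> t j < t i + 1" and "k < n"
  shows "\<exists>q. N0 \<le> q \<and> q < N0 + n \<and> (\<forall>c<k. val a t q c \<notin> \<int>)"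
proof (rule ccontr)
  assume "\<not> ?thesis"
  then obtain f where f: "\<And>q. N0 \<le> q \<Longrightarrow> q < N0 + n \<Longrightarrow> f q < k \<and> val a t q (f q) \<in> \<int>" by metis
  have no: "d \<notin> \<int>" if "0 < d" "d < 1" for d :: real
    using that by (auto elim!: Ints_cases)
  \<comment> \<open>If two ticks shared an integer-valued clock, either their distance or the
    distance from a reset in between would be an integer, although it lies strictly between 0 and
    1.\<close>
  have "f p \<noteq> f q" if "N0 \<le> p" "p < q" "q < N0 + n" for p q
  proof
    assume e: "f p = f q"
    have ints: "val a t p (f q) \<in> \<int>" "val a t q (f q) \<in> \<int>" using f[of p] f[of q] e that by auto
    from val_later[OF that(2), of a t "f q"] show False
    proof
      assume "val a t q (f q) = val a t p (f q) + (t q - t p)"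
      then have "t q - t p = val a t q (f q) - val a t p (f q)" by simp
      then have "t q - t p \<in> \<int>" using ints by simp
      then show False using no[of "t q - t p"] inc[of p q] that by auto
    next
      assume "\<exists>j. p \<le> j \<and> j < q \<and> val a t q (f q) = t q - t j"
      then obtain j where "p \<le> j" "j < q" "val a t q (f q) = t q - t j" by blast
      then show False using no[of "t q - t j"] inc[of j q] that ints by auto
    qed
  qed
  then have "inj_on f {N0..<N0 + n}"
    by (intro inj_onI) (metis atLeastLessThan_iff linorder_neqE_nat)
  moreover have "f ` {N0..<N0 + n} \<subseteq> {..<k}" using f by auto
  ultimately have "card {N0..<N0 + n} \<le> card {..<k}" by (intro card_inj_on_le) auto
  then show False using assms(2) by simp
qed


text \<open>From \<open>M\<close> on, the ticks converge to \<open>t M\<close> from below.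
  Postponing tick \<open>i\<close> to \<open>t M\<close> would make it a legitimate copy of the same
  original as tick \<open>M\<close>, so it must not be claimed there. As no clock meets an integer
  in the meantime, the controller sees the same region at the actual time and gives the same
  answer.\<close>

lemma zeno_no_claim:
  assumes leg: "legit a t M" and na0: "a M \<noteq> 0" "a M \<noteq> 1" "a M \<in> letters (content_bound P)" and M: "0 < M"
    and a: "\<And>i. i < M \<Longrightarrow> a i \<in> letters (content_bound P)"
    and t: "0 \<le> t 0" "\<And>i. i < M \<Longrightarrow> t i < t (Suc i)"
    and ans: "\<And>i. i < M \<Longrightarrow> ctrl_answer \<delta> k m l0 a t i = 0"
    and \<epsilon>: "0 < \<epsilon>" "\<epsilon> < 1" "\<epsilon> < t M - t (M - 1)" "\<And>c. c < k \<Longrightarrow> \<epsilon> < frac (val a t M c)"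
    and a': "\<And>i. a' i = (if i < M then a i else a M)"
    and t': "\<And>i. t' i = (if i < M then t i else t M - \<epsilon> / (real (i - M) + 2))"
  shows "ctrl_answer \<delta> k m l0 a' t' i = 0 \<and> t' i < t' (Suc i) \<and> 0 \<le> t' 0"
proof -
  have gap: "0 < \<epsilon> / (real d + 2)" "\<epsilon> / (real d + 2) < \<epsilon>" for d
    using \<epsilon>(1) by (auto simp: field_simps add_pos_nonneg)
  have gap_dec: "\<epsilon> / (real d + 3) < \<epsilon> / (real d + 2)" for d
    using \<epsilon>(1) by (intro divide_strict_left_mono) auto
  have t0: "0 \<le> t' 0" using t(1) M by (simp add: t')
  have inc: "t' i < t' (Suc i)" for i
  proof -
    consider "Suc i < M" | "Suc i = M" | "M \<le> i" by linarith
    then show ?thesis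
    proof cases
      case 1
      then show ?thesis using t(2)[of i] by (simp add: t')
    next
      case 2
      then have "M - 1 = i" by simp
      then show ?thesis using \<epsilon>(3) gap(2)[of 0] 2 by (simp add: t')
    next
      case 3
      then obtain d where d: "i = M + d" using le_Suc_ex by blast
      have "real (Suc d) + 2 = real d + 3" by simp
      then have "\<epsilon> / (real (Suc d) + 2) < \<epsilon> / (real d + 2)" using gap_dec[of d] by metis
      then show ?thesis unfolding d by (simp add: t' Suc_diff_le)
    qed
  qed
  have below: "t' i < t M" for i
  proof (cases "i < M")
    case True
    have "t i < t M" using True
    proof (induction "M - i" arbitrary: i)
      case (Suc d)
      show ?case
      proof (cases "Suc i = M")
        case True
        then show ?thesis using t(2)[of i] by auto
      next
        case False
        then have "t (Suc i) < t M" using Suc by auto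
        then show ?thesis using t(2)[of i] Suc.prems by linarith
      qed
    qed simp
    then show ?thesis using True by (simp add: t')
  next
    case False
    then show ?thesis using gap(1)[of "i - M"] by (simp add: t')
  qed
  have pre: "ctrl_state \<delta> k m l0 a' t' M = ctrl_state \<delta> k m l0 a t M"
    by (rule ctrl_state_cong) (simp add: a' t')
  have ptM: "prev_time t' M = prev_time t M" using M by (simp add: prev_time_def t')
  text \<open>No clock crosses an integer between the current tick and time \<open>t M\<close>.\<close>
  have inv: "\<exists>N::int. of_int N < val a' t' (M + d) c \<and>
      val a' t' (M + d) c + (t M - t' (M + d)) < of_int N + 1" if c: "c < k" for c d
  proof (induction d)
    case 0
    have e: "val a' t' M c + (t M - t' M) = val a t M c"
      by (simp add: val_def pre ptM delay_def)
    have "t M - t' M < \<epsilon>" using gap(2)[of 0] by (simp add: t')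
    then have "t M - t' M < frac (val a t M c)" using \<epsilon>(4)[OF c] by linarith
    then have "of_int \<lfloor>val a t M c\<rfloor> < val a' t' M c" using e by (simp add: frac_def)
    moreover have "val a t M c < of_int \<lfloor>val a t M c\<rfloor> + 1" by linarith
    ultimately show ?case using e by (intro exI[of _ "\<lfloor>val a t M c\<rfloor>"]) simp
  next
    case (Suc d)
    obtain Y where Y: "snd (ctrl_state \<delta> k m l0 a' t' (Suc (M + d))) = reset Y (val a' t' (M + d))"
      by (rule ctrl_state_Suc_val)
    have v: "val a' t' (M + Suc d) c = (if c \<in> Y then 0 else val a' t' (M + d) c) + (t' (M + Suc d) - t' (M + d))"
      using Y unfolding val_def[of a' t' "M + Suc d"] by (simp add: delay_def reset_def prev_time_def)
    show ?case
    proof (cases "c \<in> Y")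
      case True
      \<comment> \<open>A clock reset at one of the inserted ticks is positive at the next one and
        stays below 1 up to time \<open>t M\<close>, so the interval with \<open>N = 0\<close>
        works.\<close>
      have "t M - t' (M + d) < 1" using gap(2)[of d] \<epsilon>(2) by (simp add: t')
      then show ?thesis using v True inc[of "M + d"] by (intro exI[of _ 0]) simp
    next
      case False
      obtain N :: int where "of_int N < val a' t' (M + d) c" "val a' t' (M + d) c + (t M - t' (M + d)) < of_int N + 1"
        using Suc by blast
      then show ?thesis using v False inc[of "M + d"] by (intro exI[of _ N]) simp
    qed
  qed
  have "ctrl_answer \<delta> k m l0 a' t' i = 0" for i
  proof (induction i rule: less_induct)
    case (less i)
    show ?case
    proof (cases "i < M")
      case True
      have "ctrl_answer \<delta> k m l0 a' t' i = ctrl_answer \<delta> k m l0 a t i"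
        using True by (intro ctrl_answer_cong) (auto simp: a' t')
      then show ?thesis using ans True by simp
    next
      case False
      \<comment> \<open>The same play with tick \<open>i\<close> alone postponed to the
        limit.\<close>
      define t'' where "t'' = t'(i := t M)"
      have "ctrl_answer \<delta> k m l0 a' t'' i = 0"
      proof (rule no_claim_at_legit)
        have "\<not> (M = 0 \<and> a 0 = 0)" using M by simp
        then obtain j where j: "j < M" "t j = t M - 1" "matches (a j) (a M)" "hc a (Suc j) (Suc M) = 1"
          using leg na0(2) unfolding legit_def by blast
        have eq: "hc a' (Suc j) M = hc a (Suc j) M"
          unfolding hc_def by (rule arg_cong[where f = card]) (auto simp: a')
        have "hc a' (Suc j) (M + d) = 1" for d
        proof (induction d)
          case 0
          show ?case using eq j(1,4) na0(1) by (simp add: hc_Suc)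
        next
          case (Suc d)
          then show ?case using j(1) na0(1) by (simp add: hc_Suc a')
        qed
        from this[of "Suc i - M"] have "hc a' (Suc j) (Suc i) = 1" using False by simp
        then show "legit a' t'' i" unfolding legit_def using j False
          by (intro disjI2 exI[of _ j]) (auto simp: a' t' t''_def)
        show "0 \<le> t'' 0" using t0 M False by (simp add: t''_def)
        show "t'' n \<le> t'' (Suc n)" if "n < i" for n
          using that inc[of n] below[of n] by (auto simp: t''_def less_imp_le)
        show "a' n \<in> letters (content_bound P)" for n using a na0 by (simp add: a')
        show "ctrl_answer \<delta> k m l0 a' t'' n = 0" if "n < i" for n
        proof -
          have "ctrl_answer \<delta> k m l0 a' t'' n = ctrl_answer \<delta> k m l0 a' t' n"
            using that by (intro ctrl_answer_cong) (auto simp: t''_def)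
          then show ?thesis using less that by simp
        qed
      qed
      moreover have "region k m (val a' t'' i) = region k m (val a' t' i)"
      proof -
        have st: "ctrl_state \<delta> k m l0 a' t'' i = ctrl_state \<delta> k m l0 a' t' i"
          by (rule ctrl_state_cong) (simp add: t''_def)
        have "prev_time t'' i = prev_time t' i" using M False by (cases i) (auto simp: prev_time_def t''_def)
        moreover have "t'' i = t M" by (simp add: t''_def)
        ultimately have "val a' t'' i = delay (val a' t' i) (t M - t' i)"
          by (simp add: val_def st delay_def fun_eq_iff)
        moreover have "region k m (delay (val a' t' i) (t M - t' i)) = region k m (val a' t' i)"
          by (rule region_eqI) (use inv[of _ "i - M"] below[of i] False in \<open>auto simp: less_imp_le\<close>)
        ultimately show ?thesis by simp
      qed
      moreover have "ctrl_state \<delta> k m l0 a' t'' i = ctrl_state \<delta> k m l0 a' t' i"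
        by (rule ctrl_state_cong) (simp add: t''_def)
      ultimately show ?thesis unfolding ctrl_answer_def val_def by (simp split: prod.splits)
    qed
  qed
  then show ?thesis using inc t0 by blast
qed

lemma winning_halts: "halts P x"
proof (rule ccontr)
  assume nh: "\<not> halts P x"
  \<comment> \<open>One cell more than there are clocks, as the pigeonhole argument
    requires.\<close>
  let ?n = "Suc k"
  obtain us where R: "reach P x LFin (replicate ?n 0) us" using reach_LFin[OF nh] by blast
  let ?b = "real (length us) + 1"
  let ?c = "cell 0 0"
  let ?u = "replicate ?n ?c"
  let ?pw = "prefix_word us"
  let ?w = "?pw @ tcells ?b ?u"
  note h0 = reach_hon[OF R, THEN conjunct1] and us = reach_hon[OF R, THEN conjunct2]
  have loop: "bstep P x LFin ?c LFin" using content_bound_ge[of P] by (intro bbase_bstep b_fin) auto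
  then have "path P x LFin ?u LFin" by (intro path_loop) auto
  moreover have "copies (replicate ?n 0) ?u" by (auto simp: copies_def)
  ultimately have h: "hon P x ?w LFin" using prefix_word_config[OF h0 _ _ us] by blast
  let ?N = "length ?pw"
  define a where "a i = fst (?w ! i)" for i
  define t where "t i = snd (?w ! i)" for i
  have wm: "?w = map (\<lambda>i. (a i, t i)) [0..<length ?w]"
    unfolding a_def t_def by (simp only: prod.collapse map_nth)
  have w0m: "?pw = map (\<lambda>i. (a i, t i)) [0..<?N]"
    by (rule nth_equalityI) (simp_all add: a_def t_def nth_append del: tcells.simps replicate.simps)
  have lw: "length ?w = ?N + ?n" by simp
  have props: "legit a t j" "a j \<in> letters (content_bound P)" "prev_time t j < t j" if "j < ?N + ?n" for j
    using hon_props[OF h wm] that unfolding lw by blast+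
  obtain ls where ls: "ls 0 = LB" "\<And>i. i < ?N \<Longrightarrow> bstep P x (ls i) (a i) (ls (Suc i))" "ls ?N = LFin"
    using hon_props[OF h0 w0m] by blast
  have N0: "0 < ?N" by (simp add: prefix_word_def)
  have inc1: "t i < t (Suc i)" if "Suc i < ?N + ?n" for i
    using props(3)[OF that] by (simp add: prev_time_def)
  have incr: "t i < t j" if "i < j" "j < ?N + ?n" for i j
    using that
  proof (induction j)
    case (Suc j)
    then show ?case using inc1[of j] by (cases "i = j") auto
  qed simp
  have cells: "a i = ?c \<and> ?b < t i \<and> t i < ?b + 1" if "?N \<le> i" "i < ?N + ?n" for i
  proof -
    have i: "i - ?N < ?n" using that by simp
    have wi: "?w ! i = tcells ?b ?u ! (i - ?N)" using that by (simp add: nth_append del: tcells.simps replicate.simps)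
    have "tcells ?b ?u ! (i - ?N) \<in> set (tcells ?b ?u)" using i by (intro nth_mem) (simp del: tcells.simps replicate.simps)
    moreover have "fst (tcells ?b ?u ! (i - ?N)) = ?c"
      using i map_fst_tcells[of ?b ?u] by (metis length_replicate length_tcells nth_map nth_replicate)
    ultimately show ?thesis using tcells_bounds[of "tcells ?b ?u ! (i - ?N)" ?b ?u] unfolding a_def t_def wi by blast
  qed
  have "\<exists>q. ?N \<le> q \<and> q < ?N + ?n \<and> (\<forall>c<k. val a t q c \<notin> \<int>)"
  proof (rule tick_without_integer_clock)
    fix i j assume ij: "?N \<le> i" "i < j" "j < ?N + ?n"
    then show "t i < t j \<and> t j < t i + 1" using incr[of i j] cells[of i] cells[of j] by auto
  qed simp
  then obtain M where M: "?N \<le> M" "M < ?N + ?n" "\<And>c. c < k \<Longrightarrow> val a t M c \<notin> \<int>" by blast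
  have M0: "0 < M" using M(1) N0 by linarith
  \<comment> \<open>The bounds that \<open>\<epsilon>\<close> must respect: 1 for freshly reset
    clocks, the gap before tick \<open>M\<close> for monotonicity, and the fractional parts so that
    no clock crosses an integer. Half the minimum is strictly below all of them.\<close>
  define E where "E = insert 1 (insert (t M - t (M - 1)) ((\<lambda>c. frac (val a t M c)) ` {..<k}))"
  have "0 < e" if "e \<in> E" for e
    using that incr[of "M - 1" M] M M0 by (auto simp: E_def frac_gt_0_iff)
  moreover have E: "finite E" "E \<noteq> {}" by (auto simp: E_def)
  ultimately have "0 < Min E" by simp
  define \<epsilon> where "\<epsilon> = Min E / 2"
  have \<epsilon>: "0 < \<epsilon>" "\<And>e. e \<in> E \<Longrightarrow> \<epsilon> < e"
    using \<open>0 < Min E\<close> Min_le[OF E(1)] by (auto simp: \<epsilon>_def) (smt (verit) field_sum_of_halves)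
  define a' where "a' i = (if i < M then a i else a M)" for i
  define t' where "t' i = (if i < M then t i else t M - \<epsilon> / (real (i - M) + 2))" for i
  have aM: "a M = ?c" using cells M by blast
  have Z: "ctrl_answer \<delta> k m l0 a' t' i = 0 \<and> t' i < t' (Suc i) \<and> 0 \<le> t' 0" for i
  proof (rule zeno_no_claim[of a t M])
    show "ctrl_answer \<delta> k m l0 a t i = 0" if "i < M" for i
      using hon_no_claim[OF h wm] that M lw by simp
    show "t i < t (Suc i)" if "i < M" for i using inc1[of i] that M by simp
    show "0 \<le> t 0" using props(3)[of 0] by (simp add: prev_time_def)
    show "a M \<in> letters (content_bound P)" using props(2) M by blast
  qed (use aM M M0 props \<epsilon> in \<open>auto simp: a'_def t'_def E_def\<close>)
  have t0: "0 < t' 0" using props(3)[of 0] M0 by (simp add: t'_def prev_time_def)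
  \<comment> \<open>The automaton never leaves \<open>LFin\<close> after the last header, since all
    letters from there on, inserted ones included, are the same cell.\<close>
  define ls' where "ls' i = (if i \<le> ?N then ls i else LFin)" for i
  have a'c: "a' i = ?c" if "?N \<le> i" for i using that cells[of i] M aM by (auto simp: a'_def)
  have "(\<lambda>i. ((a' i, 0), t' i)) \<in> ta_lang (automaton P x)"
  proof (rule automaton_lang_unclaimed[where ls = ls'])
    fix i
    show "bstep P x (ls' i) (a' i) (ls' (Suc i))"
    proof (cases "i < ?N")
      case True
      then show ?thesis using ls(2) M(1) by (auto simp: ls'_def a'_def)
    next
      case False
      then show ?thesis using a'c[of i] loop ls(3) by (auto simp: ls'_def)
    qed
    show "\<exists>\<^sub>\<infinity>i. ls' i = LFin" unfolding INFM_nat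
    proof
      fix n
      show "\<exists>i>n. ls' i = LFin" by (intro exI[of _ "Suc (n + ?N)"]) (simp add: ls'_def)
    qed
  qed (use ls(1) t0 Z in \<open>auto simp: ls'_def\<close>)
  then have "(\<lambda>i. ((a' i, ctrl_answer \<delta> k m l0 a' t' i), t' i)) \<in> ta_lang (automaton P x)"
    by (simp only: Z[THEN conjunct1])
  moreover have "a' i \<in> {..<na}" for i
  proof -
    have "a (min i M) \<in> letters (content_bound P)" using M(2) by (intro props(2)) linarith
    then show ?thesis using na by (auto simp: a'_def min_def split: if_splits)
  qed
  moreover have "t' i \<le> t' (Suc i)" for i using Z[of i] by simp
  ultimately show False using win Z unfolding winning_controller_def by blast
qed

end

section \<open>Computing the instance\<close>

fun rconst :: "nat \<Rightarrow> recf" where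
  "rconst 0 = RZ"
| "rconst (Suc n) = RCn RS [rconst n]"

definition radd :: recf where "radd = RPr (RId 0) (RCn RS [RId 1])"
definition rtri :: recf where "rtri = RPr RZ (RCn radd [RId 1, RCn RS [RId 0]])"
definition rpair :: recf where "rpair = RCn radd [RCn rtri [radd], RId 0]"
definition rcons :: "recf \<Rightarrow> recf \<Rightarrow> recf" where "rcons f g = RCn RS [RCn rpair [f, g]]"
definition rdouble :: "recf \<Rightarrow> recf" where "rdouble f = RCn radd [f, f]"

lemma eval_Cn1: "eval g xs y \<Longrightarrow> eval f [y] z \<Longrightarrow> eval (RCn f [g]) xs z"
  by (rule eval_Cn[where ys = "[y]"]) auto

lemma eval_Cn2: "eval g xs y \<Longrightarrow> eval h xs y' \<Longrightarrow> eval f [y, y'] z \<Longrightarrow> eval (RCn f [g, h]) xs z"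
  by (rule eval_Cn[where ys = "[y, y']"]) auto

lemma eval_Id_eq: "n < length xs \<Longrightarrow> xs ! n = y \<Longrightarrow> eval (RId n) xs y"
  using eval_Id by auto

lemma eval_rconst: "eval (rconst n) xs n"
  by (induction n) (auto intro: eval_Z eval_Cn1 eval_S)

lemma eval_radd: "eval radd [n, y] (n + y)"
proof (induction n)
  case 0
  show ?case unfolding radd_def by (rule eval_Pr0) (simp add: eval_Id_eq)
next
  case (Suc n)
  have "eval (RCn RS [RId 1]) [n, n + y, y] (Suc (n + y))"
    by (rule eval_Cn1[OF eval_Id_eq eval_S]) simp_all
  then show ?case using Suc unfolding radd_def by (auto intro: eval_PrS)
qed

lemma eval_rtri: "eval rtri [n] (triangle n)"
proof (induction n)
  case 0
  show ?case unfolding rtri_def by (rule eval_Pr0) (simp add: eval_Z)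
next
  case (Suc n)
  have "eval (RCn RS [RId 0]) [n, triangle n] (Suc n)"
    by (rule eval_Cn1[OF eval_Id_eq eval_S]) simp_all
  then have "eval (RCn radd [RId 1, RCn RS [RId 0]]) [n, triangle n] (triangle n + Suc n)"
    by (rule eval_Cn2[OF eval_Id_eq _ eval_radd, rotated 2]) simp_all
  then show ?case using Suc unfolding rtri_def by (auto intro: eval_PrS)
qed

lemma eval_rpair: "eval rpair [a, b] (prod_encode (a, b))"
proof -
  have "eval (RCn rtri [radd]) [a, b] (triangle (a + b))" by (rule eval_Cn1[OF eval_radd eval_rtri])
  then have "eval rpair [a, b] (triangle (a + b) + a)"
    unfolding rpair_def by (rule eval_Cn2[OF _ eval_Id_eq eval_radd]) simp_all
  then show ?thesis by (simp add: prod_encode_def)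
qed

lemma eval_rcons: "eval f xs y \<Longrightarrow> eval g xs (list_encode ys) \<Longrightarrow> eval (rcons f g) xs (list_encode (y # ys))"
  unfolding rcons_def by (auto intro!: eval_Cn1[OF eval_Cn2[OF _ _ eval_rpair] eval_S])

lemma eval_rdouble: "eval f xs y \<Longrightarrow> eval (rdouble f) xs (2 * y)"
  unfolding rdouble_def mult_2 by (rule eval_Cn2[OF _ _ eval_radd])

lemma eval_rnil: "eval (rconst 0) xs (list_encode [])"
  using eval_rconst[of 0 xs] by simp

definition rrule :: "recf \<Rightarrow> nat \<Rightarrow> recf \<Rightarrow> recf" where
  "rrule src l tgt = rcons src (rcons (rconst (enc_letter (Some (l, 0)))) (rcons (rconst (enc_ccon gpos))
     (rcons (rconst (list_encode [0])) (rcons tgt (rconst 0)))))"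

lemma eval_rrule:
  assumes "eval src xs (lenc l)" "eval tgt xs (lenc l')"
  shows "eval (rrule src a tgt) xs (enc_rule (mk_rule l a 0 gpos True l'))"
  unfolding rrule_def enc_rule_def mk_rule_def prod.case if_True
  by (intro eval_rcons eval_rnil eval_rconst assms)

text \<open>The parameter plays two parts: as a list code it is the tail to which rules are
  prepended, and as a number it is the input that fixes the target \<open>Lc p\<close> of the rule
  from \<open>LF\<close>. The recursion adds two loading rules per unit of input.\<close>

definition rchain :: recf where
  "rchain = RPr (rcons (rrule (rconst (lenc LF)) 1 (rdouble (RId 0))) (RId 0))
     (rcons (rrule (rdouble (RCn RS [RId 0])) (cell 0 2) (rdouble (RId 0)))
       (rcons (rrule (rdouble (RCn RS [RId 0])) 0 (rconst (lenc LX))) (RId 1)))"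

lemma eval_rchain:
  assumes p: "p = list_encode (map enc_rule bs)"
  shows "eval rchain [n, p] (list_encode (map enc_rule (chain n @ mk_rule LF 1 0 gpos True (Lc p) # bs)))"
proof (induction n)
  case 0
  have "eval (rcons (rrule (rconst (lenc LF)) 1 (rdouble (RId 0))) (RId 0)) [p]
     (list_encode (enc_rule (mk_rule LF 1 0 gpos True (Lc p)) # map enc_rule bs))"
    by (intro eval_rcons eval_rrule eval_rconst) (auto intro!: eval_rdouble eval_Id_eq simp: p)
  then show ?case unfolding rchain_def by (intro eval_Pr0) simp
next
  case (Suc n)
  let ?y = "list_encode (map enc_rule (chain n @ mk_rule LF 1 0 gpos True (Lc p) # bs))"
  have S: "eval (RCn RS [RId 0]) [n, ?y, p] (Suc n)"
    by (rule eval_Cn1[OF eval_Id_eq eval_S]) simp_all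
  have src: "eval (rdouble (RCn RS [RId 0])) [n, ?y, p] (lenc (Lc (Suc n)))"
    using eval_rdouble[OF S] by simp
  have "eval (rdouble (RId 0)) [n, ?y, p] (2 * n)" by (intro eval_rdouble eval_Id_eq) simp_all
  then have tgt: "eval (rdouble (RId 0)) [n, ?y, p] (lenc (Lc n))" by simp
  have "eval (rcons (rrule (rdouble (RCn RS [RId 0])) (cell 0 2) (rdouble (RId 0)))
       (rcons (rrule (rdouble (RCn RS [RId 0])) 0 (rconst (lenc LX))) (RId 1))) [n, ?y, p]
     (list_encode (enc_rule (mk_rule (Lc (Suc n)) (cell 0 2) 0 gpos True (Lc n)) #
       enc_rule (mk_rule (Lc (Suc n)) 0 0 gpos True LX) #
       map enc_rule (chain n @ mk_rule LF 1 0 gpos True (Lc p) # bs)))"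
    by (intro eval_rcons eval_rrule eval_rconst src tgt eval_Id_eq) simp_all
  then show ?case using Suc unfolding rchain_def chain.simps append_Cons list.map by (rule eval_PrS[rotated])
qed

definition instance_of :: "ins list \<Rightarrow> nat \<Rightarrow> tinst" where
  "instance_of P x = (2 * x + 2, 2, automaton P x)"

text \<open>A program is coded by the automaton rules that do not depend on its input; the instance is
  then computed from the code by adding the few remaining rules.\<close>
definition prog_code :: "ins list \<Rightarrow> nat" where
  "prog_code P = list_encode (map enc_rule (base_rules P))"

definition rinstance :: recf where
  "rinstance = (let n = RCn RS [RCn RS [rdouble (RId 0)]] in
     rcons n (rcons (rconst 2) (rcons (rcons n (rcons (rconst 1)
       (rcons (rconst (list_encode [lenc LS, lenc LA, lenc LB]))
       (rcons (rconst (list_encode [lenc LAcc, lenc LFin]))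
       (rcons (RCn rchain [RId 0, RId 0]) (rconst 0)))))) (rconst 0))))"

lemma eval_rinstance:
  "eval rinstance [prog_code P] (enc_instance (instance_of P (prog_code P)))"
proof -
  let ?p = "prog_code P"
  have "eval (RCn RS [RCn RS [rdouble (RId 0)]]) [?p] (Suc (Suc (2 * ?p)))"
    by (intro eval_Cn1[OF eval_Cn1[OF eval_rdouble[OF eval_Id_eq] eval_S] eval_S]) simp_all
  then have n: "eval (RCn RS [RCn RS [rdouble (RId 0)]]) [?p] (2 * ?p + 2)" by simp
  have c: "eval (RCn rchain [RId 0, RId 0]) [?p] (list_encode (map enc_rule (ta_rules (automaton P ?p))))"
    unfolding automaton_def ta.simps
    by (rule eval_Cn2[OF eval_Id_eq eval_Id_eq eval_rchain]) (simp_all add: prog_code_def)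
  have i: "eval (rconst (list_encode [lenc LS, lenc LA, lenc LB])) [?p] (list_encode (ta_init (automaton P ?p)))"
    "eval (rconst (list_encode [lenc LAcc, lenc LFin])) [?p] (list_encode (ta_fin (automaton P ?p)))"
    "eval (rconst 1) [?p] (ta_nclk (automaton P ?p))"
    "eval (RCn RS [RCn RS [rdouble (RId 0)]]) [?p] (ta_nloc (automaton P ?p))"
    unfolding automaton_def ta.simps by (rule eval_rconst n)+
  show ?thesis
    unfolding rinstance_def Let_def enc_instance_def instance_of_def prod.case enc_ta_def
    by (intro eval_rcons eval_rnil i c n eval_rconst)
qed

text \<open>Pairing dominates its components and a nonempty list code adds a successor, so a code
  exceeds every entry. This bounds all numbers in the rules by the code of the program.\<close>

lemma mem_list_encode: "y \<in> set ys \<Longrightarrow> y < list_encode ys"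
proof (induction ys)
  case (Cons z ys)
  show ?case
  proof (cases "y = z")
    case True
    then show ?thesis using le_prod_encode_1[of z "list_encode ys"] by simp
  next
    case False
    then show ?thesis using Cons le_prod_encode_2[of "list_encode ys" z] by simp
  qed
qed simp

lemma base_rule_bounds:
  assumes "mk_rule l a b g res l' \<in> set (base_rules P)"
  shows "lenc l < prog_code P" "lenc l' < prog_code P" "a < prog_code P"
proof -
  let ?r = "enc_rule (mk_rule l a b g res l')"
  have r: "?r < prog_code P" unfolding prog_code_def using assms by (intro mem_list_encode) simp
  have "lenc l < ?r" "lenc l' < ?r" "enc_letter (Some (a, b)) < ?r"
    unfolding enc_rule_def mk_rule_def prod.case by (rule mem_list_encode, simp)+
  moreover have "a < enc_letter (Some (a, b))" using le_prod_encode_1[of a b] by (simp add: less_Suc_eq_le)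
  ultimately show "lenc l < prog_code P" "lenc l' < prog_code P" "a < prog_code P" using r by linarith+
qed

lemma base_bbase: "bbase P l a l' \<Longrightarrow> mk_rule l a 0 gpos True l' \<in> set (base_rules P)"
  unfolding set_base_rules base_set_def by blast

lemma base_aux: "aux (content_bound P) l a b g res l' \<Longrightarrow> mk_rule l a b g res l' \<in> set (base_rules P)"
  unfolding set_base_rules base_set_def by blast

lemma letters_bound: "letters (content_bound P) \<subseteq> {..<prog_code P}"
  using base_rule_bounds(3)[OF base_aux[OF aux_wait]] by blast

text \<open>Since a code exceeds whatever it codes, taking the code itself as input makes it large
  enough to bound all letters and locations; nothing about the size of the automaton has to be
  counted.\<close>

lemma wf_instance_of: "wf_instance (instance_of P (prog_code P))"
proof -
  let ?p = "prog_code P"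
  let ?N = "2 * ?p + 2"
  have "lenc LS < ?p" "lenc LA < ?p" "lenc LAcc < ?p" "lenc LB < ?p" "lenc LF < ?p" "lenc LX < ?p" "lenc LFin < ?p"
    using base_rule_bounds(1,2)[OF base_aux[OF aux_first]] base_rule_bounds(1)[OF base_aux[OF aux_fresh]]
      base_rule_bounds(1,2)[OF base_bbase[OF b_init]] base_rule_bounds(1)[OF base_bbase[OF b_restarted[of LF]]]
      base_rule_bounds(2)[OF base_bbase[OF b_restarted[of LFin]]] by blast+
  then have l: "lenc LS < ?N" "lenc LA < ?N" "lenc LAcc < ?N" "lenc LB < ?N" "lenc LF < ?N" "lenc LX < ?N" "lenc LFin < ?N"
    by linarith+
  have "cell 0 2 \<in> letters (content_bound P)" using content_bound_ge[of P] by (auto simp: letters_def)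
  then have c: "cell 0 2 < ?N" using letters_bound[of P] by auto
  have rule: "rule_src r < ?N \<and> rule_tgt r < ?N \<and> (\<forall>a b. rule_letter r = Some (a, b) \<longrightarrow> a < ?N \<and> b < 2) \<and>
      ccon_clocks (rule_guard r) \<subseteq> {..<1} \<and> rule_resets r \<subseteq> {..<1}"
    if r: "r \<in> set (ta_rules (automaton P ?p))" for r
  proof -
    consider "r \<in> set (chain ?p)" | "r = mk_rule LF 1 0 gpos True (Lc ?p)" | "r \<in> set (base_rules P)"
      using r by (auto simp: automaton_def)
    then show ?thesis
    proof cases
      case 1
      then show ?thesis using l c by (auto simp: set_chain gpos_def)
    next
      case 2
      then show ?thesis using l by (auto simp: gpos_def)
    next
      case 3
      then obtain l a b g res l' where e: "r = mk_rule l a b g res l'"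
        "bbase P l a l' \<and> b = 0 \<and> g = gpos \<or> aux (content_bound P) l a b g res l'"
        unfolding set_base_rules base_set_def by blast
      have "b < 2" "ccon_clocks g \<subseteq> {..<1}"
        using e(2) by (auto simp: gpos_def gone_def elim: aux.cases)
      moreover have "lenc l < ?N" "lenc l' < ?N" "a < ?N"
        using base_rule_bounds[OF 3[unfolded e(1)]] by linarith+
      ultimately show ?thesis unfolding e(1) mk_rule_simps by simp
    qed
  qed
  then show ?thesis using l
    unfolding wf_instance_def instance_of_def prod.case wf_ta_def by (simp add: automaton_def)
qed

lemma one_clock_instance_of: "one_clock_no_eps (instance_of P x)"
  unfolding one_clock_no_eps_def instance_of_def prod.case
  using automaton_letter by (auto simp: automaton_def)

lemma controllable_iff_halts:
  "controllable (instance_of P (prog_code P)) \<longleftrightarrow> halts P (prog_code P)"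
proof
  let ?p = "prog_code P"
  assume "controllable (instance_of P ?p)"
  then obtain k m L l0 \<delta> where
    win: "winning_controller {..<2 * ?p + 2} {..<2} (ta_lang (automaton P ?p)) k m L l0 \<delta>"
    unfolding controllable_def instance_of_def by auto
  have "letters (content_bound P) \<subseteq> {..<2 * ?p + 2}" using letters_bound[of P] by auto
  then show "halts P ?p" using winning_halts[OF win] by blast
next
  assume "halts P (prog_code P)"
  then show "controllable (instance_of P (prog_code P))"
    unfolding instance_of_def by (rule halts_controllable)
qed

lemma decidable_on_subset: "decidable_on D enc Q \<Longrightarrow> D' \<subseteq> D \<Longrightarrow> decidable_on D' enc Q"
  unfolding decidable_on_def by blast

text \<open>Diagonalisation: run on its own code, the program halts iff the supposed decision procedure
  rejects the instance built from that code.\<close>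
lemma one_clock_undecidable:
  "\<not> decidable_on {I. wf_instance I \<and> one_clock_no_eps I} enc_instance controllable"
proof
  assume "decidable_on {I. wf_instance I \<and> one_clock_no_eps I} enc_instance controllable"
  then obtain D where D: "\<And>I. wf_instance I \<Longrightarrow> one_clock_no_eps I \<Longrightarrow>
      eval D [enc_instance I] (if controllable I then 1 else 0)"
    unfolding decidable_on_def by blast
  define P where "P = diag_prog (RCn D [rinstance])"
  let ?I = "instance_of P (prog_code P)"
  have "eval (RCn D [rinstance]) [prog_code P] (if controllable ?I then 1 else 0)"
    using eval_rinstance D[OF wf_instance_of one_clock_instance_of] by (rule eval_Cn1)
  then have "halts P (prog_code P) \<longleftrightarrow> \<not> controllable ?I"
    unfolding P_def by (subst halts_diag_prog) (assumption, auto)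
  then show False using controllable_iff_halts by blast
qed

theorem theorem15:
  shows "\<not> decidable_on {I. wf_instance I} enc_instance controllable
       \<and> \<not> decidable_on {I. wf_instance I \<and> one_clock_no_eps I} enc_instance controllable"
proof
  show "\<not> decidable_on {I. wf_instance I} enc_instance controllable"
  proof
    assume "decidable_on {I. wf_instance I} enc_instance controllable"
    then have "decidable_on {I. wf_instance I \<and> one_clock_no_eps I} enc_instance controllable"
      by (rule decidable_on_subset) auto
    then show False using one_clock_undecidable by contradiction
  qed
qed (rule one_clock_undecidable)

end
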